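(* Let $\mathcal A,\mathcal B,\mathcal C$ be symmetric monoidal categories. The assignments $F\mapsto\bar F$, $\sigma\mapsto\bar\sigma$ define a functor $En:\mathrm{SMC}(\mathcal A,[\mathcal B,\mathcal C])\to\mathrm{SMC}(\mathcal A\otimes\mathcal B,\mathcal C)$ which factorises as $$\mathrm{SMC}(\mathcal A,[\mathcal B,\mathcal C])\xrightarrow{\ \cong\ }\mathrm{StrSMC}(\mathcal A\otimes\mathcal B,\mathcal C)\to\mathrm{SMC}(\mathcal A\otimes\mathcal B,\mathcal C),$$ where the first functor is an isomorphism of categories and the second is the inclusion.
   Context: **Basics.** All symmetric monoidal categories are small, with tensor $\otimes$, unit $I$ and natural isomorphisms $ass_{a,b,c}:a\otimes(b\otimes c)\to(a\otimes b)\otimes c$, $r_a:a\otimes I\to a$, $l_a:I\otimes a\to a$, $s_{a,b}:a\otimes b\to b\otimes a$ satisfying the usual coherence axioms. A symmetric monoidal functor $F:\mathcal A\to\mathcal B$ is a lax one: a functor with an arrow $F^0:I\to F(I)$ and a natural family $F^2_{x,y}:Fx\otimes Fy\to F(x\otimes y)$ satisfying the usual associativity, unit and symmetry axioms; it is strict if $F^0$ and all $F^2_{x,y}$ are identities. $\mathrm{SMC}$ is the 2-category of symmetric monoidal categories, symmetric monoidal functors and monoidal natural transformations; $\mathrm{StrSMC}$ is its sub-2-category with the same objects, strict symmetric monoidal functors as 1-cells, and all monoidal natural transformations between these as 2-cells. **Internal hom.** $[\mathcal A,\mathcal B]$ is the category $\mathrm{SMC}(\mathcal A,\mathcal B)$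 with the pointwise symmetric monoidal structure: $(F\Box G)(a)=Fa\otimes Ga$, $(F\Box G)^0$ is $I\cong I\otimes I\xrightarrow{F^0\otimes G^0}F(I)\otimes G(I)$, $(F\Box G)^2_{a,b}$ is the canonical interchange $(Fa\otimes Ga)\otimes(Fb\otimes Gb)\cong(Fa\otimes Fb)\otimes(Ga\otimes Gb)$ followed by $F^2_{a,b}\otimes G^2_{a,b}$; $(\sigma\Box\tau)_a=\sigma_a\otimes\tau_a$; the unit is the constant functor at $I_{\mathcal B}$ (with $I\to I$ the identity and $I\otimes I\to I$ the canonical arrow); $ass,r,l,s$ are pointwise. **Tensor.** $\mathcal A\otimes\mathcal B$ is the following symmetric monoidal category. Its objects are the formal words freely generated from a constant $I$ and symbols $a\otimes b$ ($a$ in $\mathcal A$, $b$ in $\mathcal B$) under a formal binary operation $X\otimes Y$. Its arrows are freely generated, under composition and the operations $p\mapsto X\otimes p$, $p\mapsto p\otimes X$ for objects $X$, by formal arrows $ass,r,l$ (with formal inverses) and $s$ for all objects, and by arrows $\alpha_b:I\to I_{\mathcal A}\otimes b$; $\beta_a:I\to a\otimes I_{\mathcal B}$; $\gamma_{a,a',b}:(a\otimes b)\otimes(a'\otimes b)\to(a\otimes a')\otimes b$; $\delta_{a,b,b'}:(a\otimes b)\otimes(a\otimes b')\to a\otimes(b\otimes b')$; $a\otimes g:a\otimes b\to a\otimes b'$ for $g:b\to b'$ in $\mathcal B$; $f\otimes b:a\otimes b\to a'\otimes b$ for $f:a\to a'$ in $\mathcal A$; modulo the smallest congruence, compatible with all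 $X\otimes-$ and $-\otimes X$, such that: (i) $\otimes$ is a bifunctor and $\otimes,I,ass,r,l,s$ form a symmetric monoidal structure; (ii) for each $a$, $b\mapsto a\otimes b$, $g\mapsto a\otimes g$ with structure $\beta_a$, $\delta_{a,-,-}$ is a symmetric monoidal functor $\mathcal B\to\mathcal A\otimes\mathcal B$; (iii) for each $b$, $a\mapsto a\otimes b$, $f\mapsto f\otimes b$ with structure $\alpha_b$, $\gamma_{-,-,b}$ is a symmetric monoidal functor $\mathcal A\to\mathcal A\otimes\mathcal B$; (iv) for each $f:a\to a'$ the family $(f\otimes b)_b$, and for each $g:b\to b'$ the family $(a\otimes g)_a$, is a monoidal natural transformation between the corresponding functors of (ii), resp. (iii); (v) with $c:I\otimes I\to I$ canonical, $\alpha_{b\otimes b'}\circ c=\delta_{I_{\mathcal A},b,b'}\circ(\alpha_b\otimes\alpha_{b'})$, $\beta_{a\otimes a'}\circ c=\gamma_{a,a',I_{\mathcal B}}\circ(\beta_a\otimes\beta_{a'})$, and $\beta_{I_{\mathcal A}}=\alpha_{I_{\mathcal B}}$; (vi) $\gamma_{a,a',b\otimes b'}\circ(\delta_{a,b,b'}\otimes\delta_{a',b,b'})=\delta_{a\otimes a',b,b'}\circ(\gamma_{a,a',b}\otimes\gamma_{a,a',b'})\circ m$, where $m$ is the canonical isomorphism exchanging the two middle factors $a\otimes b'$ and $a'\otimes b$. **$\bar F$ and $\bar\sigma$.** For $F:\mathcal A\to[\mathcal B,\mathcal C]$, $\bar F:\mathcal A\otimes\mathcal B\to\mathcal C$ is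 the strict symmetric monoidal functor with $I\mapsto I$, $a\otimes b\mapsto F(a)(b)$, $X\otimes Y\mapsto\bar F(X)\otimes\bar F(Y)$, canonical arrows to canonical arrows, $X\otimes p\mapsto 1\otimes\bar F(p)$, $p\otimes X\mapsto\bar F(p)\otimes1$, and $\alpha_b\mapsto(F^0)_b$, $\beta_a\mapsto(Fa)^0$, $\gamma_{a,a',b}\mapsto(F^2_{a,a'})_b$, $\delta_{a,b,b'}\mapsto(Fa)^2_{b,b'}$, $f\otimes b\mapsto F(f)_b$, $a\otimes g\mapsto F(a)(g)$. For a monoidal natural transformation $\sigma:F\to G$, $\bar\sigma$ has components $\bar\sigma_I=1$, $\bar\sigma_{a\otimes b}=(\sigma_a)_b$, $\bar\sigma_{X\otimes Y}=\bar\sigma_X\otimes\bar\sigma_Y$. *)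

theory Defs
  imports Main "HOL-Library.FuncSet"
begin

section \<open>Categories and functors\<close>

record ('o, 'm) cat =
  Obj :: "'o set"
  Arr :: "'m set"
  Dom :: "'m \<Rightarrow> 'o"
  Cod :: "'m \<Rightarrow> 'o"
  Idn :: "'o \<Rightarrow> 'm"
  Comp :: "'m \<Rightarrow> 'm \<Rightarrow> 'm" (infixr "\<cdot>\<index>" 55)

definition hom :: "('o, 'm, 'x) cat_scheme \<Rightarrow> 'o \<Rightarrow> 'o \<Rightarrow> 'm set" where
  "hom C a b = {f \<in> Arr C. Dom C f = a \<and> Cod C f = b}"

locale category =
  fixes C :: "('o, 'm, 'x) cat_scheme" (structure)
  assumes Dom_obj: "f \<in> Arr C \<Longrightarrow> Dom C f \<in> Obj C"
    and Cod_obj: "f \<in> Arr C \<Longrightarrow> Cod C f \<in> Obj C"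
    and Idn_hom: "a \<in> Obj C \<Longrightarrow> Idn C a \<in> hom C a a"
    and Comp_hom: "f \<in> hom C a b \<Longrightarrow> g \<in> hom C b c \<Longrightarrow> g \<cdot> f \<in> hom C a c"
    and Comp_Idn: "f \<in> hom C a b \<Longrightarrow> f \<cdot> Idn C a = f"
    and Idn_Comp: "f \<in> hom C a b \<Longrightarrow> Idn C b \<cdot> f = f"
    and Comp_assoc: "f \<in> hom C a b \<Longrightarrow> g \<in> hom C b c \<Longrightarrow> h \<in> hom C c d \<Longrightarrow>
      (h \<cdot> g) \<cdot> f = h \<cdot> (g \<cdot> f)"

definition is_inverse :: "('o, 'm, 'x) cat_scheme \<Rightarrow> 'm \<Rightarrow> 'm \<Rightarrow> bool" where
  "is_inverse C f g \<longleftrightarrow> g \<in> hom C (Cod C f) (Dom C f) \<and>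
     g \<cdot>\<^bsub>C\<^esub> f = Idn C (Dom C f) \<and> f \<cdot>\<^bsub>C\<^esub> g = Idn C (Cod C f)"

definition iso :: "('o, 'm, 'x) cat_scheme \<Rightarrow> 'm \<Rightarrow> bool" where
  "iso C f \<longleftrightarrow> f \<in> Arr C \<and> (\<exists>g. is_inverse C f g)"

definition inv_arr :: "('o, 'm, 'x) cat_scheme \<Rightarrow> 'm \<Rightarrow> 'm" where
  "inv_arr C f = (THE g. is_inverse C f g)"

record ('o1, 'm1, 'o2, 'm2) ftor =
  omap :: "'o1 \<Rightarrow> 'o2"
  amap :: "'m1 \<Rightarrow> 'm2"

text \<open>All maps that are part of a functor or of a natural transformation are required to be
  \<^const>\<open>undefined\<close> outside their domain, so that HOL equality is equality of functors and
  of transformations.\<close>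

locale cat_functor = A: category A + B: category B
  for A :: "('o1, 'm1, 'x) cat_scheme" and B :: "('o2, 'm2, 'y) cat_scheme"
    and F :: "('o1, 'm1, 'o2, 'm2, 'z) ftor_scheme" +
  assumes omap_obj: "a \<in> Obj A \<Longrightarrow> omap F a \<in> Obj B"
    and amap_hom: "f \<in> hom A a b \<Longrightarrow> amap F f \<in> hom B (omap F a) (omap F b)"
    and amap_Idn: "a \<in> Obj A \<Longrightarrow> amap F (Idn A a) = Idn B (omap F a)"
    and amap_Comp: "f \<in> hom A a b \<Longrightarrow> g \<in> hom A b c \<Longrightarrow>
      amap F (g \<cdot>\<^bsub>A\<^esub> f) = amap F g \<cdot>\<^bsub>B\<^esub> amap F f"
    and omap_ext: "omap F \<in> extensional (Obj A)"
    and amap_ext: "amap F \<in> extensional (Arr A)"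

definition ftor_id :: "('o, 'm, 'x) cat_scheme \<Rightarrow> ('o, 'm, 'o, 'm) ftor" where
  "ftor_id A = \<lparr>omap = (\<lambda>a \<in> Obj A. a), amap = (\<lambda>f \<in> Arr A. f)\<rparr>"

definition ftor_comp :: "('o1, 'm1, 'x) cat_scheme \<Rightarrow> ('o2, 'm2, 'o3, 'm3) ftor \<Rightarrow>
    ('o1, 'm1, 'o2, 'm2) ftor \<Rightarrow> ('o1, 'm1, 'o3, 'm3) ftor" where
  "ftor_comp A G F =
    \<lparr>omap = (\<lambda>a \<in> Obj A. omap G (omap F a)), amap = (\<lambda>f \<in> Arr A. amap G (amap F f))\<rparr>"

definition cat_iso :: "('o1, 'm1, 'x) cat_scheme \<Rightarrow> ('o2, 'm2, 'y) cat_scheme \<Rightarrow>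
    ('o1, 'm1, 'o2, 'm2) ftor \<Rightarrow> bool" where
  "cat_iso A B F \<longleftrightarrow> cat_functor A B F \<and>
     (\<exists>G. cat_functor B A G \<and> ftor_comp A G F = ftor_id A \<and> ftor_comp B F G = ftor_id B)"


section \<open>Symmetric monoidal categories\<close>

record ('o, 'm) smc = "('o, 'm) cat" +
  TenO :: "'o \<Rightarrow> 'o \<Rightarrow> 'o" (infixr "\<otimes>\<index>" 70)
  TenA :: "'m \<Rightarrow> 'm \<Rightarrow> 'm" (infixr "\<boxtimes>\<index>" 70)
  Unt :: "'o"
  Ass :: "'o \<Rightarrow> 'o \<Rightarrow> 'o \<Rightarrow> 'm"
  Run :: "'o \<Rightarrow> 'm"
  Lun :: "'o \<Rightarrow> 'm"
  Sym :: "'o \<Rightarrow> 'o \<Rightarrow> 'm"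

locale smc = category C
  for C :: "('o, 'm) smc" (structure) +
  assumes TenO_obj: "a \<in> Obj C \<Longrightarrow> b \<in> Obj C \<Longrightarrow> a \<otimes> b \<in> Obj C"
    and TenA_hom: "f \<in> hom C a a' \<Longrightarrow> g \<in> hom C b b' \<Longrightarrow> f \<boxtimes> g \<in> hom C (a \<otimes> b) (a' \<otimes> b')"
    and TenA_Idn: "a \<in> Obj C \<Longrightarrow> b \<in> Obj C \<Longrightarrow> Idn C a \<boxtimes> Idn C b = Idn C (a \<otimes> b)"
    and TenA_Comp: "f \<in> hom C a a' \<Longrightarrow> f' \<in> hom C a' a'' \<Longrightarrow>
      g \<in> hom C b b' \<Longrightarrow> g' \<in> hom C b' b'' \<Longrightarrow>
      (f' \<cdot> f) \<boxtimes> (g' \<cdot> g) = (f' \<boxtimes> g') \<cdot> (f \<boxtimes> g)"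
    and Unt_obj: "Unt C \<in> Obj C"
    and Ass_hom: "a \<in> Obj C \<Longrightarrow> b \<in> Obj C \<Longrightarrow> c \<in> Obj C \<Longrightarrow>
      Ass C a b c \<in> hom C (a \<otimes> (b \<otimes> c)) ((a \<otimes> b) \<otimes> c)"
    and Ass_iso: "a \<in> Obj C \<Longrightarrow> b \<in> Obj C \<Longrightarrow> c \<in> Obj C \<Longrightarrow> iso C (Ass C a b c)"
    and Ass_nat: "f \<in> hom C a a' \<Longrightarrow> g \<in> hom C b b' \<Longrightarrow> h \<in> hom C c c' \<Longrightarrow>
      Ass C a' b' c' \<cdot> (f \<boxtimes> (g \<boxtimes> h)) = ((f \<boxtimes> g) \<boxtimes> h) \<cdot> Ass C a b c"
    and Run_hom: "a \<in> Obj C \<Longrightarrow> Run C a \<in> hom C (a \<otimes> Unt C) a"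
    and Run_iso: "a \<in> Obj C \<Longrightarrow> iso C (Run C a)"
    and Run_nat: "f \<in> hom C a a' \<Longrightarrow> Run C a' \<cdot> (f \<boxtimes> Idn C (Unt C)) = f \<cdot> Run C a"
    and Lun_hom: "a \<in> Obj C \<Longrightarrow> Lun C a \<in> hom C (Unt C \<otimes> a) a"
    and Lun_iso: "a \<in> Obj C \<Longrightarrow> iso C (Lun C a)"
    and Lun_nat: "f \<in> hom C a a' \<Longrightarrow> Lun C a' \<cdot> (Idn C (Unt C) \<boxtimes> f) = f \<cdot> Lun C a"
    and Sym_hom: "a \<in> Obj C \<Longrightarrow> b \<in> Obj C \<Longrightarrow> Sym C a b \<in> hom C (a \<otimes> b) (b \<otimes> a)"
    and Sym_nat: "f \<in> hom C a a' \<Longrightarrow> g \<in> hom C b b' \<Longrightarrow>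
      Sym C a' b' \<cdot> (f \<boxtimes> g) = (g \<boxtimes> f) \<cdot> Sym C a b"
    and pentagon: "a \<in> Obj C \<Longrightarrow> b \<in> Obj C \<Longrightarrow> c \<in> Obj C \<Longrightarrow> d \<in> Obj C \<Longrightarrow>
      Ass C (a \<otimes> b) c d \<cdot> Ass C a b (c \<otimes> d) =
      (Ass C a b c \<boxtimes> Idn C d) \<cdot> Ass C a (b \<otimes> c) d \<cdot> (Idn C a \<boxtimes> Ass C b c d)"
    and triangle: "a \<in> Obj C \<Longrightarrow> b \<in> Obj C \<Longrightarrow>
      (Run C a \<boxtimes> Idn C b) \<cdot> Ass C a (Unt C) b = Idn C a \<boxtimes> Lun C b"
    and Sym_inv: "a \<in> Obj C \<Longrightarrow> b \<in> Obj C \<Longrightarrow> Sym C b a \<cdot> Sym C a b = Idn C (a \<otimes> b)"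
    and Sym_unit: "a \<in> Obj C \<Longrightarrow> Lun C a \<cdot> Sym C a (Unt C) = Run C a"
    and hexagon: "a \<in> Obj C \<Longrightarrow> b \<in> Obj C \<Longrightarrow> c \<in> Obj C \<Longrightarrow>
      Ass C c a b \<cdot> Sym C (a \<otimes> b) c \<cdot> Ass C a b c =
      (Sym C a c \<boxtimes> Idn C b) \<cdot> Ass C a c b \<cdot> (Idn C a \<boxtimes> Sym C b c)"

text \<open>The canonical isomorphism \<open>(a \<otimes> b) \<otimes> (c \<otimes> d) \<rightarrow> (a \<otimes> c) \<otimes> (b \<otimes> d)\<close>.\<close>

definition interchange :: "('o, 'm) smc \<Rightarrow> 'o \<Rightarrow> 'o \<Rightarrow> 'o \<Rightarrow> 'o \<Rightarrow> 'm" where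
  "interchange C a b c d =
     Ass C a c (b \<otimes>\<^bsub>C\<^esub> d) \<cdot>\<^bsub>C\<^esub>
     (Idn C a \<boxtimes>\<^bsub>C\<^esub> (inv_arr C (Ass C c b d) \<cdot>\<^bsub>C\<^esub>
       (Sym C b c \<boxtimes>\<^bsub>C\<^esub> Idn C d) \<cdot>\<^bsub>C\<^esub> Ass C b c d)) \<cdot>\<^bsub>C\<^esub>
     inv_arr C (Ass C a b (c \<otimes>\<^bsub>C\<^esub> d))"


section \<open>Symmetric monoidal functors and monoidal natural transformations\<close>

record ('o1, 'm1, 'o2, 'm2) smf = "('o1, 'm1, 'o2, 'm2) ftor" +
  phi0 :: 'm2
  phi2 :: "'o1 \<Rightarrow> 'o1 \<Rightarrow> 'm2"

locale sm_functor = cat_functor A B F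
  for A :: "('o1, 'm1) smc" and B :: "('o2, 'm2) smc" and F :: "('o1, 'm1, 'o2, 'm2) smf" +
  assumes phi0_hom: "phi0 F \<in> hom B (Unt B) (omap F (Unt A))"
    and phi2_hom: "x \<in> Obj A \<Longrightarrow> y \<in> Obj A \<Longrightarrow>
      phi2 F x y \<in> hom B (omap F x \<otimes>\<^bsub>B\<^esub> omap F y) (omap F (x \<otimes>\<^bsub>A\<^esub> y))"
    and phi2_nat: "f \<in> hom A x x' \<Longrightarrow> g \<in> hom A y y' \<Longrightarrow>
      phi2 F x' y' \<cdot>\<^bsub>B\<^esub> (amap F f \<boxtimes>\<^bsub>B\<^esub> amap F g) =
      amap F (f \<boxtimes>\<^bsub>A\<^esub> g) \<cdot>\<^bsub>B\<^esub> phi2 F x y"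
    and phi2_Ass: "x \<in> Obj A \<Longrightarrow> y \<in> Obj A \<Longrightarrow> z \<in> Obj A \<Longrightarrow>
      amap F (Ass A x y z) \<cdot>\<^bsub>B\<^esub> phi2 F x (y \<otimes>\<^bsub>A\<^esub> z) \<cdot>\<^bsub>B\<^esub>
        (Idn B (omap F x) \<boxtimes>\<^bsub>B\<^esub> phi2 F y z) =
      phi2 F (x \<otimes>\<^bsub>A\<^esub> y) z \<cdot>\<^bsub>B\<^esub> (phi2 F x y \<boxtimes>\<^bsub>B\<^esub> Idn B (omap F z)) \<cdot>\<^bsub>B\<^esub>
        Ass B (omap F x) (omap F y) (omap F z)"
    and phi2_Run: "x \<in> Obj A \<Longrightarrow>
      amap F (Run A x) \<cdot>\<^bsub>B\<^esub> phi2 F x (Unt A) \<cdot>\<^bsub>B\<^esub> (Idn B (omap F x) \<boxtimes>\<^bsub>B\<^esub> phi0 F) =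
      Run B (omap F x)"
    and phi2_Lun: "x \<in> Obj A \<Longrightarrow>
      amap F (Lun A x) \<cdot>\<^bsub>B\<^esub> phi2 F (Unt A) x \<cdot>\<^bsub>B\<^esub> (phi0 F \<boxtimes>\<^bsub>B\<^esub> Idn B (omap F x)) =
      Lun B (omap F x)"
    and phi2_Sym: "x \<in> Obj A \<Longrightarrow> y \<in> Obj A \<Longrightarrow>
      amap F (Sym A x y) \<cdot>\<^bsub>B\<^esub> phi2 F x y =
      phi2 F y x \<cdot>\<^bsub>B\<^esub> Sym B (omap F x) (omap F y)"
    and phi2_ext: "x \<notin> Obj A \<or> y \<notin> Obj A \<Longrightarrow> phi2 F x y = undefined"

text \<open>Since \<open>phi0 F\<close> and \<open>phi2 F x y\<close> have codomains \<open>F I\<close> and \<open>F (x \<otimes> y)\<close>, strictness entails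
  that these objects are \<open>I\<close> and \<open>F x \<otimes> F y\<close>.\<close>

definition strict :: "('o1, 'm1) smc \<Rightarrow> ('o2, 'm2) smc \<Rightarrow> ('o1, 'm1, 'o2, 'm2) smf \<Rightarrow> bool" where
  "strict A B F \<longleftrightarrow> phi0 F = Idn B (Unt B) \<and>
     (\<forall>x \<in> Obj A. \<forall>y \<in> Obj A. phi2 F x y = Idn B (omap F x \<otimes>\<^bsub>B\<^esub> omap F y))"

record ('o1, 'm1, 'o2, 'm2) mnt =
  msrc :: "('o1, 'm1, 'o2, 'm2) smf"
  mtgt :: "('o1, 'm1, 'o2, 'm2) smf"
  mcomp :: "'o1 \<Rightarrow> 'm2"

locale monoidal_transformation =
  F: sm_functor A B "msrc \<sigma>" + G: sm_functor A B "mtgt \<sigma>"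
  for A :: "('o1, 'm1) smc" and B :: "('o2, 'm2) smc" and \<sigma> :: "('o1, 'm1, 'o2, 'm2) mnt" +
  assumes mcomp_hom: "x \<in> Obj A \<Longrightarrow> mcomp \<sigma> x \<in> hom B (omap (msrc \<sigma>) x) (omap (mtgt \<sigma>) x)"
    and mcomp_nat: "f \<in> hom A x y \<Longrightarrow>
      mcomp \<sigma> y \<cdot>\<^bsub>B\<^esub> amap (msrc \<sigma>) f = amap (mtgt \<sigma>) f \<cdot>\<^bsub>B\<^esub> mcomp \<sigma> x"
    and mcomp_phi0: "mcomp \<sigma> (Unt A) \<cdot>\<^bsub>B\<^esub> phi0 (msrc \<sigma>) = phi0 (mtgt \<sigma>)"
    and mcomp_phi2: "x \<in> Obj A \<Longrightarrow> y \<in> Obj A \<Longrightarrow>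
      mcomp \<sigma> (x \<otimes>\<^bsub>A\<^esub> y) \<cdot>\<^bsub>B\<^esub> phi2 (msrc \<sigma>) x y =
      phi2 (mtgt \<sigma>) x y \<cdot>\<^bsub>B\<^esub> (mcomp \<sigma> x \<boxtimes>\<^bsub>B\<^esub> mcomp \<sigma> y)"
    and mcomp_ext: "mcomp \<sigma> \<in> extensional (Obj A)"

definition SMC :: "('o1, 'm1) smc \<Rightarrow> ('o2, 'm2) smc \<Rightarrow>
    (('o1, 'm1, 'o2, 'm2) smf, ('o1, 'm1, 'o2, 'm2) mnt) cat" where
  "SMC A B = \<lparr>
     Obj = {F. sm_functor A B F},
     Arr = {\<sigma>. monoidal_transformation A B \<sigma>},
     Dom = msrc,
     Cod = mtgt,
     Idn = (\<lambda>F. \<lparr>msrc = F, mtgt = F, mcomp = (\<lambda>x \<in> Obj A. Idn B (omap F x))\<rparr>),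
     Comp = (\<lambda>\<tau> \<sigma>. \<lparr>msrc = msrc \<sigma>, mtgt = mtgt \<tau>,
       mcomp = (\<lambda>x \<in> Obj A. mcomp \<tau> x \<cdot>\<^bsub>B\<^esub> mcomp \<sigma> x)\<rparr>)\<rparr>"

definition StrSMC :: "('o1, 'm1) smc \<Rightarrow> ('o2, 'm2) smc \<Rightarrow>
    (('o1, 'm1, 'o2, 'm2) smf, ('o1, 'm1, 'o2, 'm2) mnt) cat" where
  "StrSMC A B = (SMC A B)\<lparr>
     Obj := {F. sm_functor A B F \<and> strict A B F},
     Arr := {\<sigma>. monoidal_transformation A B \<sigma> \<and> strict A B (msrc \<sigma>) \<and> strict A B (mtgt \<sigma>)}\<rparr>"

text \<open>The inclusion has the underlying maps of the identity functor of the subcategory.\<close>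

definition StrSMC_incl :: "('o1, 'm1) smc \<Rightarrow> ('o2, 'm2) smc \<Rightarrow>
    (('o1, 'm1, 'o2, 'm2) smf, ('o1, 'm1, 'o2, 'm2) mnt,
     ('o1, 'm1, 'o2, 'm2) smf, ('o1, 'm1, 'o2, 'm2) mnt) ftor" where
  "StrSMC_incl A B = ftor_id (StrSMC A B)"


section \<open>The internal hom\<close>

text \<open>\<open>Run B (Unt B)\<close>, which equals \<open>Lun B (Unt B)\<close>, is the canonical arrow \<open>I \<otimes> I \<rightarrow> I\<close>.\<close>

definition ihom_ten :: "('o1, 'm1) smc \<Rightarrow> ('o2, 'm2) smc \<Rightarrow>
    ('o1, 'm1, 'o2, 'm2) smf \<Rightarrow> ('o1, 'm1, 'o2, 'm2) smf \<Rightarrow> ('o1, 'm1, 'o2, 'm2) smf" where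
  "ihom_ten A B F G = \<lparr>
     omap = (\<lambda>x \<in> Obj A. omap F x \<otimes>\<^bsub>B\<^esub> omap G x),
     amap = (\<lambda>f \<in> Arr A. amap F f \<boxtimes>\<^bsub>B\<^esub> amap G f),
     phi0 = (phi0 F \<boxtimes>\<^bsub>B\<^esub> phi0 G) \<cdot>\<^bsub>B\<^esub> inv_arr B (Run B (Unt B)),
     phi2 = (\<lambda>x y. if x \<in> Obj A \<and> y \<in> Obj A
       then (phi2 F x y \<boxtimes>\<^bsub>B\<^esub> phi2 G x y) \<cdot>\<^bsub>B\<^esub>
         interchange B (omap F x) (omap G x) (omap F y) (omap G y)
       else undefined)\<rparr>"

definition ihom_unit :: "('o1, 'm1) smc \<Rightarrow> ('o2, 'm2) smc \<Rightarrow> ('o1, 'm1, 'o2, 'm2) smf" where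
  "ihom_unit A B = \<lparr>
     omap = (\<lambda>x \<in> Obj A. Unt B),
     amap = (\<lambda>f \<in> Arr A. Idn B (Unt B)),
     phi0 = Idn B (Unt B),
     phi2 = (\<lambda>x y. if x \<in> Obj A \<and> y \<in> Obj A then Run B (Unt B) else undefined)\<rparr>"

definition ihom :: "('o1, 'm1) smc \<Rightarrow> ('o2, 'm2) smc \<Rightarrow>
    (('o1, 'm1, 'o2, 'm2) smf, ('o1, 'm1, 'o2, 'm2) mnt) smc" where
  "ihom A B = cat.extend (SMC A B) (smc.fields
     (ihom_ten A B)
     (\<lambda>\<sigma> \<tau>. \<lparr>msrc = ihom_ten A B (msrc \<sigma>) (msrc \<tau>), mtgt = ihom_ten A B (mtgt \<sigma>) (mtgt \<tau>),
       mcomp = (\<lambda>x \<in> Obj A. mcomp \<sigma> x \<boxtimes>\<^bsub>B\<^esub> mcomp \<tau> x)\<rparr>)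
     (ihom_unit A B)
     (\<lambda>F G H. \<lparr>msrc = ihom_ten A B F (ihom_ten A B G H),
       mtgt = ihom_ten A B (ihom_ten A B F G) H,
       mcomp = (\<lambda>x \<in> Obj A. Ass B (omap F x) (omap G x) (omap H x))\<rparr>)
     (\<lambda>F. \<lparr>msrc = ihom_ten A B F (ihom_unit A B), mtgt = F,
       mcomp = (\<lambda>x \<in> Obj A. Run B (omap F x))\<rparr>)
     (\<lambda>F. \<lparr>msrc = ihom_ten A B (ihom_unit A B) F, mtgt = F,
       mcomp = (\<lambda>x \<in> Obj A. Lun B (omap F x))\<rparr>)
     (\<lambda>F G. \<lparr>msrc = ihom_ten A B F G, mtgt = ihom_ten A B G F,
       mcomp = (\<lambda>x \<in> Obj A. Sym B (omap F x) (omap G x))\<rparr>))"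


section \<open>The tensor product\<close>

text \<open>\<open>WGen a b\<close> is the symbol \<open>a \<otimes> b\<close>, and \<open>X \<odot> Y\<close> is the formal tensor of words.\<close>

datatype ('a, 'b) word =
    WUnit
  | WGen 'a 'b
  | WTen "('a, 'b) word" "('a, 'b) word" (infixr "\<odot>" 70)

text \<open>\<open>FLeft X p\<close> and \<open>FRight p X\<close> are \<open>X \<otimes> p\<close> and \<open>p \<otimes> X\<close>; \<open>FObjArr a g\<close> and \<open>FArrObj f b\<close> are
  \<open>a \<otimes> g\<close> and \<open>f \<otimes> b\<close>; \<open>FComp q p\<close> is \<open>q \<circ> p\<close>.  The type variables stand for the objects of
  \<open>A\<close>, the arrows of \<open>A\<close>, the objects of \<open>B\<close> and the arrows of \<open>B\<close>.\<close>

datatype ('a, 'f, 'b, 'g) formal =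
    FId "('a, 'b) word"
  | FComp "('a, 'f, 'b, 'g) formal" "('a, 'f, 'b, 'g) formal" (infixr "\<bullet>" 55)
  | FLeft "('a, 'b) word" "('a, 'f, 'b, 'g) formal"
  | FRight "('a, 'f, 'b, 'g) formal" "('a, 'b) word"
  | FAss "('a, 'b) word" "('a, 'b) word" "('a, 'b) word"
  | FAssInv "('a, 'b) word" "('a, 'b) word" "('a, 'b) word"
  | FRun "('a, 'b) word"
  | FRunInv "('a, 'b) word"
  | FLun "('a, 'b) word"
  | FLunInv "('a, 'b) word"
  | FSym "('a, 'b) word" "('a, 'b) word"
  | FAlpha 'b
  | FBeta 'a
  | FGamma 'a 'a 'b
  | FDelta 'a 'b 'b
  | FObjArr 'a 'g
  | FArrObj 'f 'b

primrec word_ok :: "('a, 'f) smc \<Rightarrow> ('b, 'g) smc \<Rightarrow> ('a, 'b) word \<Rightarrow> bool" where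
  "word_ok A B WUnit \<longleftrightarrow> True"
| "word_ok A B (WGen a b) \<longleftrightarrow> a \<in> Obj A \<and> b \<in> Obj B"
| "word_ok A B (X \<odot> Y) \<longleftrightarrow> word_ok A B X \<and> word_ok A B Y"

primrec fdom :: "('a, 'f) smc \<Rightarrow> ('b, 'g) smc \<Rightarrow> ('a, 'f, 'b, 'g) formal \<Rightarrow> ('a, 'b) word" where
  "fdom A B (FId X) = X"
| "fdom A B (q \<bullet> p) = fdom A B p"
| "fdom A B (FLeft X p) = X \<odot> fdom A B p"
| "fdom A B (FRight p X) = fdom A B p \<odot> X"
| "fdom A B (FAss X Y Z) = X \<odot> (Y \<odot> Z)"
| "fdom A B (FAssInv X Y Z) = (X \<odot> Y) \<odot> Z"
| "fdom A B (FRun X) = X \<odot> WUnit"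
| "fdom A B (FRunInv X) = X"
| "fdom A B (FLun X) = WUnit \<odot> X"
| "fdom A B (FLunInv X) = X"
| "fdom A B (FSym X Y) = X \<odot> Y"
| "fdom A B (FAlpha b) = WUnit"
| "fdom A B (FBeta a) = WUnit"
| "fdom A B (FGamma a a' b) = WGen a b \<odot> WGen a' b"
| "fdom A B (FDelta a b b') = WGen a b \<odot> WGen a b'"
| "fdom A B (FObjArr a g) = WGen a (Dom B g)"
| "fdom A B (FArrObj f b) = WGen (Dom A f) b"

primrec fcod :: "('a, 'f) smc \<Rightarrow> ('b, 'g) smc \<Rightarrow> ('a, 'f, 'b, 'g) formal \<Rightarrow> ('a, 'b) word" where
  "fcod A B (FId X) = X"
| "fcod A B (q \<bullet> p) = fcod A B q"
| "fcod A B (FLeft X p) = X \<odot> fcod A B p"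
| "fcod A B (FRight p X) = fcod A B p \<odot> X"
| "fcod A B (FAss X Y Z) = (X \<odot> Y) \<odot> Z"
| "fcod A B (FAssInv X Y Z) = X \<odot> (Y \<odot> Z)"
| "fcod A B (FRun X) = X"
| "fcod A B (FRunInv X) = X \<odot> WUnit"
| "fcod A B (FLun X) = X"
| "fcod A B (FLunInv X) = WUnit \<odot> X"
| "fcod A B (FSym X Y) = Y \<odot> X"
| "fcod A B (FAlpha b) = WGen (Unt A) b"
| "fcod A B (FBeta a) = WGen a (Unt B)"
| "fcod A B (FGamma a a' b) = WGen (a \<otimes>\<^bsub>A\<^esub> a') b"
| "fcod A B (FDelta a b b') = WGen a (b \<otimes>\<^bsub>B\<^esub> b')"
| "fcod A B (FObjArr a g) = WGen a (Cod B g)"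
| "fcod A B (FArrObj f b) = WGen (Cod A f) b"

primrec formal_ok :: "('a, 'f) smc \<Rightarrow> ('b, 'g) smc \<Rightarrow> ('a, 'f, 'b, 'g) formal \<Rightarrow> bool" where
  "formal_ok A B (FId X) \<longleftrightarrow> word_ok A B X"
| "formal_ok A B (q \<bullet> p) \<longleftrightarrow> formal_ok A B q \<and> formal_ok A B p \<and> fcod A B p = fdom A B q"
| "formal_ok A B (FLeft X p) \<longleftrightarrow> word_ok A B X \<and> formal_ok A B p"
| "formal_ok A B (FRight p X) \<longleftrightarrow> formal_ok A B p \<and> word_ok A B X"
| "formal_ok A B (FAss X Y Z) \<longleftrightarrow> word_ok A B X \<and> word_ok A B Y \<and> word_ok A B Z"
| "formal_ok A B (FAssInv X Y Z) \<longleftrightarrow> word_ok A B X \<and> word_ok A B Y \<and> word_ok A B Z"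
| "formal_ok A B (FRun X) \<longleftrightarrow> word_ok A B X"
| "formal_ok A B (FRunInv X) \<longleftrightarrow> word_ok A B X"
| "formal_ok A B (FLun X) \<longleftrightarrow> word_ok A B X"
| "formal_ok A B (FLunInv X) \<longleftrightarrow> word_ok A B X"
| "formal_ok A B (FSym X Y) \<longleftrightarrow> word_ok A B X \<and> word_ok A B Y"
| "formal_ok A B (FAlpha b) \<longleftrightarrow> b \<in> Obj B"
| "formal_ok A B (FBeta a) \<longleftrightarrow> a \<in> Obj A"
| "formal_ok A B (FGamma a a' b) \<longleftrightarrow> a \<in> Obj A \<and> a' \<in> Obj A \<and> b \<in> Obj B"
| "formal_ok A B (FDelta a b b') \<longleftrightarrow> a \<in> Obj A \<and> b \<in> Obj B \<and> b' \<in> Obj B"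
| "formal_ok A B (FObjArr a g) \<longleftrightarrow> a \<in> Obj A \<and> g \<in> Arr B"
| "formal_ok A B (FArrObj f b) \<longleftrightarrow> f \<in> Arr A \<and> b \<in> Obj B"

definition ften :: "('a, 'f) smc \<Rightarrow> ('b, 'g) smc \<Rightarrow> ('a, 'f, 'b, 'g) formal \<Rightarrow>
    ('a, 'f, 'b, 'g) formal \<Rightarrow> ('a, 'f, 'b, 'g) formal" where
  "ften A B p q = FLeft (fcod A B p) q \<bullet> FRight p (fdom A B q)"

definition finterchange :: "('a, 'b) word \<Rightarrow> ('a, 'b) word \<Rightarrow> ('a, 'b) word \<Rightarrow> ('a, 'b) word \<Rightarrow>
    ('a, 'f, 'b, 'g) formal" where
  "finterchange X Y Z W =
     FAss X Z (Y \<odot> W) \<bullet>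
     FLeft X (FAssInv Z Y W \<bullet> FRight (FSym Y Z) W \<bullet> FAss Y Z W) \<bullet>
     FAssInv X Y (Z \<odot> W)"

text \<open>The defining equations of \<open>A \<otimes> B\<close>.  They are only used between formal arrows that are
  well formed (see \<open>base\<close> in \<open>fcong\<close> below), which enforces the typing of all variables.
  As above, \<open>FRun WUnit\<close> serves as the canonical arrow \<open>I \<otimes> I \<rightarrow> I\<close>.\<close>

inductive frel :: "('a, 'f) smc \<Rightarrow> ('b, 'g) smc \<Rightarrow> ('a, 'f, 'b, 'g) formal \<Rightarrow>
    ('a, 'f, 'b, 'g) formal \<Rightarrow> bool"
  for A :: "('a, 'f) smc" and B :: "('b, 'g) smc" where
  \<comment> \<open>category, bifunctor and symmetric monoidal structure\<close>
  comp_id: "frel A B (p \<bullet> FId X) p"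
| id_comp: "frel A B (FId X \<bullet> p) p"
| comp_assoc: "frel A B ((r \<bullet> q) \<bullet> p) (r \<bullet> (q \<bullet> p))"
| left_id: "frel A B (FLeft X (FId Y)) (FId (X \<odot> Y))"
| left_comp: "frel A B (FLeft X (q \<bullet> p)) (FLeft X q \<bullet> FLeft X p)"
| right_id: "frel A B (FRight (FId Y) X) (FId (Y \<odot> X))"
| right_comp: "frel A B (FRight (q \<bullet> p) X) (FRight q X \<bullet> FRight p X)"
| left_right: "frel A B
    (FLeft (fcod A B p) q \<bullet> FRight p (fdom A B q))
    (FRight p (fcod A B q) \<bullet> FLeft (fdom A B p) q)"
| ass_inv1: "frel A B (FAssInv X Y Z \<bullet> FAss X Y Z) (FId (X \<odot> (Y \<odot> Z)))"
| ass_inv2: "frel A B (FAss X Y Z \<bullet> FAssInv X Y Z) (FId ((X \<odot> Y) \<odot> Z))"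
| ass_nat: "frel A B
    (FAss (fcod A B p) (fcod A B q) (fcod A B r) \<bullet> ften A B p (ften A B q r))
    (ften A B (ften A B p q) r \<bullet> FAss (fdom A B p) (fdom A B q) (fdom A B r))"
| run_inv1: "frel A B (FRunInv X \<bullet> FRun X) (FId (X \<odot> WUnit))"
| run_inv2: "frel A B (FRun X \<bullet> FRunInv X) (FId X)"
| run_nat: "frel A B (FRun (fcod A B p) \<bullet> FRight p WUnit) (p \<bullet> FRun (fdom A B p))"
| lun_inv1: "frel A B (FLunInv X \<bullet> FLun X) (FId (WUnit \<odot> X))"
| lun_inv2: "frel A B (FLun X \<bullet> FLunInv X) (FId X)"
| lun_nat: "frel A B (FLun (fcod A B p) \<bullet> FLeft WUnit p) (p \<bullet> FLun (fdom A B p))"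
| sym_nat: "frel A B
    (FSym (fcod A B p) (fcod A B q) \<bullet> ften A B p q)
    (ften A B q p \<bullet> FSym (fdom A B p) (fdom A B q))"
| pentagon: "frel A B
    (FAss (X \<odot> Y) Z W \<bullet> FAss X Y (Z \<odot> W))
    (FRight (FAss X Y Z) W \<bullet> FAss X (Y \<odot> Z) W \<bullet> FLeft X (FAss Y Z W))"
| triangle: "frel A B (FRight (FRun X) Y \<bullet> FAss X WUnit Y) (FLeft X (FLun Y))"
| sym_inv: "frel A B (FSym Y X \<bullet> FSym X Y) (FId (X \<odot> Y))"
| sym_unit: "frel A B (FLun X \<bullet> FSym X WUnit) (FRun X)"
| hexagon: "frel A B
    (FAss Z X Y \<bullet> FSym (X \<odot> Y) Z \<bullet> FAss X Y Z)
    (FRight (FSym X Z) Y \<bullet> FAss X Z Y \<bullet> FLeft X (FSym Y Z))"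
  \<comment> \<open>\<open>b \<mapsto> a \<otimes> b\<close>, with \<open>\<beta>\<close> and \<open>\<delta>\<close>, is a symmetric monoidal functor\<close>
| obj_arr_id: "frel A B (FObjArr a (Idn B b)) (FId (WGen a b))"
| obj_arr_comp: "g \<in> hom B b b' \<Longrightarrow> g' \<in> hom B b' b'' \<Longrightarrow>
    frel A B (FObjArr a (g' \<cdot>\<^bsub>B\<^esub> g)) (FObjArr a g' \<bullet> FObjArr a g)"
| delta_nat: "g \<in> hom B b c \<Longrightarrow> g' \<in> hom B b' c' \<Longrightarrow> frel A B
    (FDelta a c c' \<bullet> ften A B (FObjArr a g) (FObjArr a g'))
    (FObjArr a (g \<boxtimes>\<^bsub>B\<^esub> g') \<bullet> FDelta a b b')"
| delta_ass: "frel A B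
    (FObjArr a (Ass B b b' b'') \<bullet> FDelta a b (b' \<otimes>\<^bsub>B\<^esub> b'') \<bullet>
      FLeft (WGen a b) (FDelta a b' b''))
    (FDelta a (b \<otimes>\<^bsub>B\<^esub> b') b'' \<bullet> FRight (FDelta a b b') (WGen a b'') \<bullet>
      FAss (WGen a b) (WGen a b') (WGen a b''))"
| delta_run: "frel A B
    (FObjArr a (Run B b) \<bullet> FDelta a b (Unt B) \<bullet> FLeft (WGen a b) (FBeta a))
    (FRun (WGen a b))"
| delta_lun: "frel A B
    (FObjArr a (Lun B b) \<bullet> FDelta a (Unt B) b \<bullet> FRight (FBeta a) (WGen a b))
    (FLun (WGen a b))"
| delta_sym: "frel A B
    (FObjArr a (Sym B b b') \<bullet> FDelta a b b')
    (FDelta a b' b \<bullet> FSym (WGen a b) (WGen a b'))"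
  \<comment> \<open>\<open>a \<mapsto> a \<otimes> b\<close>, with \<open>\<alpha>\<close> and \<open>\<gamma>\<close>, is a symmetric monoidal functor\<close>
| arr_obj_id: "frel A B (FArrObj (Idn A a) b) (FId (WGen a b))"
| arr_obj_comp: "f \<in> hom A a a' \<Longrightarrow> f' \<in> hom A a' a'' \<Longrightarrow>
    frel A B (FArrObj (f' \<cdot>\<^bsub>A\<^esub> f) b) (FArrObj f' b \<bullet> FArrObj f b)"
| gamma_nat: "f \<in> hom A a c \<Longrightarrow> f' \<in> hom A a' c' \<Longrightarrow> frel A B
    (FGamma c c' b \<bullet> ften A B (FArrObj f b) (FArrObj f' b))
    (FArrObj (f \<boxtimes>\<^bsub>A\<^esub> f') b \<bullet> FGamma a a' b)"
| gamma_ass: "frel A B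
    (FArrObj (Ass A a a' a'') b \<bullet> FGamma a (a' \<otimes>\<^bsub>A\<^esub> a'') b \<bullet>
      FLeft (WGen a b) (FGamma a' a'' b))
    (FGamma (a \<otimes>\<^bsub>A\<^esub> a') a'' b \<bullet> FRight (FGamma a a' b) (WGen a'' b) \<bullet>
      FAss (WGen a b) (WGen a' b) (WGen a'' b))"
| gamma_run: "frel A B
    (FArrObj (Run A a) b \<bullet> FGamma a (Unt A) b \<bullet> FLeft (WGen a b) (FAlpha b))
    (FRun (WGen a b))"
| gamma_lun: "frel A B
    (FArrObj (Lun A a) b \<bullet> FGamma (Unt A) a b \<bullet> FRight (FAlpha b) (WGen a b))
    (FLun (WGen a b))"
| gamma_sym: "frel A B
    (FArrObj (Sym A a a') b \<bullet> FGamma a a' b)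
    (FGamma a' a b \<bullet> FSym (WGen a b) (WGen a' b))"
  \<comment> \<open>\<open>f \<otimes> b\<close> and \<open>a \<otimes> g\<close> are monoidal natural in \<open>b\<close> and in \<open>a\<close>, respectively\<close>
| arr_arr: "f \<in> hom A a a' \<Longrightarrow> g \<in> hom B b b' \<Longrightarrow> frel A B
    (FArrObj f b' \<bullet> FObjArr a g) (FObjArr a' g \<bullet> FArrObj f b)"
| arr_beta: "f \<in> hom A a a' \<Longrightarrow> frel A B (FArrObj f (Unt B) \<bullet> FBeta a) (FBeta a')"
| arr_delta: "f \<in> hom A a a' \<Longrightarrow> frel A B
    (FArrObj f (b \<otimes>\<^bsub>B\<^esub> b') \<bullet> FDelta a b b')
    (FDelta a' b b' \<bullet> ften A B (FArrObj f b) (FArrObj f b'))"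
| arr_alpha: "g \<in> hom B b b' \<Longrightarrow> frel A B (FObjArr (Unt A) g \<bullet> FAlpha b) (FAlpha b')"
| arr_gamma: "g \<in> hom B b b' \<Longrightarrow> frel A B
    (FObjArr (a \<otimes>\<^bsub>A\<^esub> a') g \<bullet> FGamma a a' b)
    (FGamma a a' b' \<bullet> ften A B (FObjArr a g) (FObjArr a' g))"
  \<comment> \<open>compatibility of \<open>\<alpha>\<close>, \<open>\<beta>\<close>, \<open>\<gamma>\<close>, \<open>\<delta>\<close>\<close>
| alpha_delta: "frel A B
    (FAlpha (b \<otimes>\<^bsub>B\<^esub> b') \<bullet> FRun WUnit)
    (FDelta (Unt A) b b' \<bullet> ften A B (FAlpha b) (FAlpha b'))"
| beta_gamma: "frel A B
    (FBeta (a \<otimes>\<^bsub>A\<^esub> a') \<bullet> FRun WUnit)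
    (FGamma a a' (Unt B) \<bullet> ften A B (FBeta a) (FBeta a'))"
| beta_alpha: "frel A B (FBeta (Unt A)) (FAlpha (Unt B))"
| gamma_delta: "frel A B
    (FGamma a a' (b \<otimes>\<^bsub>B\<^esub> b') \<bullet> ften A B (FDelta a b b') (FDelta a' b b'))
    (FDelta (a \<otimes>\<^bsub>A\<^esub> a') b b' \<bullet> ften A B (FGamma a a' b) (FGamma a a' b') \<bullet>
      finterchange (WGen a b) (WGen a b') (WGen a' b) (WGen a' b'))"

inductive fcong :: "('a, 'f) smc \<Rightarrow> ('b, 'g) smc \<Rightarrow> ('a, 'f, 'b, 'g) formal \<Rightarrow>
    ('a, 'f, 'b, 'g) formal \<Rightarrow> bool"
  for A :: "('a, 'f) smc" and B :: "('b, 'g) smc" where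
  base: "frel A B p q \<Longrightarrow> formal_ok A B p \<Longrightarrow> formal_ok A B q \<Longrightarrow> fcong A B p q"
| refl: "formal_ok A B p \<Longrightarrow> fcong A B p p"
| sym: "fcong A B p q \<Longrightarrow> fcong A B q p"
| trans: "fcong A B p q \<Longrightarrow> fcong A B q r \<Longrightarrow> fcong A B p r"
| comp: "fcong A B q q' \<Longrightarrow> fcong A B p p' \<Longrightarrow> fcod A B p = fdom A B q \<Longrightarrow>
    fcong A B (q \<bullet> p) (q' \<bullet> p')"
| left: "word_ok A B X \<Longrightarrow> fcong A B p q \<Longrightarrow> fcong A B (FLeft X p) (FLeft X q)"
| right: "word_ok A B X \<Longrightarrow> fcong A B p q \<Longrightarrow> fcong A B (FRight p X) (FRight q X)"

definition fclass :: "('a, 'f) smc \<Rightarrow> ('b, 'g) smc \<Rightarrow> ('a, 'f, 'b, 'g) formal \<Rightarrow>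
    ('a, 'f, 'b, 'g) formal set" where
  "fclass A B p = {q. fcong A B p q}"

definition rep :: "'p set \<Rightarrow> 'p" where
  "rep c = (SOME p. p \<in> c)"

definition tensor :: "('a, 'f) smc \<Rightarrow> ('b, 'g) smc \<Rightarrow>
    (('a, 'b) word, ('a, 'f, 'b, 'g) formal set) smc" where
  "tensor A B = \<lparr>
     Obj = {X. word_ok A B X},
     Arr = {fclass A B p | p. formal_ok A B p},
     Dom = (\<lambda>c. fdom A B (rep c)),
     Cod = (\<lambda>c. fcod A B (rep c)),
     Idn = (\<lambda>X. fclass A B (FId X)),
     Comp = (\<lambda>d c. fclass A B (rep d \<bullet> rep c)),
     TenO = WTen,
     TenA = (\<lambda>c d. fclass A B (ften A B (rep c) (rep d))),
     Unt = WUnit,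
     Ass = (\<lambda>X Y Z. fclass A B (FAss X Y Z)),
     Run = (\<lambda>X. fclass A B (FRun X)),
     Lun = (\<lambda>X. fclass A B (FLun X)),
     Sym = (\<lambda>X Y. fclass A B (FSym X Y))\<rparr>"


section \<open>The functor \<open>En\<close>\<close>

primrec bar_word :: "('c, 'h) smc \<Rightarrow>
    ('a, 'f, ('b, 'g, 'c, 'h) smf, ('b, 'g, 'c, 'h) mnt) smf \<Rightarrow> ('a, 'b) word \<Rightarrow> 'c" where
  "bar_word C F WUnit = Unt C"
| "bar_word C F (WGen a b) = omap (omap F a) b"
| "bar_word C F (X \<odot> Y) = bar_word C F X \<otimes>\<^bsub>C\<^esub> bar_word C F Y"

primrec bar_formal :: "('c, 'h) smc \<Rightarrow>
    ('a, 'f, ('b, 'g, 'c, 'h) smf, ('b, 'g, 'c, 'h) mnt) smf \<Rightarrow>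
    ('a, 'f, 'b, 'g) formal \<Rightarrow> 'h" where
  "bar_formal C F (FId X) = Idn C (bar_word C F X)"
| "bar_formal C F (q \<bullet> p) = bar_formal C F q \<cdot>\<^bsub>C\<^esub> bar_formal C F p"
| "bar_formal C F (FLeft X p) = Idn C (bar_word C F X) \<boxtimes>\<^bsub>C\<^esub> bar_formal C F p"
| "bar_formal C F (FRight p X) = bar_formal C F p \<boxtimes>\<^bsub>C\<^esub> Idn C (bar_word C F X)"
| "bar_formal C F (FAss X Y Z) = Ass C (bar_word C F X) (bar_word C F Y) (bar_word C F Z)"
| "bar_formal C F (FAssInv X Y Z) =
     inv_arr C (Ass C (bar_word C F X) (bar_word C F Y) (bar_word C F Z))"
| "bar_formal C F (FRun X) = Run C (bar_word C F X)"
| "bar_formal C F (FRunInv X) = inv_arr C (Run C (bar_word C F X))"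
| "bar_formal C F (FLun X) = Lun C (bar_word C F X)"
| "bar_formal C F (FLunInv X) = inv_arr C (Lun C (bar_word C F X))"
| "bar_formal C F (FSym X Y) = Sym C (bar_word C F X) (bar_word C F Y)"
| "bar_formal C F (FAlpha b) = mcomp (phi0 F) b"
| "bar_formal C F (FBeta a) = phi0 (omap F a)"
| "bar_formal C F (FGamma a a' b) = mcomp (phi2 F a a') b"
| "bar_formal C F (FDelta a b b') = phi2 (omap F a) b b'"
| "bar_formal C F (FObjArr a g) = amap (omap F a) g"
| "bar_formal C F (FArrObj f b) = mcomp (amap F f) b"

definition bar :: "('a, 'f) smc \<Rightarrow> ('b, 'g) smc \<Rightarrow> ('c, 'h) smc \<Rightarrow>
    ('a, 'f, ('b, 'g, 'c, 'h) smf, ('b, 'g, 'c, 'h) mnt) smf \<Rightarrow>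
    (('a, 'b) word, ('a, 'f, 'b, 'g) formal set, 'c, 'h) smf" where
  "bar A B C F = \<lparr>
     omap = (\<lambda>X \<in> Obj (tensor A B). bar_word C F X),
     amap = (\<lambda>c \<in> Arr (tensor A B). bar_formal C F (rep c)),
     phi0 = Idn C (Unt C),
     phi2 = (\<lambda>X Y. if X \<in> Obj (tensor A B) \<and> Y \<in> Obj (tensor A B)
       then Idn C (bar_word C F X \<otimes>\<^bsub>C\<^esub> bar_word C F Y) else undefined)\<rparr>"

primrec bar_mnt_word :: "('c, 'h) smc \<Rightarrow>
    ('a, 'f, ('b, 'g, 'c, 'h) smf, ('b, 'g, 'c, 'h) mnt) mnt \<Rightarrow> ('a, 'b) word \<Rightarrow> 'h" where
  "bar_mnt_word C \<sigma> WUnit = Idn C (Unt C)"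
| "bar_mnt_word C \<sigma> (WGen a b) = mcomp (mcomp \<sigma> a) b"
| "bar_mnt_word C \<sigma> (X \<odot> Y) = bar_mnt_word C \<sigma> X \<boxtimes>\<^bsub>C\<^esub> bar_mnt_word C \<sigma> Y"

definition bar_mnt :: "('a, 'f) smc \<Rightarrow> ('b, 'g) smc \<Rightarrow> ('c, 'h) smc \<Rightarrow>
    ('a, 'f, ('b, 'g, 'c, 'h) smf, ('b, 'g, 'c, 'h) mnt) mnt \<Rightarrow>
    (('a, 'b) word, ('a, 'f, 'b, 'g) formal set, 'c, 'h) mnt" where
  "bar_mnt A B C \<sigma> = \<lparr>
     msrc = bar A B C (msrc \<sigma>),
     mtgt = bar A B C (mtgt \<sigma>),
     mcomp = (\<lambda>X \<in> Obj (tensor A B). bar_mnt_word C \<sigma> X)\<rparr>"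

definition En :: "('a, 'f) smc \<Rightarrow> ('b, 'g) smc \<Rightarrow> ('c, 'h) smc \<Rightarrow>
    (('a, 'f, ('b, 'g, 'c, 'h) smf, ('b, 'g, 'c, 'h) mnt) smf,
     ('a, 'f, ('b, 'g, 'c, 'h) smf, ('b, 'g, 'c, 'h) mnt) mnt,
     (('a, 'b) word, ('a, 'f, 'b, 'g) formal set, 'c, 'h) smf,
     (('a, 'b) word, ('a, 'f, 'b, 'g) formal set, 'c, 'h) mnt) ftor" where
  "En A B C = \<lparr>
     omap = (\<lambda>F \<in> Obj (SMC A (ihom B C)). bar A B C F),
     amap = (\<lambda>\<sigma> \<in> Arr (SMC A (ihom B C)). bar_mnt A B C \<sigma>)\<rparr>"

end

theory Submission
  imports Defs
begin

text \<open>The tensor product \<open>A \<otimes> B\<close> is presented by generators and relations, and the presentation is a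
  symmetric monoidal functor \<open>F : A \<rightarrow> [B, C]\<close> written out in components.  The generators \<open>a \<otimes> b\<close>,
  \<open>a \<otimes> g\<close>, \<open>\<beta>\<close>, \<open>\<delta>\<close> stand for the values and structure arrows of the functors \<open>F a\<close>; the generators
  \<open>f \<otimes> b\<close>, \<open>\<alpha>\<close>, \<open>\<gamma>\<close> for the components of the transformations \<open>F f\<close>, \<open>F\<^sup>0\<close>, \<open>F\<^sup>2\<close>; and the relations
  are the axioms for these data, together with those of a symmetric monoidal category.

  So evaluation of formal arrows in \<open>C\<close> along \<open>F\<close> respects the relations (\<open>bar_frel\<close>) and descends to
  a strict functor on \<open>A \<otimes> B\<close>.  Conversely, a strict functor \<open>G\<close> on \<open>A \<otimes> B\<close> preserves the canonical
  arrows and tensor products of arrows, and is therefore determined by its values on the generators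
  (\<open>bar_formal_unbar\<close>); and as \<open>G\<close> sends relations to equations in \<open>C\<close>, these values form a functor
  \<open>A \<rightarrow> [B, C]\<close> (\<open>sm_functor_unbar\<close>).  The two passages are mutually inverse.  The same holds for
  transformations: the component at a tensor product of words is the tensor product of the
  components, and naturality on \<open>A \<otimes> B\<close> needs to be checked at the generating arrows only, where it
  says that a family of transformations \<open>F a \<rightarrow> F' a\<close> is natural and monoidal in both variables.
  Since a functor that is bijective on objects and arrows is an isomorphism (\<open>cat_isoI\<close>), this proves
  the claim; functoriality in the other direction comes for free.

  One ingredient goes beyond this translation.  For \<open>F\<^sup>2\<close> to be a family of arrows of \<open>[B, C]\<close> with the
  right domains, the pointwise tensor product of two symmetric monoidal functors must be symmetric
  monoidal again (\<open>sm_functor_ihom_ten\<close>).  Its axioms reduce to identities for the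
  interchange \<open>(a \<otimes> b) \<otimes> (c \<otimes> d) \<rightarrow> (a \<otimes> c) \<otimes> (b \<otimes> d)\<close>, up to six objects at a time.  These are
  obtained from a coherence theorem that replaces composites of canonical arrows by products of
  swaps of adjacent factors (\<open>coherence\<close>).\<close>

section \<open>Working in a symmetric monoidal category\<close>

lemma hom_iff: "f \<in> hom C a b \<longleftrightarrow> f \<in> Arr C \<and> Dom C f = a \<and> Cod C f = b"
  by (simp add: hom_def)

text \<open>The axioms are restated with \<^const>\<open>Arr\<close>, \<^const>\<open>Dom\<close> and \<^const>\<open>Cod\<close> in place of
  \<^const>\<open>hom\<close>: then no premise mentions an object that the conclusion does not determine,
  and the simplifier can discharge the typing conditions.\<close>

context category
begin

lemma Dom_in [simp]: "f \<in> Arr C \<Longrightarrow> Dom C f \<in> Obj C"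
  and Cod_in [simp]: "f \<in> Arr C \<Longrightarrow> Cod C f \<in> Obj C"
  by (simp_all add: Dom_obj Cod_obj)

lemma Idn_typing [simp]:
  assumes "a \<in> Obj C"
  shows "Idn C a \<in> Arr C" and "Dom C (Idn C a) = a" and "Cod C (Idn C a) = a"
  using Idn_hom[OF assms] by (simp_all add: hom_iff)

lemma comp_typing [simp]:
  assumes "f \<in> Arr C" and "g \<in> Arr C" and "Cod C f = Dom C g"
  shows "g \<cdot> f \<in> Arr C" and "Dom C (g \<cdot> f) = Dom C f" and "Cod C (g \<cdot> f) = Cod C g"
  using Comp_hom[of f "Dom C f" "Dom C g" g "Cod C g"] assms by (simp_all add: hom_iff)

lemma comp_idn [simp]: "f \<in> Arr C \<Longrightarrow> Dom C f = a \<Longrightarrow> f \<cdot> Idn C a = f"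
  using Comp_Idn[of f a "Cod C f"] by (simp add: hom_iff)

lemma idn_comp [simp]: "f \<in> Arr C \<Longrightarrow> Cod C f = b \<Longrightarrow> Idn C b \<cdot> f = f"
  using Idn_Comp[of f "Dom C f" b] by (simp add: hom_iff)

lemma comp_assoc [simp]:
  "f \<in> Arr C \<Longrightarrow> g \<in> Arr C \<Longrightarrow> h \<in> Arr C \<Longrightarrow> Cod C f = Dom C g \<Longrightarrow> Cod C g = Dom C h \<Longrightarrow>
    (h \<cdot> g) \<cdot> f = h \<cdot> (g \<cdot> f)"
  using Comp_assoc[of f "Dom C f" "Cod C f" g "Cod C g" h "Cod C h"] by (simp add: hom_iff)

text \<open>Composites are kept bracketed to the right, so an equation between two arrows meets them in
  front of a third one.\<close>

lemma comp_extend: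
  "g \<cdot> f = h \<Longrightarrow> f \<in> Arr C \<Longrightarrow> g \<in> Arr C \<Longrightarrow> k \<in> Arr C \<Longrightarrow> Cod C f = Dom C g \<Longrightarrow>
    Cod C k = Dom C f \<Longrightarrow> g \<cdot> (f \<cdot> k) = h \<cdot> k"
  using comp_assoc[of k f g] by simp

lemma is_inverse_unique:
  assumes f: "f \<in> Arr C" and g: "is_inverse C f g" and h: "is_inverse C f h"
  shows "g = h"
proof -
  have "g \<cdot> (f \<cdot> h) = (g \<cdot> f) \<cdot> h"
    using f g h by (subst comp_assoc) (auto simp: is_inverse_def hom_iff)
  then show ?thesis
    using f g h by (simp add: is_inverse_def hom_iff)
qed

lemma inv_arr_eq: "f \<in> Arr C \<Longrightarrow> is_inverse C f g \<Longrightarrow> inv_arr C f = g"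
  unfolding inv_arr_def using is_inverse_unique by blast

lemma iso_arr: "iso C f \<Longrightarrow> f \<in> Arr C"
  by (simp add: iso_def)

lemma is_inverse_inv_arr: "iso C f \<Longrightarrow> is_inverse C f (inv_arr C f)"
  using inv_arr_eq by (auto simp: iso_def)

lemma inv_arr_typing [simp]:
  assumes "iso C f"
  shows "inv_arr C f \<in> Arr C" and "Dom C (inv_arr C f) = Cod C f" and "Cod C (inv_arr C f) = Dom C f"
    and "inv_arr C f \<cdot> f = Idn C (Dom C f)" and "f \<cdot> inv_arr C f = Idn C (Cod C f)"
  using is_inverse_inv_arr[OF assms] by (simp_all add: is_inverse_def hom_iff)

lemma inv_arr_comp [simp]:
  assumes f: "iso C f" and k: "k \<in> Arr C"
  shows "Cod C k = Dom C f \<Longrightarrow> inv_arr C f \<cdot> (f \<cdot> k) = k"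
    and "Cod C k = Cod C f \<Longrightarrow> f \<cdot> (inv_arr C f \<cdot> k) = k"
proof -
  note [simp] = iso_arr[OF f]
  show "inv_arr C f \<cdot> (f \<cdot> k) = k" if "Cod C k = Dom C f"
    using that f k by (subst comp_assoc[symmetric]) simp_all
  show "f \<cdot> (inv_arr C f \<cdot> k) = k" if "Cod C k = Cod C f"
    using that f k by (subst comp_assoc[symmetric]) simp_all
qed

lemma isoI:
  "f \<in> Arr C \<Longrightarrow> g \<in> Arr C \<Longrightarrow> Dom C g = Cod C f \<Longrightarrow> Cod C g = Dom C f \<Longrightarrow>
    g \<cdot> f = Idn C (Dom C f) \<Longrightarrow> f \<cdot> g = Idn C (Cod C f) \<Longrightarrow> iso C f"
  by (auto simp: iso_def is_inverse_def hom_iff)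

lemma iso_Idn [simp]: "a \<in> Obj C \<Longrightarrow> iso C (Idn C a)"
  by (rule isoI[of _ "Idn C a"]) simp_all

lemma iso_inv_arr [simp]: "iso C f \<Longrightarrow> iso C (inv_arr C f)"
  by (rule isoI[of _ f]) (simp_all add: iso_arr)

lemma iso_comp [simp]:
  assumes "iso C f" and "iso C g" and "Cod C f = Dom C g"
  shows "iso C (g \<cdot> f)"
  using assms by (intro isoI[of _ "inv_arr C f \<cdot> inv_arr C g"]) (simp_all add: iso_arr)

lemma iso_cancel_right:
  assumes "f \<cdot> k = g \<cdot> k" and "iso C k" and "f \<in> Arr C" and "g \<in> Arr C"
    and "Dom C f = Cod C k" and "Dom C g = Cod C k"
  shows "f = g"
proof -
  have "(f \<cdot> k) \<cdot> inv_arr C k = (g \<cdot> k) \<cdot> inv_arr C k" using assms by (simp add: iso_arr)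
  then show ?thesis using assms(2-) by (simp add: iso_arr)
qed

lemma iso_cancel_left:
  assumes "k \<cdot> f = k \<cdot> g" and "iso C k" and "f \<in> Arr C" and "g \<in> Arr C"
    and "Cod C f = Dom C k" and "Cod C g = Dom C k"
  shows "f = g"
proof -
  have "inv_arr C k \<cdot> (k \<cdot> f) = inv_arr C k \<cdot> (k \<cdot> g)" using assms by (simp add: iso_arr)
  then show ?thesis using assms(2-) by (simp add: iso_arr)
qed

end

text \<open>The bifunctor laws on their own.  The composition of monoidal transformations rests on them, and
  they are established for the internal hom too, so that transformations between functors into it
  can be composed.\<close>

locale tensor_category = category C
  for C :: "('o, 'm) smc" (structure) +
  assumes ten_hom: "f \<in> hom C a a' \<Longrightarrow> g \<in> hom C b b' \<Longrightarrow> f \<boxtimes> g \<in> hom C (a \<otimes> b) (a' \<otimes> b')"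
    and ten_Idn: "a \<in> Obj C \<Longrightarrow> b \<in> Obj C \<Longrightarrow> Idn C a \<boxtimes> Idn C b = Idn C (a \<otimes> b)"
    and ten_Comp: "f \<in> hom C a a' \<Longrightarrow> f' \<in> hom C a' a'' \<Longrightarrow>
      g \<in> hom C b b' \<Longrightarrow> g' \<in> hom C b' b'' \<Longrightarrow>
      (f' \<cdot> f) \<boxtimes> (g' \<cdot> g) = (f' \<boxtimes> g') \<cdot> (f \<boxtimes> g)"
begin

lemma ten_typing [simp]:
  assumes "f \<in> Arr C" and "g \<in> Arr C"
  shows "f \<boxtimes> g \<in> Arr C" and "Dom C (f \<boxtimes> g) = Dom C f \<otimes> Dom C g"
    and "Cod C (f \<boxtimes> g) = Cod C f \<otimes> Cod C g"
  using ten_hom[of f "Dom C f" "Cod C f" g "Dom C g" "Cod C g"] assms by (simp_all add: hom_iff)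

lemma ten_idn [simp]: "a \<in> Obj C \<Longrightarrow> b \<in> Obj C \<Longrightarrow> Idn C a \<boxtimes> Idn C b = Idn C (a \<otimes> b)"
  by (rule ten_Idn)

text \<open>As a rewrite rule, functoriality merges neighbouring tensor products of arrows.\<close>

lemma ten_comp [simp]:
  assumes "f \<in> Arr C" and "f' \<in> Arr C" and "Cod C f = Dom C f'"
    and "g \<in> Arr C" and "g' \<in> Arr C" and "Cod C g = Dom C g'"
  shows "(f' \<boxtimes> g') \<cdot> (f \<boxtimes> g) = (f' \<cdot> f) \<boxtimes> (g' \<cdot> g)"
  using ten_Comp[of f "Dom C f" "Cod C f" f' "Cod C f'" g "Dom C g" "Cod C g" g' "Cod C g'"] assms
  by (simp add: hom_iff)

lemma ten_comp' [simp]: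
  assumes "f \<in> Arr C" and "f' \<in> Arr C" and "Cod C f = Dom C f'"
    and "g \<in> Arr C" and "g' \<in> Arr C" and "Cod C g = Dom C g'"
    and "k \<in> Arr C" and "Cod C k = Dom C f \<otimes> Dom C g"
  shows "(f' \<boxtimes> g') \<cdot> ((f \<boxtimes> g) \<cdot> k) = ((f' \<cdot> f) \<boxtimes> (g' \<cdot> g)) \<cdot> k"
  using assms comp_assoc[of k "f \<boxtimes> g" "f' \<boxtimes> g'"] by (simp del: comp_assoc)

end

sublocale smc \<subseteq> tensor_category
  by unfold_locales (simp_all add: TenA_hom TenA_Idn TenA_Comp)

context smc
begin

lemma Unt_in [simp]: "Unt C \<in> Obj C"
  and TenO_in [simp]: "a \<in> Obj C \<Longrightarrow> b \<in> Obj C \<Longrightarrow> a \<otimes> b \<in> Obj C"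
  by (simp_all add: Unt_obj TenO_obj)

lemma iso_ten [simp]:
  assumes "iso C f" and "iso C g"
  shows "iso C (f \<boxtimes> g)"
  using assms by (intro isoI[of _ "inv_arr C f \<boxtimes> inv_arr C g"]) (simp_all add: iso_arr)

lemma Ass_typing [simp]:
  assumes "a \<in> Obj C" and "b \<in> Obj C" and "c \<in> Obj C"
  shows "Ass C a b c \<in> Arr C" and "Dom C (Ass C a b c) = a \<otimes> (b \<otimes> c)"
    and "Cod C (Ass C a b c) = (a \<otimes> b) \<otimes> c" and "iso C (Ass C a b c)"
  using Ass_hom[OF assms] Ass_iso[OF assms] by (simp_all add: hom_iff)

lemma Run_typing [simp]:
  assumes "a \<in> Obj C"
  shows "Run C a \<in> Arr C" and "Dom C (Run C a) = a \<otimes> Unt C"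
    and "Cod C (Run C a) = a" and "iso C (Run C a)"
  using Run_hom[OF assms] Run_iso[OF assms] by (simp_all add: hom_iff)

lemma Lun_typing [simp]:
  assumes "a \<in> Obj C"
  shows "Lun C a \<in> Arr C" and "Dom C (Lun C a) = Unt C \<otimes> a"
    and "Cod C (Lun C a) = a" and "iso C (Lun C a)"
  using Lun_hom[OF assms] Lun_iso[OF assms] by (simp_all add: hom_iff)

lemma Sym_typing [simp]:
  assumes "a \<in> Obj C" and "b \<in> Obj C"
  shows "Sym C a b \<in> Arr C" and "Dom C (Sym C a b) = a \<otimes> b" and "Cod C (Sym C a b) = b \<otimes> a"
  using Sym_hom[OF assms] by (simp_all add: hom_iff)

lemma ass_nat:
  assumes "f \<in> Arr C" and "g \<in> Arr C" and "h \<in> Arr C"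
  shows "Ass C (Cod C f) (Cod C g) (Cod C h) \<cdot> (f \<boxtimes> (g \<boxtimes> h)) =
    ((f \<boxtimes> g) \<boxtimes> h) \<cdot> Ass C (Dom C f) (Dom C g) (Dom C h)"
  using assms by (intro Ass_nat) (simp_all add: hom_iff)

lemma run_nat: "f \<in> Arr C \<Longrightarrow> Run C (Cod C f) \<cdot> (f \<boxtimes> Idn C (Unt C)) = f \<cdot> Run C (Dom C f)"
  by (intro Run_nat) (simp add: hom_iff)

lemma lun_nat: "f \<in> Arr C \<Longrightarrow> Lun C (Cod C f) \<cdot> (Idn C (Unt C) \<boxtimes> f) = f \<cdot> Lun C (Dom C f)"
  by (intro Lun_nat) (simp add: hom_iff)

lemma sym_nat:
  "f \<in> Arr C \<Longrightarrow> g \<in> Arr C \<Longrightarrow>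
    Sym C (Cod C f) (Cod C g) \<cdot> (f \<boxtimes> g) = (g \<boxtimes> f) \<cdot> Sym C (Dom C f) (Dom C g)"
  by (intro Sym_nat) (simp_all add: hom_iff)

text \<open>Because \<open>r\<close> and \<open>l\<close> are natural isomorphisms, tensoring with \<open>I\<close> loses no information.\<close>

lemma run_faithful:
  assumes "f \<boxtimes> Idn C (Unt C) = g \<boxtimes> Idn C (Unt C)"
    and "f \<in> Arr C" and "g \<in> Arr C" and "Dom C f = Dom C g" and "Cod C f = Cod C g"
  shows "f = g"
  using run_nat[of f] run_nat[of g] assms
  by (intro iso_cancel_right[of f "Run C (Dom C f)" g]) simp_all

lemma lun_faithful:
  assumes "Idn C (Unt C) \<boxtimes> f = Idn C (Unt C) \<boxtimes> g"
    and "f \<in> Arr C" and "g \<in> Arr C" and "Dom C f = Dom C g" and "Cod C f = Cod C g"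
  shows "f = g"
  using lun_nat[of f] lun_nat[of g] assms
  by (intro iso_cancel_right[of f "Lun C (Dom C f)" g]) simp_all

end

section \<open>Coherence\<close>

text \<open>Equations between composites of canonical arrows are decided by an action.  A bracketed word \<open>u\<close>
  with letters \<open>a\<^sub>1, \<dots>, a\<^sub>n\<close> sends an object \<open>x\<close> to the right-nested product
  \<open>a\<^sub>1 \<otimes> (a\<^sub>2 \<otimes> (\<dots> \<otimes> x))\<close>, which forgets the brackets and the units of \<open>u\<close> and is
  canonically isomorphic to \<open>u \<otimes> x\<close>.  Transported along this isomorphism, tensoring with \<open>x\<close> turns
  associativity and unit arrows into identities, and the symmetry of two letters into a swap of
  adjacent factors.  Two composites with the same action agree after tensoring with \<open>I\<close>, hence
  agree.  What remains of an equation is then a comparison of products of swaps, which are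
  involutive and natural.\<close>

datatype 'o tree = One | Leaf 'o | Node "'o tree" "'o tree"

text \<open>Symmetries are needed as generators for letters only; those of longer words are composites of
  these by the hexagon.\<close>

datatype 'o expr =
    EId "'o tree"
  | EComp "'o expr" "'o expr"
  | ELeft "'o tree" "'o expr"
  | ERight "'o expr" "'o tree"
  | EAss "'o tree" "'o tree" "'o tree"
  | EAssInv "'o tree" "'o tree" "'o tree"
  | ERun "'o tree"
  | ERunInv "'o tree"
  | ELun "'o tree"
  | ELunInv "'o tree"
  | ESym 'o 'o

primrec edom :: "'o expr \<Rightarrow> 'o tree" where
  "edom (EId u) = u"
| "edom (EComp q p) = edom p"
| "edom (ELeft u p) = Node u (edom p)"
| "edom (ERight p u) = Node (edom p) u"
| "edom (EAss u v w) = Node u (Node v w)"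
| "edom (EAssInv u v w) = Node (Node u v) w"
| "edom (ERun u) = Node u One"
| "edom (ERunInv u) = u"
| "edom (ELun u) = Node One u"
| "edom (ELunInv u) = u"
| "edom (ESym a b) = Node (Leaf a) (Leaf b)"

primrec ecod :: "'o expr \<Rightarrow> 'o tree" where
  "ecod (EId u) = u"
| "ecod (EComp q p) = ecod q"
| "ecod (ELeft u p) = Node u (ecod p)"
| "ecod (ERight p u) = Node (ecod p) u"
| "ecod (EAss u v w) = Node (Node u v) w"
| "ecod (EAssInv u v w) = Node u (Node v w)"
| "ecod (ERun u) = u"
| "ecod (ERunInv u) = Node u One"
| "ecod (ELun u) = u"
| "ecod (ELunInv u) = Node One u"
| "ecod (ESym a b) = Node (Leaf b) (Leaf a)"

primrec expr_ok :: "'o set \<Rightarrow> 'o expr \<Rightarrow> bool" where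
  "expr_ok S (EId u) \<longleftrightarrow> set_tree u \<subseteq> S"
| "expr_ok S (EComp q p) \<longleftrightarrow> expr_ok S q \<and> expr_ok S p \<and> ecod p = edom q"
| "expr_ok S (ELeft u p) \<longleftrightarrow> set_tree u \<subseteq> S \<and> expr_ok S p"
| "expr_ok S (ERight p u) \<longleftrightarrow> set_tree u \<subseteq> S \<and> expr_ok S p"
| "expr_ok S (EAss u v w) \<longleftrightarrow> set_tree u \<subseteq> S \<and> set_tree v \<subseteq> S \<and> set_tree w \<subseteq> S"
| "expr_ok S (EAssInv u v w) \<longleftrightarrow> set_tree u \<subseteq> S \<and> set_tree v \<subseteq> S \<and> set_tree w \<subseteq> S"
| "expr_ok S (ERun u) \<longleftrightarrow> set_tree u \<subseteq> S"
| "expr_ok S (ERunInv u) \<longleftrightarrow> set_tree u \<subseteq> S"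
| "expr_ok S (ELun u) \<longleftrightarrow> set_tree u \<subseteq> S"
| "expr_ok S (ELunInv u) \<longleftrightarrow> set_tree u \<subseteq> S"
| "expr_ok S (ESym a b) \<longleftrightarrow> a \<in> S \<and> b \<in> S"

lemma expr_ok_typing [simp]:
  assumes "expr_ok S p"
  shows "set_tree (edom p) \<subseteq> S" and "set_tree (ecod p) \<subseteq> S"
proof -
  have "set_tree (edom p) \<subseteq> S \<and> set_tree (ecod p) \<subseteq> S"
    using assms by (induction p) auto
  then show "set_tree (edom p) \<subseteq> S" and "set_tree (ecod p) \<subseteq> S" by simp_all
qed

context
  fixes C :: "('o, 'm) smc" (structure)
begin

primrec eval_tree :: "'o tree \<Rightarrow> 'o" where
  "eval_tree One = Unt C"
| "eval_tree (Leaf a) = a"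
| "eval_tree (Node u v) = eval_tree u \<otimes> eval_tree v"

primrec eval :: "'o expr \<Rightarrow> 'm" where
  "eval (EId u) = Idn C (eval_tree u)"
| "eval (EComp q p) = eval q \<cdot> eval p"
| "eval (ELeft u p) = Idn C (eval_tree u) \<boxtimes> eval p"
| "eval (ERight p u) = eval p \<boxtimes> Idn C (eval_tree u)"
| "eval (EAss u v w) = Ass C (eval_tree u) (eval_tree v) (eval_tree w)"
| "eval (EAssInv u v w) = inv_arr C (Ass C (eval_tree u) (eval_tree v) (eval_tree w))"
| "eval (ERun u) = Run C (eval_tree u)"
| "eval (ERunInv u) = inv_arr C (Run C (eval_tree u))"
| "eval (ELun u) = Lun C (eval_tree u)"
| "eval (ELunInv u) = inv_arr C (Lun C (eval_tree u))"
| "eval (ESym a b) = Sym C a b"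

primrec act :: "'o tree \<Rightarrow> 'o \<Rightarrow> 'o" where
  "act One x = x"
| "act (Leaf a) x = a \<otimes> x"
| "act (Node u v) x = act u (act v x)"

primrec act_arr :: "'o tree \<Rightarrow> 'm \<Rightarrow> 'm" where
  "act_arr One f = f"
| "act_arr (Leaf a) f = Idn C a \<boxtimes> f"
| "act_arr (Node u v) f = act_arr u (act_arr v f)"

text \<open>The canonical arrow from \<open>act u x\<close> to \<open>u \<otimes> x\<close>.\<close>

primrec flat :: "'o tree \<Rightarrow> 'o \<Rightarrow> 'm" where
  "flat One x = inv_arr C (Lun C x)"
| "flat (Leaf a) x = Idn C (a \<otimes> x)"
| "flat (Node u v) x = Ass C (eval_tree u) (eval_tree v) x \<cdot>
    (Idn C (eval_tree u) \<boxtimes> flat v x) \<cdot> flat u (act v x)"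

text \<open>The symmetry of two letters, rebracketed so as to act on the first two factors of a right-nested
  product.\<close>

definition swap :: "'o \<Rightarrow> 'o \<Rightarrow> 'o \<Rightarrow> 'm" where
  "swap a b x = inv_arr C (Ass C b a x) \<cdot> (Sym C a b \<boxtimes> Idn C x) \<cdot> Ass C a b x"

text \<open>The action of an expression: the conjugate of \<open>eval p \<otimes> x\<close> by the canonical arrows
  (lemma \<open>flat_eact\<close>), computed without them.\<close>

primrec eact :: "'o expr \<Rightarrow> 'o \<Rightarrow> 'm" where
  "eact (EId u) x = Idn C (act u x)"
| "eact (EComp q p) x = eact q x \<cdot> eact p x"
| "eact (ELeft u p) x = act_arr u (eact p x)"
| "eact (ERight p u) x = eact p (act u x)"
| "eact (EAss u v w) x = Idn C (act u (act v (act w x)))"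
| "eact (EAssInv u v w) x = Idn C (act u (act v (act w x)))"
| "eact (ERun u) x = Idn C (act u x)"
| "eact (ERunInv u) x = Idn C (act u x)"
| "eact (ELun u) x = Idn C (act u x)"
| "eact (ELunInv u) x = Idn C (act u x)"
| "eact (ESym a b) x = swap a b x"

end

context smc
begin

lemma pentagon_arr:
  "a \<in> Obj C \<Longrightarrow> b \<in> Obj C \<Longrightarrow> c \<in> Obj C \<Longrightarrow> d \<in> Obj C \<Longrightarrow>
    (Ass C a b c \<boxtimes> Idn C d) \<cdot> (Ass C a (b \<otimes> c) d \<cdot> (Idn C a \<boxtimes> Ass C b c d)) =
    Ass C (a \<otimes> b) c d \<cdot> Ass C a b (c \<otimes> d)"
  by (simp only: pentagon)

text \<open>Kelly's argument: this triangle for \<open>l\<close> is not among the axioms, but after tensoring with \<open>I\<close> on the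
  left it follows from the pentagon for \<open>I, I, a, x\<close> and the given triangle, and tensoring with \<open>I\<close>
  is faithful.\<close>

lemma lun_ten:
  assumes a [simp]: "a \<in> Obj C" and x [simp]: "x \<in> Obj C"
  shows "(Lun C a \<boxtimes> Idn C x) \<cdot> Ass C (Unt C) a x = Lun C (a \<otimes> x)"
proof -
  let ?I = "Unt C" and ?i = "Idn C (Unt C)"
  have n1: "((Run C ?I \<boxtimes> Idn C a) \<boxtimes> Idn C x) \<cdot> Ass C (?I \<otimes> ?I) a x =
      Ass C ?I a x \<cdot> (Run C ?I \<boxtimes> Idn C (a \<otimes> x))"
    using ass_nat[of "Run C ?I" "Idn C a" "Idn C x"] by simp
  have n2: "((?i \<boxtimes> Lun C a) \<boxtimes> Idn C x) \<cdot> Ass C ?I (?I \<otimes> a) x =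
      Ass C ?I a x \<cdot> (?i \<boxtimes> (Lun C a \<boxtimes> Idn C x))"
    using ass_nat[of ?i "Lun C a" "Idn C x"] by simp
  have "Ass C ?I a x \<cdot> (?i \<boxtimes> Lun C (a \<otimes> x)) =
      Ass C ?I a x \<cdot> ((Run C ?I \<boxtimes> Idn C (a \<otimes> x)) \<cdot> Ass C ?I ?I (a \<otimes> x))"
    by (simp add: triangle)
  also have "\<dots> = ((Run C ?I \<boxtimes> Idn C a) \<boxtimes> Idn C x) \<cdot> (Ass C (?I \<otimes> ?I) a x \<cdot> Ass C ?I ?I (a \<otimes> x))"
    by (simp add: comp_extend[OF n1])
  also have "\<dots> = ((?i \<boxtimes> Lun C a) \<boxtimes> Idn C x) \<cdot>
      (Ass C ?I (?I \<otimes> a) x \<cdot> (?i \<boxtimes> Ass C ?I a x))"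
    by (simp add: pentagon triangle)
  also have "\<dots> = Ass C ?I a x \<cdot> (?i \<boxtimes> ((Lun C a \<boxtimes> Idn C x) \<cdot> Ass C ?I a x))"
    by (simp add: comp_extend[OF n2])
  finally have "?i \<boxtimes> Lun C (a \<otimes> x) = ?i \<boxtimes> ((Lun C a \<boxtimes> Idn C x) \<cdot> Ass C ?I a x)"
    by (rule iso_cancel_left) simp_all
  then have "Lun C (a \<otimes> x) = (Lun C a \<boxtimes> Idn C x) \<cdot> Ass C ?I a x"
    by (rule lun_faithful) simp_all
  then show ?thesis by simp
qed

lemma eval_tree_in [simp]: "set_tree u \<subseteq> Obj C \<Longrightarrow> eval_tree C u \<in> Obj C"
  by (induction u) simp_all

lemma act_in [simp]: "set_tree u \<subseteq> Obj C \<Longrightarrow> x \<in> Obj C \<Longrightarrow> act C u x \<in> Obj C"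
  by (induction u arbitrary: x) simp_all

lemma act_arr_typing [simp]:
  assumes "set_tree u \<subseteq> Obj C" and "f \<in> Arr C"
  shows "act_arr C u f \<in> Arr C" and "Dom C (act_arr C u f) = act C u (Dom C f)"
    and "Cod C (act_arr C u f) = act C u (Cod C f)"
  using assms by (induction u arbitrary: f) simp_all

lemma act_arr_idn [simp]:
  "set_tree u \<subseteq> Obj C \<Longrightarrow> x \<in> Obj C \<Longrightarrow> act_arr C u (Idn C x) = Idn C (act C u x)"
  by (induction u arbitrary: x) simp_all

lemma flat_typing [simp]:
  assumes "set_tree u \<subseteq> Obj C" and "x \<in> Obj C"
  shows "flat C u x \<in> Arr C" and "Dom C (flat C u x) = act C u x"
    and "Cod C (flat C u x) = eval_tree C u \<otimes> x" and "iso C (flat C u x)"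
  using assms by (induction u arbitrary: x) simp_all

lemma flat_nat:
  assumes "set_tree u \<subseteq> Obj C" and "f \<in> Arr C"
  shows "flat C u (Cod C f) \<cdot> act_arr C u f = (Idn C (eval_tree C u) \<boxtimes> f) \<cdot> flat C u (Dom C f)"
  using assms
proof (induction u arbitrary: f)
  case One
  then have "Lun C (Cod C f) \<cdot> (inv_arr C (Lun C (Cod C f)) \<cdot> f) =
      Lun C (Cod C f) \<cdot> ((Idn C (Unt C) \<boxtimes> f) \<cdot> inv_arr C (Lun C (Dom C f)))"
    by (simp add: comp_extend[OF lun_nat])
  then have "inv_arr C (Lun C (Cod C f)) \<cdot> f = (Idn C (Unt C) \<boxtimes> f) \<cdot> inv_arr C (Lun C (Dom C f))"
    by (rule iso_cancel_left) (use One in simp_all)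
  then show ?case by simp
next
  case (Leaf a)
  then show ?case by simp
next
  case (Node u v)
  note [simp] = Node.prems
  have su: "set_tree u \<subseteq> Obj C" and sv: "set_tree v \<subseteq> Obj C" using Node.prems by auto
  note [simp] = su sv
  have u: "flat C u (act C v (Cod C f)) \<cdot> act_arr C u (act_arr C v f) =
      (Idn C (eval_tree C u) \<boxtimes> act_arr C v f) \<cdot> flat C u (act C v (Dom C f))"
    using Node.IH(1)[of "act_arr C v f"] by simp
  have a: "Ass C (eval_tree C u) (eval_tree C v) (Cod C f) \<cdot>
      (Idn C (eval_tree C u) \<boxtimes> (Idn C (eval_tree C v) \<boxtimes> f)) =
      (Idn C (eval_tree C u \<otimes> eval_tree C v) \<boxtimes> f) \<cdot> Ass C (eval_tree C u) (eval_tree C v) (Dom C f)"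
    using ass_nat[of "Idn C (eval_tree C u)" "Idn C (eval_tree C v)" f] by simp
  have "flat C (Node u v) (Cod C f) \<cdot> act_arr C (Node u v) f =
      Ass C (eval_tree C u) (eval_tree C v) (Cod C f) \<cdot>
      (Idn C (eval_tree C u) \<boxtimes> (flat C v (Cod C f) \<cdot> act_arr C v f)) \<cdot> flat C u (act C v (Dom C f))"
    by (simp add: u)
  also have "\<dots> = Ass C (eval_tree C u) (eval_tree C v) (Cod C f) \<cdot>
      ((Idn C (eval_tree C u) \<boxtimes> (Idn C (eval_tree C v) \<boxtimes> f)) \<cdot>
      ((Idn C (eval_tree C u) \<boxtimes> flat C v (Dom C f)) \<cdot> flat C u (act C v (Dom C f))))"
    using Node.IH(2)[of f] by simp
  also have "\<dots> = (Idn C (eval_tree C (Node u v)) \<boxtimes> f) \<cdot> flat C (Node u v) (Dom C f)"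
    by (simp add: comp_extend[OF a] del: ten_comp' ten_comp)
  finally show ?case .
qed

lemma swap_typing [simp]:
  assumes "a \<in> Obj C" and "b \<in> Obj C" and "x \<in> Obj C"
  shows "swap C a b x \<in> Arr C" and "Dom C (swap C a b x) = a \<otimes> (b \<otimes> x)"
    and "Cod C (swap C a b x) = b \<otimes> (a \<otimes> x)"
  using assms by (simp_all add: swap_def)

lemma swap_inv:
  assumes [simp]: "a \<in> Obj C" "b \<in> Obj C" "x \<in> Obj C"
  shows "swap C b a x \<cdot> swap C a b x = Idn C (a \<otimes> (b \<otimes> x))"
  by (simp add: swap_def Sym_inv)

lemma swap_nat:
  assumes [simp]: "a \<in> Obj C" "b \<in> Obj C" "f \<in> Arr C"
  shows "swap C a b (Cod C f) \<cdot> (Idn C a \<boxtimes> (Idn C b \<boxtimes> f)) =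
    (Idn C b \<boxtimes> (Idn C a \<boxtimes> f)) \<cdot> swap C a b (Dom C f)"
proof -
  have n: "Ass C a b (Cod C f) \<cdot> (Idn C a \<boxtimes> (Idn C b \<boxtimes> f)) =
      (Idn C (a \<otimes> b) \<boxtimes> f) \<cdot> Ass C a b (Dom C f)"
    using ass_nat[of "Idn C a" "Idn C b" f] by simp
  have n': "Ass C b a (Cod C f) \<cdot> (Idn C b \<boxtimes> (Idn C a \<boxtimes> f)) =
      (Idn C (b \<otimes> a) \<boxtimes> f) \<cdot> Ass C b a (Dom C f)"
    using ass_nat[of "Idn C b" "Idn C a" f] by simp
  have "Ass C b a (Cod C f) \<cdot> (swap C a b (Cod C f) \<cdot> (Idn C a \<boxtimes> (Idn C b \<boxtimes> f))) =
    Ass C b a (Cod C f) \<cdot> ((Idn C b \<boxtimes> (Idn C a \<boxtimes> f)) \<cdot> swap C a b (Dom C f))"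
    by (simp add: swap_def n comp_extend[OF n'])
  then show ?thesis by (rule iso_cancel_left) simp_all
qed

lemma eval_typing [simp]:
  assumes "expr_ok (Obj C) p"
  shows "eval C p \<in> Arr C" and "Dom C (eval C p) = eval_tree C (edom p)"
    and "Cod C (eval C p) = eval_tree C (ecod p)"
  using assms by (induction p) simp_all

lemma eact_typing [simp]:
  assumes "expr_ok (Obj C) p" and "x \<in> Obj C"
  shows "eact C p x \<in> Arr C" and "Dom C (eact C p x) = act C (edom p) x"
    and "Cod C (eact C p x) = act C (ecod p) x"
  using assms by (induction p arbitrary: x) simp_all

text \<open>The pentagon says that the associativity arrow acts as the identity; likewise the two triangles
  for the unit arrows.\<close>

lemma flat_ass:
  assumes [simp]: "set_tree u \<subseteq> Obj C" "set_tree v \<subseteq> Obj C" "set_tree w \<subseteq> Obj C" "x \<in> Obj C"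
  shows "(eval C (EAss u v w) \<boxtimes> Idn C x) \<cdot> flat C (Node u (Node v w)) x = flat C (Node (Node u v) w) x"
proof -
  let ?u = "eval_tree C u" and ?v = "eval_tree C v" and ?w = "eval_tree C w"
  let ?k = "(Idn C ?u \<boxtimes> flat C v (act C w x)) \<cdot> flat C u (act C v (act C w x))"
  have n: "Ass C ?u ?v (?w \<otimes> x) \<cdot> (Idn C ?u \<boxtimes> (Idn C ?v \<boxtimes> flat C w x)) =
      (Idn C (?u \<otimes> ?v) \<boxtimes> flat C w x) \<cdot> Ass C ?u ?v (act C w x)"
    using ass_nat[of "Idn C ?u" "Idn C ?v" "flat C w x"] by simp
  have p: "(Ass C ?u ?v ?w \<boxtimes> Idn C x) \<cdot> (Ass C ?u (?v \<otimes> ?w) x \<cdot> ((Idn C ?u \<boxtimes> Ass C ?v ?w x) \<cdot> k)) =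
      Ass C (?u \<otimes> ?v) ?w x \<cdot> (Ass C ?u ?v (?w \<otimes> x) \<cdot> k)"
    if "k \<in> Arr C" "Cod C k = ?u \<otimes> (?v \<otimes> (?w \<otimes> x))" for k
    using comp_extend[OF pentagon_arr[of ?u ?v ?w x], of k] that by simp
  have "(eval C (EAss u v w) \<boxtimes> Idn C x) \<cdot> flat C (Node u (Node v w)) x =
      (Ass C ?u ?v ?w \<boxtimes> Idn C x) \<cdot> (Ass C ?u (?v \<otimes> ?w) x \<cdot> ((Idn C ?u \<boxtimes> Ass C ?v ?w x) \<cdot>
        ((Idn C ?u \<boxtimes> (Idn C ?v \<boxtimes> flat C w x)) \<cdot> ?k)))"
    by simp
  also have "\<dots> = Ass C (?u \<otimes> ?v) ?w x \<cdot> (Ass C ?u ?v (?w \<otimes> x) \<cdot>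
        ((Idn C ?u \<boxtimes> (Idn C ?v \<boxtimes> flat C w x)) \<cdot> ?k))"
    by (rule p) simp_all
  also have "\<dots> = flat C (Node (Node u v) w) x"
    by (simp add: comp_extend[OF n] del: ten_comp ten_comp')
  finally show ?thesis .
qed

lemma flat_run:
  assumes [simp]: "set_tree u \<subseteq> Obj C" "x \<in> Obj C"
  shows "(eval C (ERun u) \<boxtimes> Idn C x) \<cdot> flat C (Node u One) x = flat C u x"
  by (simp add: comp_extend[OF triangle])

lemma flat_lun:
  assumes [simp]: "set_tree u \<subseteq> Obj C" "x \<in> Obj C"
  shows "(eval C (ELun u) \<boxtimes> Idn C x) \<cdot> flat C (Node One u) x = flat C u x"
proof -
  have n: "Lun C (eval_tree C u \<otimes> x) \<cdot> (Idn C (Unt C) \<boxtimes> flat C u x) = flat C u x \<cdot> Lun C (act C u x)"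
    using lun_nat[of "flat C u x"] by simp
  show ?thesis
    by (simp add: comp_extend[OF lun_ten] comp_extend[OF n])
qed

text \<open>Among the generators only the symmetries of letters act by something other than identities, and
  for these the claim is the definition of \<^const>\<open>swap\<close>.\<close>

lemma flat_eact:
  assumes "expr_ok (Obj C) p" and "x \<in> Obj C"
  shows "flat C (ecod p) x \<cdot> eact C p x = (eval C p \<boxtimes> Idn C x) \<cdot> flat C (edom p) x"
  using assms
proof (induction p arbitrary: x)
  case (EId u)
  then show ?case by simp
next
  case (EComp q p)
  from EComp.prems have [simp]: "expr_ok (Obj C) q" "expr_ok (Obj C) p" "ecod p = edom q" "x \<in> Obj C"
    by simp_all
  have q: "flat C (ecod q) x \<cdot> eact C q x = (eval C q \<boxtimes> Idn C x) \<cdot> flat C (edom q) x"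
    and p: "flat C (edom q) x \<cdot> eact C p x = (eval C p \<boxtimes> Idn C x) \<cdot> flat C (edom p) x"
    using EComp.IH(1)[of x] EComp.IH(2)[of x] by simp_all
  show ?case by (simp add: comp_extend[OF q] p)
next
  case (ELeft u p)
  from ELeft.prems have [simp]: "set_tree u \<subseteq> Obj C" "expr_ok (Obj C) p" "x \<in> Obj C" by simp_all
  let ?u = "eval_tree C u" and ?v = "eval_tree C (edom p)" and ?w = "eval_tree C (ecod p)"
  have n: "flat C u (act C (ecod p) x) \<cdot> act_arr C u (eact C p x) =
      (Idn C ?u \<boxtimes> eact C p x) \<cdot> flat C u (act C (edom p) x)"
    using flat_nat[of u "eact C p x"] by simp
  have a: "Ass C ?u ?w x \<cdot> (Idn C ?u \<boxtimes> (eval C p \<boxtimes> Idn C x)) =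
      ((Idn C ?u \<boxtimes> eval C p) \<boxtimes> Idn C x) \<cdot> Ass C ?u ?v x"
    using ass_nat[of "Idn C ?u" "eval C p" "Idn C x"] by simp
  have "flat C (ecod (ELeft u p)) x \<cdot> eact C (ELeft u p) x =
      Ass C ?u ?w x \<cdot> (Idn C ?u \<boxtimes> (flat C (ecod p) x \<cdot> eact C p x)) \<cdot> flat C u (act C (edom p) x)"
    by (simp add: n)
  also have "\<dots> = Ass C ?u ?w x \<cdot> (Idn C ?u \<boxtimes> (eval C p \<boxtimes> Idn C x)) \<cdot>
      (Idn C ?u \<boxtimes> flat C (edom p) x) \<cdot> flat C u (act C (edom p) x)"
    by (simp add: ELeft.IH)
  also have "\<dots> = (eval C (ELeft u p) \<boxtimes> Idn C x) \<cdot> flat C (edom (ELeft u p)) x"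
    by (simp add: comp_extend[OF a] del: ten_comp' ten_comp)
  finally show ?case .
next
  case (ERight p w)
  from ERight.prems have [simp]: "set_tree w \<subseteq> Obj C" "expr_ok (Obj C) p" "x \<in> Obj C" by simp_all
  let ?w = "eval_tree C w" and ?u = "eval_tree C (edom p)" and ?v = "eval_tree C (ecod p)"
  have a: "Ass C ?v ?w x \<cdot> (eval C p \<boxtimes> Idn C (?w \<otimes> x)) =
      ((eval C p \<boxtimes> Idn C ?w) \<boxtimes> Idn C x) \<cdot> Ass C ?u ?w x"
    using ass_nat[of "eval C p" "Idn C ?w" "Idn C x"] by simp
  have "flat C (ecod (ERight p w)) x \<cdot> eact C (ERight p w) x =
      Ass C ?v ?w x \<cdot> (Idn C ?v \<boxtimes> flat C w x) \<cdot>
        (eval C p \<boxtimes> Idn C (act C w x)) \<cdot> flat C (edom p) (act C w x)"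
    by (simp add: ERight.IH del: ten_comp' ten_comp)
  also have "\<dots> = Ass C ?v ?w x \<cdot> (eval C p \<boxtimes> Idn C (?w \<otimes> x)) \<cdot>
        (Idn C ?u \<boxtimes> flat C w x) \<cdot> flat C (edom p) (act C w x)"
    by simp
  also have "\<dots> = (eval C (ERight p w) \<boxtimes> Idn C x) \<cdot> flat C (edom (ERight p w)) x"
    by (simp add: comp_extend[OF a] del: ten_comp' ten_comp)
  finally show ?case .
next
  case (EAss u v w)
  then show ?case using flat_ass[of u v w x] by simp
next
  case (EAssInv u v w)
  then have [simp]: "set_tree u \<subseteq> Obj C" "set_tree v \<subseteq> Obj C" "set_tree w \<subseteq> Obj C" "x \<in> Obj C"
    by simp_all
  have "flat C (edom (EAssInv u v w)) x =
      (eval C (EAss u v w) \<boxtimes> Idn C x) \<cdot> flat C (ecod (EAssInv u v w)) x"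
    using flat_ass[of u v w x] by simp
  then show ?case by (simp del: flat.simps)
next
  case (ERun u)
  then show ?case using flat_run[of u x] by simp
next
  case (ERunInv u)
  then have [simp]: "set_tree u \<subseteq> Obj C" "x \<in> Obj C" by simp_all
  have "flat C u x = (eval C (ERun u) \<boxtimes> Idn C x) \<cdot> flat C (Node u One) x"
    using flat_run[of u x] by simp
  then show ?case by (simp del: flat.simps)
next
  case (ELun u)
  then show ?case using flat_lun[of u x] by simp
next
  case (ELunInv u)
  then have [simp]: "set_tree u \<subseteq> Obj C" "x \<in> Obj C" by simp_all
  have "flat C u x = (eval C (ELun u) \<boxtimes> Idn C x) \<cdot> flat C (Node One u) x"
    using flat_lun[of u x] by simp
  then show ?case by (simp del: flat.simps)
next
  case (ESym a b)
  then show ?case by (simp add: swap_def)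
qed

text \<open>The canonical arrow \<^const>\<open>flat\<close> is invertible, so equal actions force
  \<open>eval p \<otimes> I = eval q \<otimes> I\<close>.\<close>

theorem coherence:
  assumes p: "expr_ok (Obj C) p" and q: "expr_ok (Obj C) q"
    and e: "edom p = edom q" "ecod p = ecod q" "eact C p (Unt C) = eact C q (Unt C)"
  shows "eval C p = eval C q"
proof -
  have "(eval C p \<boxtimes> Idn C (Unt C)) \<cdot> flat C (edom q) (Unt C) =
      (eval C q \<boxtimes> Idn C (Unt C)) \<cdot> flat C (edom q) (Unt C)"
    using flat_eact[OF p, of "Unt C"] flat_eact[OF q, of "Unt C"] e by simp
  then have "eval C p \<boxtimes> Idn C (Unt C) = eval C q \<boxtimes> Idn C (Unt C)"
    by (rule iso_cancel_right) (use p q e in simp_all)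
  then show ?thesis
    by (rule run_faithful) (use p q e in simp_all)
qed

end

text \<open>The symmetry of two arbitrary words, spelled out by the hexagons and the unit laws in terms of
  the symmetries of letters.\<close>

primrec esym1 :: "'o \<Rightarrow> 'o tree \<Rightarrow> 'o expr" where
  "esym1 a One = EComp (ELunInv (Leaf a)) (ERun (Leaf a))"
| "esym1 a (Leaf b) = ESym a b"
| "esym1 a (Node v w) = EComp (EAss v w (Leaf a)) (EComp (ELeft v (esym1 a w))
    (EComp (EAssInv v (Leaf a) w) (EComp (ERight (esym1 a v) w) (EAss (Leaf a) v w))))"

primrec esym :: "'o tree \<Rightarrow> 'o tree \<Rightarrow> 'o expr" where
  "esym One v = EComp (ERunInv v) (ELun v)"
| "esym (Leaf a) v = esym1 a v"
| "esym (Node u w) v = EComp (EAssInv v u w) (EComp (ERight (esym u v) w)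
    (EComp (EAss u v w) (EComp (ELeft u (esym w v)) (EAssInv u w v))))"

declare esym.simps(3) [simp del] esym1.simps(3) [simp del]

definition einterchange :: "'o tree \<Rightarrow> 'o tree \<Rightarrow> 'o tree \<Rightarrow> 'o tree \<Rightarrow> 'o expr" where
  "einterchange u v w z = EComp (EAss u w (Node v z)) (EComp
     (ELeft u (EComp (EAssInv w v z) (EComp (ERight (esym v w) z) (EAss v w z))))
     (EAssInv u v (Node w z)))"

lemma esym1_typing [simp]:
  "edom (esym1 a v) = Node (Leaf a) v" "ecod (esym1 a v) = Node v (Leaf a)"
  "expr_ok S (esym1 a v) \<longleftrightarrow> a \<in> S \<and> set_tree v \<subseteq> S"
  by (induction v) (auto simp: esym1.simps)

lemma esym_typing [simp]:
  "edom (esym u v) = Node u v" "ecod (esym u v) = Node v u"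
  "expr_ok S (esym u v) \<longleftrightarrow> set_tree u \<subseteq> S \<and> set_tree v \<subseteq> S"
  by (induction u) (auto simp: esym.simps)

lemma einterchange_typing [simp]:
  "edom (einterchange u v w z) = Node (Node u v) (Node w z)"
  "ecod (einterchange u v w z) = Node (Node u w) (Node v z)"
  "expr_ok S (einterchange u v w z) \<longleftrightarrow>
    set_tree u \<subseteq> S \<and> set_tree v \<subseteq> S \<and> set_tree w \<subseteq> S \<and> set_tree z \<subseteq> S"
  by (auto simp: einterchange_def)

context smc
begin

lemma sym_ten_left:
  assumes [simp]: "a \<in> Obj C" "b \<in> Obj C" "c \<in> Obj C"
  shows "Sym C (a \<otimes> b) c = inv_arr C (Ass C c a b) \<cdot> (Sym C a c \<boxtimes> Idn C b) \<cdot> Ass C a c b \<cdot>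
    (Idn C a \<boxtimes> Sym C b c) \<cdot> inv_arr C (Ass C a b c)"
proof -
  have "Sym C (a \<otimes> b) c = inv_arr C (Ass C c a b) \<cdot>
      (Ass C c a b \<cdot> Sym C (a \<otimes> b) c \<cdot> Ass C a b c) \<cdot> inv_arr C (Ass C a b c)"
    by simp
  then show ?thesis by (simp add: hexagon)
qed

lemma sym_ten_right:
  assumes [simp]: "a \<in> Obj C" "b \<in> Obj C" "c \<in> Obj C"
  shows "Sym C a (b \<otimes> c) = Ass C b c a \<cdot> (Idn C b \<boxtimes> Sym C a c) \<cdot> inv_arr C (Ass C b a c) \<cdot>
    (Sym C a b \<boxtimes> Idn C c) \<cdot> Ass C a b c" (is "_ = ?r")
proof -
  have "?r \<cdot> Sym C (b \<otimes> c) a = Idn C ((b \<otimes> c) \<otimes> a)"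
    by (simp add: sym_ten_left Sym_inv)
  then have "(?r \<cdot> Sym C (b \<otimes> c) a) \<cdot> Sym C a (b \<otimes> c) = Sym C a (b \<otimes> c)"
    by simp
  moreover have "(?r \<cdot> Sym C (b \<otimes> c) a) \<cdot> Sym C a (b \<otimes> c) = ?r \<cdot> (Sym C (b \<otimes> c) a \<cdot> Sym C a (b \<otimes> c))"
    by (rule comp_assoc) simp_all
  moreover have "Sym C (b \<otimes> c) a \<cdot> Sym C a (b \<otimes> c) = Idn C (a \<otimes> (b \<otimes> c))"
    by (rule Sym_inv) simp_all
  ultimately show ?thesis by simp
qed

lemma sym_unit_left:
  assumes [simp]: "a \<in> Obj C"
  shows "Sym C (Unt C) a = inv_arr C (Run C a) \<cdot> Lun C a"
proof -
  have "Lun C a = Lun C a \<cdot> (Sym C a (Unt C) \<cdot> Sym C (Unt C) a)"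
    by (simp add: Sym_inv)
  also have "\<dots> = Run C a \<cdot> Sym C (Unt C) a"
    by (simp add: comp_extend[OF Sym_unit])
  finally show ?thesis by simp
qed

lemma sym_unit_right:
  assumes [simp]: "a \<in> Obj C"
  shows "Sym C a (Unt C) = inv_arr C (Lun C a) \<cdot> Run C a"
  by (simp flip: Sym_unit)

lemma eval_esym1 [simp]:
  "a \<in> Obj C \<Longrightarrow> set_tree v \<subseteq> Obj C \<Longrightarrow> eval C (esym1 a v) = Sym C a (eval_tree C v)"
  by (induction v) (simp_all add: esym1.simps sym_unit_right sym_ten_right)

lemma eval_esym [simp]:
  "set_tree u \<subseteq> Obj C \<Longrightarrow> set_tree v \<subseteq> Obj C \<Longrightarrow>
    eval C (esym u v) = Sym C (eval_tree C u) (eval_tree C v)"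
  by (induction u) (simp_all add: esym.simps sym_unit_left sym_ten_left)

lemma eact_esym1_Node [simp]:
  "a \<in> Obj C \<Longrightarrow> set_tree v \<subseteq> Obj C \<Longrightarrow> set_tree w \<subseteq> Obj C \<Longrightarrow> x \<in> Obj C \<Longrightarrow>
    eact C (esym1 a (Node v w)) x =
      act_arr C v (eact C (esym1 a w) x) \<cdot> eact C (esym1 a v) (act C w x)"
  by (simp add: esym1.simps)

lemma eact_esym_Node [simp]:
  "set_tree u \<subseteq> Obj C \<Longrightarrow> set_tree v \<subseteq> Obj C \<Longrightarrow> set_tree w \<subseteq> Obj C \<Longrightarrow> x \<in> Obj C \<Longrightarrow>
    eact C (esym (Node u w) v) x =
      eact C (esym u v) (act C w x) \<cdot> act_arr C u (eact C (esym w v) x)"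
  by (simp add: esym.simps)

lemma eval_einterchange [simp]:
  "set_tree u \<subseteq> Obj C \<Longrightarrow> set_tree v \<subseteq> Obj C \<Longrightarrow> set_tree w \<subseteq> Obj C \<Longrightarrow> set_tree z \<subseteq> Obj C \<Longrightarrow>
    eval C (einterchange u v w z) =
      interchange C (eval_tree C u) (eval_tree C v) (eval_tree C w) (eval_tree C z)"
  by (simp add: einterchange_def interchange_def)

lemma eact_einterchange [simp]:
  "set_tree u \<subseteq> Obj C \<Longrightarrow> set_tree v \<subseteq> Obj C \<Longrightarrow> set_tree w \<subseteq> Obj C \<Longrightarrow> set_tree z \<subseteq> Obj C \<Longrightarrow>
    x \<in> Obj C \<Longrightarrow> eact C (einterchange u v w z) x = act_arr C u (eact C (esym v w) (act C z x))"
  by (simp add: einterchange_def)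

lemma interchange_typing [simp]:
  assumes "a \<in> Obj C" and "b \<in> Obj C" and "c \<in> Obj C" and "d \<in> Obj C"
  shows "interchange C a b c d \<in> Arr C"
    and "Dom C (interchange C a b c d) = (a \<otimes> b) \<otimes> (c \<otimes> d)"
    and "Cod C (interchange C a b c d) = (a \<otimes> c) \<otimes> (b \<otimes> d)"
  using assms by (simp_all add: interchange_def)

lemma inv_ass_nat:
  assumes [simp]: "f \<in> Arr C" "g \<in> Arr C" "h \<in> Arr C"
  shows "inv_arr C (Ass C (Cod C f) (Cod C g) (Cod C h)) \<cdot> ((f \<boxtimes> g) \<boxtimes> h) =
    (f \<boxtimes> (g \<boxtimes> h)) \<cdot> inv_arr C (Ass C (Dom C f) (Dom C g) (Dom C h))"
proof -
  let ?d = "Ass C (Dom C f) (Dom C g) (Dom C h)" and ?c = "Ass C (Cod C f) (Cod C g) (Cod C h)"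
  have "?c \<cdot> (inv_arr C ?c \<cdot> ((f \<boxtimes> g) \<boxtimes> h)) = ?c \<cdot> ((f \<boxtimes> (g \<boxtimes> h)) \<cdot> inv_arr C ?d)"
    by (simp add: comp_extend[OF ass_nat] del: ten_comp ten_comp')
  then show ?thesis by (rule iso_cancel_left) simp_all
qed

lemma inv_run_nat:
  assumes [simp]: "f \<in> Arr C"
  shows "(f \<boxtimes> Idn C (Unt C)) \<cdot> inv_arr C (Run C (Dom C f)) = inv_arr C (Run C (Cod C f)) \<cdot> f"
proof -
  have "Run C (Cod C f) \<cdot> ((f \<boxtimes> Idn C (Unt C)) \<cdot> inv_arr C (Run C (Dom C f))) =
      Run C (Cod C f) \<cdot> (inv_arr C (Run C (Cod C f)) \<cdot> f)"
    by (simp add: comp_extend[OF run_nat])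
  then show ?thesis by (rule iso_cancel_left) simp_all
qed

lemma inv_lun_nat:
  assumes [simp]: "f \<in> Arr C"
  shows "(Idn C (Unt C) \<boxtimes> f) \<cdot> inv_arr C (Lun C (Dom C f)) = inv_arr C (Lun C (Cod C f)) \<cdot> f"
proof -
  have "Lun C (Cod C f) \<cdot> ((Idn C (Unt C) \<boxtimes> f) \<cdot> inv_arr C (Lun C (Dom C f))) =
      Lun C (Cod C f) \<cdot> (inv_arr C (Lun C (Cod C f)) \<cdot> f)"
    by (simp add: comp_extend[OF lun_nat])
  then show ?thesis by (rule iso_cancel_left) simp_all
qed

text \<open>Naturality is not an equation between canonical arrows, so it is derived step by step from the
  naturality of the constituents.\<close>

lemma interchange_nat:
  assumes [simp]: "f \<in> Arr C" "g \<in> Arr C" "h \<in> Arr C" "k \<in> Arr C"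
  shows "interchange C (Cod C f) (Cod C g) (Cod C h) (Cod C k) \<cdot> ((f \<boxtimes> g) \<boxtimes> (h \<boxtimes> k)) =
    ((f \<boxtimes> h) \<boxtimes> (g \<boxtimes> k)) \<cdot> interchange C (Dom C f) (Dom C g) (Dom C h) (Dom C k)"
proof -
  define m where "m b c d = inv_arr C (Ass C c b d) \<cdot> (Sym C b c \<boxtimes> Idn C d) \<cdot> Ass C b c d" for b c d
  have [simp]: "m b c d \<in> Arr C" "Dom C (m b c d) = b \<otimes> (c \<otimes> d)" "Cod C (m b c d) = c \<otimes> (b \<otimes> d)"
    if "b \<in> Obj C" "c \<in> Obj C" "d \<in> Obj C" for b c d
    using that by (simp_all add: m_def)
  have i: "interchange C a b c d =
      Ass C a c (b \<otimes> d) \<cdot> (Idn C a \<boxtimes> m b c d) \<cdot> inv_arr C (Ass C a b (c \<otimes> d))" for a b c d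
    by (simp add: interchange_def m_def)
  have m: "m (Cod C g) (Cod C h) (Cod C k) \<cdot> (g \<boxtimes> (h \<boxtimes> k)) =
      (h \<boxtimes> (g \<boxtimes> k)) \<cdot> m (Dom C g) (Dom C h) (Dom C k)"
  proof -
    have "m (Cod C g) (Cod C h) (Cod C k) \<cdot> (g \<boxtimes> (h \<boxtimes> k)) =
      inv_arr C (Ass C (Cod C h) (Cod C g) (Cod C k)) \<cdot> ((h \<boxtimes> g) \<boxtimes> k) \<cdot>
        (Sym C (Dom C g) (Dom C h) \<boxtimes> Idn C (Dom C k)) \<cdot> Ass C (Dom C g) (Dom C h) (Dom C k)"
      by (simp add: m_def ass_nat sym_nat)
    also have "\<dots> = (h \<boxtimes> (g \<boxtimes> k)) \<cdot> m (Dom C g) (Dom C h) (Dom C k)"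
      by (simp add: m_def comp_extend[OF inv_ass_nat] del: ten_comp ten_comp')
    finally show ?thesis .
  qed
  have "interchange C (Cod C f) (Cod C g) (Cod C h) (Cod C k) \<cdot> ((f \<boxtimes> g) \<boxtimes> (h \<boxtimes> k)) =
    Ass C (Cod C f) (Cod C h) (Cod C g \<otimes> Cod C k) \<cdot> ((f \<boxtimes> (h \<boxtimes> (g \<boxtimes> k))) \<cdot>
      (Idn C (Dom C f) \<boxtimes> m (Dom C g) (Dom C h) (Dom C k)) \<cdot>
      inv_arr C (Ass C (Dom C f) (Dom C g) (Dom C h \<otimes> Dom C k)))"
    using inv_ass_nat[of f g "h \<boxtimes> k"] by (simp add: i m)
  also have "\<dots> = ((f \<boxtimes> h) \<boxtimes> (g \<boxtimes> k)) \<cdot> interchange C (Dom C f) (Dom C g) (Dom C h) (Dom C k)"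
    using comp_extend[OF ass_nat[of f h "g \<boxtimes> k"]] by (simp add: i del: ten_comp ten_comp')
  finally show ?thesis .
qed

text \<open>The interchange is its own inverse and makes \<open>\<otimes>\<close> a symmetric monoidal functor of two variables.
  These facts are instances of coherence: the interchange acts by exchanging the two middle words,
  and the swaps on the two sides differ at most by cancellation and by commuting swaps of disjoint
  factors.\<close>

lemma interchange_inv:
  assumes [simp]: "a \<in> Obj C" "b \<in> Obj C" "c \<in> Obj C" "d \<in> Obj C"
  shows "interchange C a c b d \<cdot> interchange C a b c d = Idn C ((a \<otimes> b) \<otimes> (c \<otimes> d))"
  using coherence[of "EComp (einterchange (Leaf a) (Leaf c) (Leaf b) (Leaf d))
      (einterchange (Leaf a) (Leaf b) (Leaf c) (Leaf d))"
      "EId (Node (Node (Leaf a) (Leaf b)) (Node (Leaf c) (Leaf d)))"]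
  by (simp add: swap_inv)

lemma interchange_sym:
  assumes [simp]: "a \<in> Obj C" "b \<in> Obj C" "c \<in> Obj C" "d \<in> Obj C"
  shows "interchange C c d a b \<cdot> Sym C (a \<otimes> b) (c \<otimes> d) =
    (Sym C a c \<boxtimes> Sym C b d) \<cdot> interchange C a b c d"
  using coherence[of "EComp (einterchange (Leaf c) (Leaf d) (Leaf a) (Leaf b))
      (esym (Node (Leaf a) (Leaf b)) (Node (Leaf c) (Leaf d)))"
    "EComp (ERight (ESym a c) (Node (Leaf d) (Leaf b)))
      (EComp (ELeft (Node (Leaf a) (Leaf c)) (ESym b d))
      (einterchange (Leaf a) (Leaf b) (Leaf c) (Leaf d)))"]
  by (simp add: swap_inv)

lemma interchange_run:
  assumes [simp]: "a \<in> Obj C" "b \<in> Obj C"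
  shows "(Run C a \<boxtimes> Run C b) \<cdot> interchange C a b (Unt C) (Unt C) \<cdot>
    (Idn C (a \<otimes> b) \<boxtimes> inv_arr C (Run C (Unt C))) = Run C (a \<otimes> b)"
  using coherence[of "EComp (ERight (ERun (Leaf a)) (Leaf b)) (EComp (ELeft (Node (Leaf a) One) (ERun (Leaf b)))
      (EComp (einterchange (Leaf a) (Leaf b) One One) (ELeft (Node (Leaf a) (Leaf b)) (ERunInv One))))"
      "ERun (Node (Leaf a) (Leaf b))"]
  by simp

lemma interchange_lun:
  assumes [simp]: "a \<in> Obj C" "b \<in> Obj C"
  shows "(Lun C a \<boxtimes> Lun C b) \<cdot> interchange C (Unt C) (Unt C) a b \<cdot>
    (inv_arr C (Run C (Unt C)) \<boxtimes> Idn C (a \<otimes> b)) = Lun C (a \<otimes> b)"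
  using coherence[of "EComp (ERight (ELun (Leaf a)) (Leaf b)) (EComp (ELeft (Node One (Leaf a)) (ELun (Leaf b)))
      (EComp (einterchange One One (Leaf a) (Leaf b)) (ERight (ERunInv One) (Node (Leaf a) (Leaf b)))))"
      "ELun (Node (Leaf a) (Leaf b))"]
  by simp

lemma interchange_ass:
  assumes [simp]: "a \<in> Obj C" "a' \<in> Obj C" "b \<in> Obj C" "b' \<in> Obj C" "c \<in> Obj C" "c' \<in> Obj C"
  shows "(Ass C a b c \<boxtimes> Ass C a' b' c') \<cdot> interchange C a a' (b \<otimes> c) (b' \<otimes> c') \<cdot>
      (Idn C (a \<otimes> a') \<boxtimes> interchange C b b' c c') =
    interchange C (a \<otimes> b) (a' \<otimes> b') c c' \<cdot> (interchange C a a' b b' \<boxtimes> Idn C (c \<otimes> c')) \<cdot>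
      Ass C (a \<otimes> a') (b \<otimes> b') (c \<otimes> c')"
proof -
  let ?a = "Leaf a" and ?a' = "Leaf a'" and ?b = "Leaf b" and ?b' = "Leaf b'" and ?c = "Leaf c" and ?c' = "Leaf c'"
  let ?p = "EComp (ERight (EAss ?a ?b ?c) (Node (Node ?a' ?b') ?c'))
      (EComp (ELeft (Node ?a (Node ?b ?c)) (EAss ?a' ?b' ?c'))
      (EComp (einterchange ?a ?a' (Node ?b ?c) (Node ?b' ?c'))
        (ELeft (Node ?a ?a') (einterchange ?b ?b' ?c ?c'))))"
  let ?q = "EComp (einterchange (Node ?a ?b) (Node ?a' ?b') ?c ?c')
      (EComp (ERight (einterchange ?a ?a' ?b ?b') (Node ?c ?c'))
        (EAss (Node ?a ?a') (Node ?b ?b') (Node ?c ?c')))"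
  \<comment> \<open>The left side swaps \<open>b', c\<close> before \<open>a', b\<close>, the right side the other way round; these swaps
    concern disjoint factors.\<close>
  have n: "swap C a' b (c \<otimes> b' \<otimes> x) \<cdot> (Idn C a' \<boxtimes> (Idn C b \<boxtimes> swap C b' c x)) =
      (Idn C b \<boxtimes> (Idn C a' \<boxtimes> swap C b' c x)) \<cdot> swap C a' b (b' \<otimes> c \<otimes> x)" if "x \<in> Obj C" for x
    using swap_nat[of a' b "swap C b' c x"] that by simp
  have "eact C ?p (Unt C) = eact C ?q (Unt C)"
    by (simp add: n)
  then have "eval C ?p = eval C ?q"
    by (intro coherence) simp_all
  then show ?thesis by simp
qed

lemma run_unit: "Run C (Unt C) = Lun C (Unt C)"
  using coherence[of "ERun One" "ELun One"] by simp

lemma run_unit_ass: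
  "Run C (Unt C) \<cdot> (Idn C (Unt C) \<boxtimes> Run C (Unt C)) =
    Run C (Unt C) \<cdot> (Run C (Unt C) \<boxtimes> Idn C (Unt C)) \<cdot> Ass C (Unt C) (Unt C) (Unt C)"
  using coherence[of "EComp (ERun One) (ELeft One (ERun One))"
      "EComp (ERun One) (EComp (ERight (ERun One) One) (EAss One One One))"] by simp

lemma run_unit_sym: "Run C (Unt C) \<cdot> Sym C (Unt C) (Unt C) = Run C (Unt C)"
  using Sym_unit[of "Unt C"] by (simp add: run_unit)

end

section \<open>Categories of symmetric monoidal functors\<close>

context cat_functor
begin

lemma omap_in [simp]: "a \<in> Obj A \<Longrightarrow> omap F a \<in> Obj B"
  by (rule omap_obj)

lemma amap_typing [simp]:
  assumes "f \<in> Arr A"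
  shows "amap F f \<in> Arr B" and "Dom B (amap F f) = omap F (Dom A f)"
    and "Cod B (amap F f) = omap F (Cod A f)"
  using amap_hom[of f "Dom A f" "Cod A f"] assms by (simp_all add: hom_iff)

lemma amap_idn [simp]: "a \<in> Obj A \<Longrightarrow> amap F (Idn A a) = Idn B (omap F a)"
  by (rule amap_Idn)

lemma amap_comp:
  "f \<in> Arr A \<Longrightarrow> g \<in> Arr A \<Longrightarrow> Cod A f = Dom A g \<Longrightarrow>
    amap F (g \<cdot>\<^bsub>A\<^esub> f) = amap F g \<cdot>\<^bsub>B\<^esub> amap F f"
  by (rule amap_Comp) (auto simp: hom_iff)

end

context sm_functor
begin

lemma phi0_typing [simp]:
  "phi0 F \<in> Arr B" "Dom B (phi0 F) = Unt B" "Cod B (phi0 F) = omap F (Unt A)"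
  using phi0_hom by (simp_all add: hom_iff)

lemma phi2_typing [simp]:
  assumes "x \<in> Obj A" and "y \<in> Obj A"
  shows "phi2 F x y \<in> Arr B" and "Dom B (phi2 F x y) = omap F x \<otimes>\<^bsub>B\<^esub> omap F y"
    and "Cod B (phi2 F x y) = omap F (x \<otimes>\<^bsub>A\<^esub> y)"
  using phi2_hom[OF assms] by (simp_all add: hom_iff)

lemma phi2_natural:
  "f \<in> Arr A \<Longrightarrow> g \<in> Arr A \<Longrightarrow>
    phi2 F (Cod A f) (Cod A g) \<cdot>\<^bsub>B\<^esub> (amap F f \<boxtimes>\<^bsub>B\<^esub> amap F g) =
    amap F (f \<boxtimes>\<^bsub>A\<^esub> g) \<cdot>\<^bsub>B\<^esub> phi2 F (Dom A f) (Dom A g)"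
  by (intro phi2_nat) (simp_all add: hom_iff)

end

lemmas sm_functor_typing =
  cat_functor.omap_in[OF sm_functor.axioms(1)] cat_functor.amap_typing[OF sm_functor.axioms(1)]
  sm_functor.phi0_typing sm_functor.phi2_typing

context monoidal_transformation
begin

lemma mcomp_typing [simp]:
  assumes "x \<in> Obj A"
  shows "mcomp \<sigma> x \<in> Arr B" and "Dom B (mcomp \<sigma> x) = omap (msrc \<sigma>) x"
    and "Cod B (mcomp \<sigma> x) = omap (mtgt \<sigma>) x"
  using mcomp_hom[OF assms] by (simp_all add: hom_iff)

lemma mcomp_natural:
  "f \<in> Arr A \<Longrightarrow> mcomp \<sigma> (Cod A f) \<cdot>\<^bsub>B\<^esub> amap (msrc \<sigma>) f = amap (mtgt \<sigma>) f \<cdot>\<^bsub>B\<^esub> mcomp \<sigma> (Dom A f)"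
  by (intro mcomp_nat) (simp add: hom_iff)

end

lemma SMC_simps [simp]:
  "Obj (SMC A B) = {F. sm_functor A B F}"
  "Arr (SMC A B) = {\<sigma>. monoidal_transformation A B \<sigma>}"
  "Dom (SMC A B) = msrc" "Cod (SMC A B) = mtgt"
  "Idn (SMC A B) = (\<lambda>F. \<lparr>msrc = F, mtgt = F, mcomp = (\<lambda>x \<in> Obj A. Idn B (omap F x))\<rparr>)"
  "Comp (SMC A B) = (\<lambda>\<tau> \<sigma>. \<lparr>msrc = msrc \<sigma>, mtgt = mtgt \<tau>,
       mcomp = (\<lambda>x \<in> Obj A. mcomp \<tau> x \<cdot>\<^bsub>B\<^esub> mcomp \<sigma> x)\<rparr>)"
  by (simp_all add: SMC_def)

lemma mnt_eqI:
  assumes "msrc \<sigma> = msrc \<tau>" and "mtgt \<sigma> = mtgt \<tau>"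
    and "mcomp \<sigma> \<in> extensional S" and "mcomp \<tau> \<in> extensional S"
    and "\<And>x. x \<in> S \<Longrightarrow> mcomp \<sigma> x = mcomp \<tau> x"
  shows "\<sigma> = (\<tau> :: ('a, 'f, 'b, 'g) mnt)"
  using assms by (auto intro!: mnt.equality extensionalityI[of _ S])

text \<open>The laws of a category of monoidal functors and transformations evaluate components at \<open>I\<close> and
  at \<open>x \<otimes> y\<close>, which must therefore be objects of the domain.  This holds for the tensor product
  by construction, before any equation between its arrows is considered.\<close>

locale tensor_closed =
  fixes A :: "('o1, 'm1) smc"
  assumes Unt_closed [simp]: "Unt A \<in> Obj A"
    and TenO_closed [simp]: "x \<in> Obj A \<Longrightarrow> y \<in> Obj A \<Longrightarrow> x \<otimes>\<^bsub>A\<^esub> y \<in> Obj A"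

sublocale smc \<subseteq> tensor_closed C
  by unfold_locales simp_all

lemma sm_functorI:
  assumes "category A" and "category B"
    and "\<And>x. x \<in> Obj A \<Longrightarrow> omap F x \<in> Obj B"
    and "\<And>f. f \<in> Arr A \<Longrightarrow> amap F f \<in> hom B (omap F (Dom A f)) (omap F (Cod A f))"
    and "\<And>x. x \<in> Obj A \<Longrightarrow> amap F (Idn A x) = Idn B (omap F x)"
    and "\<And>f g. f \<in> Arr A \<Longrightarrow> g \<in> Arr A \<Longrightarrow> Cod A f = Dom A g \<Longrightarrow>
      amap F (g \<cdot>\<^bsub>A\<^esub> f) = amap F g \<cdot>\<^bsub>B\<^esub> amap F f"
    and "omap F \<in> extensional (Obj A)" and "amap F \<in> extensional (Arr A)"
    and "phi0 F \<in> hom B (Unt B) (omap F (Unt A))"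
    and "\<And>x y. x \<in> Obj A \<Longrightarrow> y \<in> Obj A \<Longrightarrow>
      phi2 F x y \<in> hom B (omap F x \<otimes>\<^bsub>B\<^esub> omap F y) (omap F (x \<otimes>\<^bsub>A\<^esub> y))"
    and "\<And>f g. f \<in> Arr A \<Longrightarrow> g \<in> Arr A \<Longrightarrow>
      phi2 F (Cod A f) (Cod A g) \<cdot>\<^bsub>B\<^esub> (amap F f \<boxtimes>\<^bsub>B\<^esub> amap F g) =
      amap F (f \<boxtimes>\<^bsub>A\<^esub> g) \<cdot>\<^bsub>B\<^esub> phi2 F (Dom A f) (Dom A g)"
    and "\<And>x y z. x \<in> Obj A \<Longrightarrow> y \<in> Obj A \<Longrightarrow> z \<in> Obj A \<Longrightarrow>
      amap F (Ass A x y z) \<cdot>\<^bsub>B\<^esub> phi2 F x (y \<otimes>\<^bsub>A\<^esub> z) \<cdot>\<^bsub>B\<^esub>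
        (Idn B (omap F x) \<boxtimes>\<^bsub>B\<^esub> phi2 F y z) =
      phi2 F (x \<otimes>\<^bsub>A\<^esub> y) z \<cdot>\<^bsub>B\<^esub> (phi2 F x y \<boxtimes>\<^bsub>B\<^esub> Idn B (omap F z)) \<cdot>\<^bsub>B\<^esub>
        Ass B (omap F x) (omap F y) (omap F z)"
    and "\<And>x. x \<in> Obj A \<Longrightarrow>
      amap F (Run A x) \<cdot>\<^bsub>B\<^esub> phi2 F x (Unt A) \<cdot>\<^bsub>B\<^esub> (Idn B (omap F x) \<boxtimes>\<^bsub>B\<^esub> phi0 F) =
      Run B (omap F x)"
    and "\<And>x. x \<in> Obj A \<Longrightarrow>
      amap F (Lun A x) \<cdot>\<^bsub>B\<^esub> phi2 F (Unt A) x \<cdot>\<^bsub>B\<^esub> (phi0 F \<boxtimes>\<^bsub>B\<^esub> Idn B (omap F x)) =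
      Lun B (omap F x)"
    and "\<And>x y. x \<in> Obj A \<Longrightarrow> y \<in> Obj A \<Longrightarrow>
      amap F (Sym A x y) \<cdot>\<^bsub>B\<^esub> phi2 F x y = phi2 F y x \<cdot>\<^bsub>B\<^esub> Sym B (omap F x) (omap F y)"
    and "\<And>x y. x \<notin> Obj A \<or> y \<notin> Obj A \<Longrightarrow> phi2 F x y = undefined"
  shows "sm_functor A B F"
proof (intro sm_functor.intro cat_functor.intro sm_functor_axioms.intro cat_functor_axioms.intro assms)
  show "amap F f \<in> hom B (omap F x) (omap F y)" if "f \<in> hom A x y" for f x y
    using assms(4)[of f] that by (simp add: hom_iff)
  show "phi2 F x' y' \<cdot>\<^bsub>B\<^esub> (amap F f \<boxtimes>\<^bsub>B\<^esub> amap F g) = amap F (f \<boxtimes>\<^bsub>A\<^esub> g) \<cdot>\<^bsub>B\<^esub> phi2 F x y"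
    if "f \<in> hom A x x'" "g \<in> hom A y y'" for f g x x' y y'
    using assms(11)[of f g] that by (simp add: hom_iff)
qed (simp_all add: hom_iff)

lemma monoidal_transformationI:
  assumes "sm_functor A B (msrc \<sigma>)" and "sm_functor A B (mtgt \<sigma>)"
    and "\<And>x. x \<in> Obj A \<Longrightarrow> mcomp \<sigma> x \<in> hom B (omap (msrc \<sigma>) x) (omap (mtgt \<sigma>) x)"
    and "\<And>f. f \<in> Arr A \<Longrightarrow>
      mcomp \<sigma> (Cod A f) \<cdot>\<^bsub>B\<^esub> amap (msrc \<sigma>) f = amap (mtgt \<sigma>) f \<cdot>\<^bsub>B\<^esub> mcomp \<sigma> (Dom A f)"
    and "mcomp \<sigma> (Unt A) \<cdot>\<^bsub>B\<^esub> phi0 (msrc \<sigma>) = phi0 (mtgt \<sigma>)"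
    and "\<And>x y. x \<in> Obj A \<Longrightarrow> y \<in> Obj A \<Longrightarrow> mcomp \<sigma> (x \<otimes>\<^bsub>A\<^esub> y) \<cdot>\<^bsub>B\<^esub> phi2 (msrc \<sigma>) x y =
      phi2 (mtgt \<sigma>) x y \<cdot>\<^bsub>B\<^esub> (mcomp \<sigma> x \<boxtimes>\<^bsub>B\<^esub> mcomp \<sigma> y)"
    and "mcomp \<sigma> \<in> extensional (Obj A)"
  shows "monoidal_transformation A B \<sigma>"
proof (intro monoidal_transformation.intro monoidal_transformation_axioms.intro assms)
  fix f x y assume "f \<in> hom A x y"
  then show "mcomp \<sigma> y \<cdot>\<^bsub>B\<^esub> amap (msrc \<sigma>) f = amap (mtgt \<sigma>) f \<cdot>\<^bsub>B\<^esub> mcomp \<sigma> x"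
    using assms(4)[of f] by (simp add: hom_iff)
qed

lemma monoidal_transformation_Idn:
  assumes A: "tensor_closed A" and B: "tensor_category B" and F: "sm_functor A B F"
  shows "monoidal_transformation A B (Idn (SMC A B) F)"
proof -
  interpret A: tensor_closed A by (rule A)
  interpret B: tensor_category B by (rule B)
  interpret F: sm_functor A B F by (rule F)
  show ?thesis
    by (rule monoidal_transformationI) (simp_all add: hom_iff F)
qed

lemma monoidal_transformation_Comp:
  assumes A: "tensor_closed A" and B: "tensor_category B"
    and s: "monoidal_transformation A B \<sigma>" and t: "monoidal_transformation A B \<tau>"
    and st: "mtgt \<sigma> = msrc \<tau>"
  shows "monoidal_transformation A B (Comp (SMC A B) \<tau> \<sigma>)"
proof -
  interpret A: tensor_closed A by (rule A)
  interpret B: tensor_category B by (rule B)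
  interpret s: monoidal_transformation A B \<sigma> by (rule s)
  interpret t: monoidal_transformation A B \<tau> by (rule t)
  note [simp] = st
  show ?thesis
  proof (rule monoidal_transformationI)
    fix f assume [simp]: "f \<in> Arr A"
    have "(mcomp \<tau> (Cod A f) \<cdot>\<^bsub>B\<^esub> mcomp \<sigma> (Cod A f)) \<cdot>\<^bsub>B\<^esub> amap (msrc \<sigma>) f =
        amap (mtgt \<tau>) f \<cdot>\<^bsub>B\<^esub> (mcomp \<tau> (Dom A f) \<cdot>\<^bsub>B\<^esub> mcomp \<sigma> (Dom A f))"
      using s.mcomp_natural[of f] B.comp_extend[OF t.mcomp_natural[of f]] by simp
    then show "mcomp (Comp (SMC A B) \<tau> \<sigma>) (Cod A f) \<cdot>\<^bsub>B\<^esub> amap (msrc (Comp (SMC A B) \<tau> \<sigma>)) f =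
       amap (mtgt (Comp (SMC A B) \<tau> \<sigma>)) f \<cdot>\<^bsub>B\<^esub> mcomp (Comp (SMC A B) \<tau> \<sigma>) (Dom A f)"
      by simp
  next
    fix x y assume [simp]: "x \<in> Obj A" "y \<in> Obj A"
    have "mcomp \<tau> (x \<otimes>\<^bsub>A\<^esub> y) \<cdot>\<^bsub>B\<^esub> (phi2 (msrc \<tau>) x y \<cdot>\<^bsub>B\<^esub> (mcomp \<sigma> x \<boxtimes>\<^bsub>B\<^esub> mcomp \<sigma> y)) =
      phi2 (mtgt \<tau>) x y \<cdot>\<^bsub>B\<^esub> ((mcomp \<tau> x \<cdot>\<^bsub>B\<^esub> mcomp \<sigma> x) \<boxtimes>\<^bsub>B\<^esub> (mcomp \<tau> y \<cdot>\<^bsub>B\<^esub> mcomp \<sigma> y))"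
      by (simp add: B.comp_extend[OF t.mcomp_phi2])
    then show "mcomp (Comp (SMC A B) \<tau> \<sigma>) (x \<otimes>\<^bsub>A\<^esub> y) \<cdot>\<^bsub>B\<^esub> phi2 (msrc (Comp (SMC A B) \<tau> \<sigma>)) x y =
      phi2 (mtgt (Comp (SMC A B) \<tau> \<sigma>)) x y \<cdot>\<^bsub>B\<^esub>
        (mcomp (Comp (SMC A B) \<tau> \<sigma>) x \<boxtimes>\<^bsub>B\<^esub> mcomp (Comp (SMC A B) \<tau> \<sigma>) y)"
      using s.mcomp_phi2[of x y] by simp
  qed (use s.mcomp_phi0 t.mcomp_phi0 in
    \<open>simp_all add: hom_iff s.F.sm_functor_axioms t.G.sm_functor_axioms\<close>)
qed

lemma category_SMC:
  assumes A: "tensor_closed A" and B: "tensor_category B"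
  shows "category (SMC A B)"
proof -
  interpret A: tensor_closed A by (rule A)
  interpret B: tensor_category B by (rule B)
  show ?thesis
  proof
    fix \<sigma> assume "\<sigma> \<in> Arr (SMC A B)"
    then show "Dom (SMC A B) \<sigma> \<in> Obj (SMC A B)" "Cod (SMC A B) \<sigma> \<in> Obj (SMC A B)"
      by (auto simp: monoidal_transformation_def)
  next
    fix F assume "F \<in> Obj (SMC A B)"
    then show "Idn (SMC A B) F \<in> hom (SMC A B) F F"
      using monoidal_transformation_Idn[OF A B, of F] by (simp add: hom_iff)
  next
    fix \<sigma> \<tau> F G H assume "\<sigma> \<in> hom (SMC A B) F G" "\<tau> \<in> hom (SMC A B) G H"
    then show "Comp (SMC A B) \<tau> \<sigma> \<in> hom (SMC A B) F H"
      using monoidal_transformation_Comp[OF A B, of \<sigma> \<tau>] by (simp add: hom_iff)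
  next
    fix \<sigma> F G assume h: "\<sigma> \<in> hom (SMC A B) F G"
    then interpret s: monoidal_transformation A B \<sigma> by (simp add: hom_iff)
    from h have [simp]: "msrc \<sigma> = F" "mtgt \<sigma> = G" by (auto simp: hom_iff)
    show "Comp (SMC A B) \<sigma> (Idn (SMC A B) F) = \<sigma>" "Comp (SMC A B) (Idn (SMC A B) G) \<sigma> = \<sigma>"
      by (rule mnt_eqI[where S = "Obj A"]; simp add: s.mcomp_ext)+
  next
    fix \<sigma> \<tau> \<upsilon> F G H K
    assume h: "\<sigma> \<in> hom (SMC A B) F G" "\<tau> \<in> hom (SMC A B) G H" "\<upsilon> \<in> hom (SMC A B) H K"
    then interpret s: monoidal_transformation A B \<sigma> by (simp add: hom_iff)
    from h interpret t: monoidal_transformation A B \<tau> by (simp add: hom_iff)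
    from h interpret u: monoidal_transformation A B \<upsilon> by (simp add: hom_iff)
    from h have [simp]: "msrc \<sigma> = F" "mtgt \<sigma> = G" "msrc \<tau> = G" "mtgt \<tau> = H" "msrc \<upsilon> = H" "mtgt \<upsilon> = K"
      by (auto simp: hom_iff)
    show "Comp (SMC A B) (Comp (SMC A B) \<upsilon> \<tau>) \<sigma> = Comp (SMC A B) \<upsilon> (Comp (SMC A B) \<tau> \<sigma>)"
      by (rule mnt_eqI[where S = "Obj A"]) simp_all
  qed
qed

section \<open>The internal hom\<close>

lemma ihom_simps [simp]:
  "Obj (ihom A B) = Obj (SMC A B)" "Arr (ihom A B) = Arr (SMC A B)"
  "Dom (ihom A B) = Dom (SMC A B)" "Cod (ihom A B) = Cod (SMC A B)"
  "Idn (ihom A B) = Idn (SMC A B)" "Comp (ihom A B) = Comp (SMC A B)"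
  "TenO (ihom A B) = ihom_ten A B" "Unt (ihom A B) = ihom_unit A B"
  "TenA (ihom A B) = (\<lambda>\<sigma> \<tau>. \<lparr>msrc = ihom_ten A B (msrc \<sigma>) (msrc \<tau>),
     mtgt = ihom_ten A B (mtgt \<sigma>) (mtgt \<tau>),
     mcomp = (\<lambda>x \<in> Obj A. mcomp \<sigma> x \<boxtimes>\<^bsub>B\<^esub> mcomp \<tau> x)\<rparr>)"
  "Ass (ihom A B) = (\<lambda>F G H. \<lparr>msrc = ihom_ten A B F (ihom_ten A B G H),
     mtgt = ihom_ten A B (ihom_ten A B F G) H,
     mcomp = (\<lambda>x \<in> Obj A. Ass B (omap F x) (omap G x) (omap H x))\<rparr>)"
  "Run (ihom A B) = (\<lambda>F. \<lparr>msrc = ihom_ten A B F (ihom_unit A B), mtgt = F,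
     mcomp = (\<lambda>x \<in> Obj A. Run B (omap F x))\<rparr>)"
  "Lun (ihom A B) = (\<lambda>F. \<lparr>msrc = ihom_ten A B (ihom_unit A B) F, mtgt = F,
     mcomp = (\<lambda>x \<in> Obj A. Lun B (omap F x))\<rparr>)"
  "Sym (ihom A B) = (\<lambda>F G. \<lparr>msrc = ihom_ten A B F G, mtgt = ihom_ten A B G F,
     mcomp = (\<lambda>x \<in> Obj A. Sym B (omap F x) (omap G x))\<rparr>)"
  by (simp_all add: ihom_def SMC_def cat.extend_def smc.fields_def del: SMC_simps)

text \<open>Equations between arrows of the internal hom are compared one component at a time.\<close>

lemma mcomp_ihom:
  assumes "b \<in> Obj B"
  shows "mcomp (\<tau> \<cdot>\<^bsub>ihom B C\<^esub> \<sigma>) b = mcomp \<tau> b \<cdot>\<^bsub>C\<^esub> mcomp \<sigma> b"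
    and "mcomp (\<sigma> \<boxtimes>\<^bsub>ihom B C\<^esub> \<tau>) b = mcomp \<sigma> b \<boxtimes>\<^bsub>C\<^esub> mcomp \<tau> b"
    and "mcomp (Idn (ihom B C) G) b = Idn C (omap G b)"
    and "mcomp (Ass (ihom B C) G H K) b = Ass C (omap G b) (omap H b) (omap K b)"
    and "mcomp (Run (ihom B C) G) b = Run C (omap G b)"
    and "mcomp (Lun (ihom B C) G) b = Lun C (omap G b)"
    and "mcomp (Sym (ihom B C) G H) b = Sym C (omap G b) (omap H b)"
  using assms by simp_all

lemma category_ihom:
  assumes A: "tensor_closed A" and B: "tensor_category B"
  shows "category (ihom A B)"
  using category_SMC[OF assms] unfolding category_def hom_def ihom_simps .

context
  fixes A :: "('a, 'f) smc" and B :: "('b, 'g) smc"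
  assumes A: "smc A" and B: "smc B"
begin

interpretation A: smc A by (rule A)
interpretation B: smc B by (rule B)

lemma sm_functor_ihom_unit: "sm_functor A B (ihom_unit A B)"
proof (rule sm_functorI)
  show "category A" "category B" ..
qed (auto simp: ihom_unit_def hom_iff B.run_unit_ass B.run_unit_sym simp flip: B.run_unit)

text \<open>The axioms for the pointwise tensor product of \<open>F\<close> and \<open>G\<close> are those for \<open>F\<close> and \<open>G\<close> tensored
  together, once the interchanges have been moved past the structure arrows by naturality; the
  interchanges left over match because they are compatible with the associativity, unit and symmetry
  arrows.\<close>

lemma sm_functor_ihom_ten:
  assumes F: "sm_functor A B F" and G: "sm_functor A B G"
  shows "sm_functor A B (ihom_ten A B F G)"
proof (rule sm_functorI)
  interpret F: sm_functor A B F by (rule F)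
  interpret G: sm_functor A B G by (rule G)
  let ?H = "ihom_ten A B F G"
  show "category A" "category B" ..
  show "phi0 ?H \<in> hom B (Unt B) (omap ?H (Unt A))"
    by (simp add: ihom_ten_def hom_iff)
  fix f assume [simp]: "f \<in> Arr A"
  show "amap ?H f \<in> hom B (omap ?H (Dom A f)) (omap ?H (Cod A f))"
    by (simp add: ihom_ten_def hom_iff)
  fix g assume [simp]: "g \<in> Arr A"
  show "amap ?H (g \<cdot>\<^bsub>A\<^esub> f) = amap ?H g \<cdot>\<^bsub>B\<^esub> amap ?H f" if "Cod A f = Dom A g"
    using that by (simp add: ihom_ten_def F.amap_comp G.amap_comp)
  show "phi2 ?H (Cod A f) (Cod A g) \<cdot>\<^bsub>B\<^esub> (amap ?H f \<boxtimes>\<^bsub>B\<^esub> amap ?H g) =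
      amap ?H (f \<boxtimes>\<^bsub>A\<^esub> g) \<cdot>\<^bsub>B\<^esub> phi2 ?H (Dom A f) (Dom A g)"
    using B.interchange_nat[of "amap F f" "amap G f" "amap F g" "amap G g"]
    by (simp add: ihom_ten_def F.phi2_natural G.phi2_natural)
next
  interpret F: sm_functor A B F by (rule F)
  interpret G: sm_functor A B G by (rule G)
  let ?H = "ihom_ten A B F G"
  fix x assume [simp]: "x \<in> Obj A"
  show "omap ?H x \<in> Obj B" and "amap ?H (Idn A x) = Idn B (omap ?H x)"
    by (simp_all add: ihom_ten_def)
  let ?r = "inv_arr B (Run B (Unt B))"
  have "amap ?H (Run A x) \<cdot>\<^bsub>B\<^esub> phi2 ?H x (Unt A) \<cdot>\<^bsub>B\<^esub> (Idn B (omap ?H x) \<boxtimes>\<^bsub>B\<^esub> phi0 ?H) =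
      ((amap F (Run A x) \<cdot>\<^bsub>B\<^esub> phi2 F x (Unt A)) \<boxtimes>\<^bsub>B\<^esub> (amap G (Run A x) \<cdot>\<^bsub>B\<^esub> phi2 G x (Unt A))) \<cdot>\<^bsub>B\<^esub>
      interchange B (omap F x) (omap G x) (omap F (Unt A)) (omap G (Unt A)) \<cdot>\<^bsub>B\<^esub>
      ((Idn B (omap F x) \<boxtimes>\<^bsub>B\<^esub> Idn B (omap G x)) \<boxtimes>\<^bsub>B\<^esub> (phi0 F \<boxtimes>\<^bsub>B\<^esub> phi0 G)) \<cdot>\<^bsub>B\<^esub>
      (Idn B (omap F x \<otimes>\<^bsub>B\<^esub> omap G x) \<boxtimes>\<^bsub>B\<^esub> ?r)"
    by (simp add: ihom_ten_def)
  also have "\<dots> = ((amap F (Run A x) \<cdot>\<^bsub>B\<^esub> phi2 F x (Unt A) \<cdot>\<^bsub>B\<^esub> (Idn B (omap F x) \<boxtimes>\<^bsub>B\<^esub> phi0 F)) \<boxtimes>\<^bsub>B\<^esub>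
      (amap G (Run A x) \<cdot>\<^bsub>B\<^esub> phi2 G x (Unt A) \<cdot>\<^bsub>B\<^esub> (Idn B (omap G x) \<boxtimes>\<^bsub>B\<^esub> phi0 G))) \<cdot>\<^bsub>B\<^esub>
      interchange B (omap F x) (omap G x) (Unt B) (Unt B) \<cdot>\<^bsub>B\<^esub>
      (Idn B (omap F x \<otimes>\<^bsub>B\<^esub> omap G x) \<boxtimes>\<^bsub>B\<^esub> ?r)"
    using B.comp_extend[OF B.interchange_nat[of "Idn B (omap F x)" "Idn B (omap G x)" "phi0 F" "phi0 G"],
      of "Idn B (omap F x \<otimes>\<^bsub>B\<^esub> omap G x) \<boxtimes>\<^bsub>B\<^esub> ?r"]
    by simp
  also have "\<dots> = Run B (omap ?H x)"
    by (simp add: F.phi2_Run G.phi2_Run B.interchange_run ihom_ten_def del: B.ten_comp B.ten_comp')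
  finally show "amap ?H (Run A x) \<cdot>\<^bsub>B\<^esub> phi2 ?H x (Unt A) \<cdot>\<^bsub>B\<^esub>
    (Idn B (omap ?H x) \<boxtimes>\<^bsub>B\<^esub> phi0 ?H) = Run B (omap ?H x)" .
  have "amap ?H (Lun A x) \<cdot>\<^bsub>B\<^esub> phi2 ?H (Unt A) x \<cdot>\<^bsub>B\<^esub> (phi0 ?H \<boxtimes>\<^bsub>B\<^esub> Idn B (omap ?H x)) =
      ((amap F (Lun A x) \<cdot>\<^bsub>B\<^esub> phi2 F (Unt A) x) \<boxtimes>\<^bsub>B\<^esub> (amap G (Lun A x) \<cdot>\<^bsub>B\<^esub> phi2 G (Unt A) x)) \<cdot>\<^bsub>B\<^esub>
      interchange B (omap F (Unt A)) (omap G (Unt A)) (omap F x) (omap G x) \<cdot>\<^bsub>B\<^esub>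
      ((phi0 F \<boxtimes>\<^bsub>B\<^esub> phi0 G) \<boxtimes>\<^bsub>B\<^esub> (Idn B (omap F x) \<boxtimes>\<^bsub>B\<^esub> Idn B (omap G x))) \<cdot>\<^bsub>B\<^esub>
      (?r \<boxtimes>\<^bsub>B\<^esub> Idn B (omap F x \<otimes>\<^bsub>B\<^esub> omap G x))"
    by (simp add: ihom_ten_def)
  also have "\<dots> = ((amap F (Lun A x) \<cdot>\<^bsub>B\<^esub> phi2 F (Unt A) x \<cdot>\<^bsub>B\<^esub> (phi0 F \<boxtimes>\<^bsub>B\<^esub> Idn B (omap F x))) \<boxtimes>\<^bsub>B\<^esub>
      (amap G (Lun A x) \<cdot>\<^bsub>B\<^esub> phi2 G (Unt A) x \<cdot>\<^bsub>B\<^esub> (phi0 G \<boxtimes>\<^bsub>B\<^esub> Idn B (omap G x)))) \<cdot>\<^bsub>B\<^esub>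
      interchange B (Unt B) (Unt B) (omap F x) (omap G x) \<cdot>\<^bsub>B\<^esub>
      (?r \<boxtimes>\<^bsub>B\<^esub> Idn B (omap F x \<otimes>\<^bsub>B\<^esub> omap G x))"
    using B.comp_extend[OF B.interchange_nat[of "phi0 F" "phi0 G" "Idn B (omap F x)" "Idn B (omap G x)"],
      of "?r \<boxtimes>\<^bsub>B\<^esub> Idn B (omap F x \<otimes>\<^bsub>B\<^esub> omap G x)"]
    by simp
  also have "\<dots> = Lun B (omap ?H x)"
    by (simp add: F.phi2_Lun G.phi2_Lun B.interchange_lun ihom_ten_def del: B.ten_comp B.ten_comp')
  finally show "amap ?H (Lun A x) \<cdot>\<^bsub>B\<^esub> phi2 ?H (Unt A) x \<cdot>\<^bsub>B\<^esub>
    (phi0 ?H \<boxtimes>\<^bsub>B\<^esub> Idn B (omap ?H x)) = Lun B (omap ?H x)" .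
  fix y assume [simp]: "y \<in> Obj A"
  show "phi2 ?H x y \<in> hom B (omap ?H x \<otimes>\<^bsub>B\<^esub> omap ?H y) (omap ?H (x \<otimes>\<^bsub>A\<^esub> y))"
    by (simp add: ihom_ten_def hom_iff)
  have "amap ?H (Sym A x y) \<cdot>\<^bsub>B\<^esub> phi2 ?H x y =
      (phi2 F y x \<boxtimes>\<^bsub>B\<^esub> phi2 G y x) \<cdot>\<^bsub>B\<^esub>
      ((Sym B (omap F x) (omap F y) \<boxtimes>\<^bsub>B\<^esub> Sym B (omap G x) (omap G y)) \<cdot>\<^bsub>B\<^esub>
      interchange B (omap F x) (omap G x) (omap F y) (omap G y))"
    by (simp add: ihom_ten_def F.phi2_Sym G.phi2_Sym)
  also have "\<dots> = phi2 ?H y x \<cdot>\<^bsub>B\<^esub> Sym B (omap ?H x) (omap ?H y)"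
    by (subst B.interchange_sym[symmetric]) (simp_all add: ihom_ten_def)
  finally show "amap ?H (Sym A x y) \<cdot>\<^bsub>B\<^esub> phi2 ?H x y =
    phi2 ?H y x \<cdot>\<^bsub>B\<^esub> Sym B (omap ?H x) (omap ?H y)" .
  fix z assume [simp]: "z \<in> Obj A"
  let ?i = "\<lambda>x y. interchange B (omap F x) (omap G x) (omap F y) (omap G y)"
  have "amap ?H (Ass A x y z) \<cdot>\<^bsub>B\<^esub> phi2 ?H x (y \<otimes>\<^bsub>A\<^esub> z) \<cdot>\<^bsub>B\<^esub> (Idn B (omap ?H x) \<boxtimes>\<^bsub>B\<^esub> phi2 ?H y z) =
      ((amap F (Ass A x y z) \<cdot>\<^bsub>B\<^esub> phi2 F x (y \<otimes>\<^bsub>A\<^esub> z)) \<boxtimes>\<^bsub>B\<^esub>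
       (amap G (Ass A x y z) \<cdot>\<^bsub>B\<^esub> phi2 G x (y \<otimes>\<^bsub>A\<^esub> z))) \<cdot>\<^bsub>B\<^esub> ?i x (y \<otimes>\<^bsub>A\<^esub> z) \<cdot>\<^bsub>B\<^esub>
      ((Idn B (omap F x) \<boxtimes>\<^bsub>B\<^esub> Idn B (omap G x)) \<boxtimes>\<^bsub>B\<^esub> (phi2 F y z \<boxtimes>\<^bsub>B\<^esub> phi2 G y z)) \<cdot>\<^bsub>B\<^esub>
      (Idn B (omap F x \<otimes>\<^bsub>B\<^esub> omap G x) \<boxtimes>\<^bsub>B\<^esub> ?i y z)"
    by (simp add: ihom_ten_def)
  also have "\<dots> = ((amap F (Ass A x y z) \<cdot>\<^bsub>B\<^esub> phi2 F x (y \<otimes>\<^bsub>A\<^esub> z) \<cdot>\<^bsub>B\<^esub>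
        (Idn B (omap F x) \<boxtimes>\<^bsub>B\<^esub> phi2 F y z)) \<boxtimes>\<^bsub>B\<^esub>
       (amap G (Ass A x y z) \<cdot>\<^bsub>B\<^esub> phi2 G x (y \<otimes>\<^bsub>A\<^esub> z) \<cdot>\<^bsub>B\<^esub>
        (Idn B (omap G x) \<boxtimes>\<^bsub>B\<^esub> phi2 G y z))) \<cdot>\<^bsub>B\<^esub>
      interchange B (omap F x) (omap G x) (omap F y \<otimes>\<^bsub>B\<^esub> omap F z) (omap G y \<otimes>\<^bsub>B\<^esub> omap G z) \<cdot>\<^bsub>B\<^esub>
      (Idn B (omap F x \<otimes>\<^bsub>B\<^esub> omap G x) \<boxtimes>\<^bsub>B\<^esub> ?i y z)"
    using B.comp_extend[OF B.interchange_nat[of "Idn B (omap F x)" "Idn B (omap G x)" "phi2 F y z" "phi2 G y z"],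
      of "Idn B (omap F x \<otimes>\<^bsub>B\<^esub> omap G x) \<boxtimes>\<^bsub>B\<^esub> ?i y z"]
    by simp
  also have "\<dots> = ((phi2 F (x \<otimes>\<^bsub>A\<^esub> y) z \<cdot>\<^bsub>B\<^esub> (phi2 F x y \<boxtimes>\<^bsub>B\<^esub> Idn B (omap F z))) \<boxtimes>\<^bsub>B\<^esub>
      (phi2 G (x \<otimes>\<^bsub>A\<^esub> y) z \<cdot>\<^bsub>B\<^esub> (phi2 G x y \<boxtimes>\<^bsub>B\<^esub> Idn B (omap G z)))) \<cdot>\<^bsub>B\<^esub>
      ((Ass B (omap F x) (omap F y) (omap F z) \<boxtimes>\<^bsub>B\<^esub> Ass B (omap G x) (omap G y) (omap G z)) \<cdot>\<^bsub>B\<^esub>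
      interchange B (omap F x) (omap G x) (omap F y \<otimes>\<^bsub>B\<^esub> omap F z) (omap G y \<otimes>\<^bsub>B\<^esub> omap G z) \<cdot>\<^bsub>B\<^esub>
      (Idn B (omap F x \<otimes>\<^bsub>B\<^esub> omap G x) \<boxtimes>\<^bsub>B\<^esub> ?i y z))"
    by (simp add: F.phi2_Ass G.phi2_Ass)
  also have "\<dots> = (phi2 F (x \<otimes>\<^bsub>A\<^esub> y) z \<boxtimes>\<^bsub>B\<^esub> phi2 G (x \<otimes>\<^bsub>A\<^esub> y) z) \<cdot>\<^bsub>B\<^esub>
      (((phi2 F x y \<boxtimes>\<^bsub>B\<^esub> Idn B (omap F z)) \<boxtimes>\<^bsub>B\<^esub> (phi2 G x y \<boxtimes>\<^bsub>B\<^esub> Idn B (omap G z))) \<cdot>\<^bsub>B\<^esub>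
      interchange B (omap F x \<otimes>\<^bsub>B\<^esub> omap F y) (omap G x \<otimes>\<^bsub>B\<^esub> omap G y) (omap F z) (omap G z)) \<cdot>\<^bsub>B\<^esub>
      (?i x y \<boxtimes>\<^bsub>B\<^esub> Idn B (omap F z \<otimes>\<^bsub>B\<^esub> omap G z)) \<cdot>\<^bsub>B\<^esub>
      Ass B (omap F x \<otimes>\<^bsub>B\<^esub> omap G x) (omap F y \<otimes>\<^bsub>B\<^esub> omap G y) (omap F z \<otimes>\<^bsub>B\<^esub> omap G z)"
    by (subst B.interchange_ass) simp_all
  also have "((phi2 F x y \<boxtimes>\<^bsub>B\<^esub> Idn B (omap F z)) \<boxtimes>\<^bsub>B\<^esub> (phi2 G x y \<boxtimes>\<^bsub>B\<^esub> Idn B (omap G z))) \<cdot>\<^bsub>B\<^esub>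
      interchange B (omap F x \<otimes>\<^bsub>B\<^esub> omap F y) (omap G x \<otimes>\<^bsub>B\<^esub> omap G y) (omap F z) (omap G z) =
      ?i (x \<otimes>\<^bsub>A\<^esub> y) z \<cdot>\<^bsub>B\<^esub>
      ((phi2 F x y \<boxtimes>\<^bsub>B\<^esub> phi2 G x y) \<boxtimes>\<^bsub>B\<^esub> (Idn B (omap F z) \<boxtimes>\<^bsub>B\<^esub> Idn B (omap G z)))"
    using B.interchange_nat[of "phi2 F x y" "phi2 G x y" "Idn B (omap F z)" "Idn B (omap G z)"] by simp
  finally show "amap ?H (Ass A x y z) \<cdot>\<^bsub>B\<^esub> phi2 ?H x (y \<otimes>\<^bsub>A\<^esub> z) \<cdot>\<^bsub>B\<^esub>
        (Idn B (omap ?H x) \<boxtimes>\<^bsub>B\<^esub> phi2 ?H y z) =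
      phi2 ?H (x \<otimes>\<^bsub>A\<^esub> y) z \<cdot>\<^bsub>B\<^esub> (phi2 ?H x y \<boxtimes>\<^bsub>B\<^esub> Idn B (omap ?H z)) \<cdot>\<^bsub>B\<^esub>
        Ass B (omap ?H x) (omap ?H y) (omap ?H z)"
    by (simp add: ihom_ten_def)
qed (auto simp: ihom_ten_def)

text \<open>Compatibility with \<^const>\<open>phi2\<close> is the naturality of the interchange.\<close>

lemma monoidal_transformation_ihom_ten:
  assumes s: "monoidal_transformation A B \<sigma>" and t: "monoidal_transformation A B \<tau>"
  shows "monoidal_transformation A B (\<sigma> \<boxtimes>\<^bsub>ihom A B\<^esub> \<tau>)"
proof -
  interpret s: monoidal_transformation A B \<sigma> by (rule s)
  interpret t: monoidal_transformation A B \<tau> by (rule t)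
  show ?thesis
  proof (rule monoidal_transformationI)
    fix x y assume [simp]: "x \<in> Obj A" "y \<in> Obj A"
    show "mcomp (\<sigma> \<boxtimes>\<^bsub>ihom A B\<^esub> \<tau>) (x \<otimes>\<^bsub>A\<^esub> y) \<cdot>\<^bsub>B\<^esub> phi2 (msrc (\<sigma> \<boxtimes>\<^bsub>ihom A B\<^esub> \<tau>)) x y =
      phi2 (mtgt (\<sigma> \<boxtimes>\<^bsub>ihom A B\<^esub> \<tau>)) x y \<cdot>\<^bsub>B\<^esub>
        (mcomp (\<sigma> \<boxtimes>\<^bsub>ihom A B\<^esub> \<tau>) x \<boxtimes>\<^bsub>B\<^esub> mcomp (\<sigma> \<boxtimes>\<^bsub>ihom A B\<^esub> \<tau>) y)"
      using B.interchange_nat[of "mcomp \<sigma> x" "mcomp \<tau> x" "mcomp \<sigma> y" "mcomp \<tau> y"]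
        s.mcomp_phi2[of x y] t.mcomp_phi2[of x y]
      by (simp add: ihom_ten_def)
  next
    show "mcomp (\<sigma> \<boxtimes>\<^bsub>ihom A B\<^esub> \<tau>) (Unt A) \<cdot>\<^bsub>B\<^esub> phi0 (msrc (\<sigma> \<boxtimes>\<^bsub>ihom A B\<^esub> \<tau>)) =
      phi0 (mtgt (\<sigma> \<boxtimes>\<^bsub>ihom A B\<^esub> \<tau>))"
      using s.mcomp_phi0 t.mcomp_phi0 by (simp add: ihom_ten_def)
  next
    fix f assume [simp]: "f \<in> Arr A"
    show "mcomp (\<sigma> \<boxtimes>\<^bsub>ihom A B\<^esub> \<tau>) (Cod A f) \<cdot>\<^bsub>B\<^esub> amap (msrc (\<sigma> \<boxtimes>\<^bsub>ihom A B\<^esub> \<tau>)) f =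
      amap (mtgt (\<sigma> \<boxtimes>\<^bsub>ihom A B\<^esub> \<tau>)) f \<cdot>\<^bsub>B\<^esub> mcomp (\<sigma> \<boxtimes>\<^bsub>ihom A B\<^esub> \<tau>) (Dom A f)"
      using s.mcomp_natural[of f] t.mcomp_natural[of f] by (simp add: ihom_ten_def)
  qed (use s.F.sm_functor_axioms s.G.sm_functor_axioms t.F.sm_functor_axioms t.G.sm_functor_axioms in
    \<open>auto simp: ihom_ten_def hom_iff intro!: sm_functor_ihom_ten[unfolded ihom_ten_def]\<close>)
qed

lemma tensor_category_ihom: "tensor_category (ihom A B)"
proof -
  have c: "category (ihom A B)"
    by (rule category_ihom) unfold_locales
  interpret H: category "ihom A B" by (rule c)
  show ?thesis
  proof
    fix \<sigma> \<tau> F F' G G' assume h: "\<sigma> \<in> hom (ihom A B) F F'" "\<tau> \<in> hom (ihom A B) G G'"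
    then show "\<sigma> \<boxtimes>\<^bsub>ihom A B\<^esub> \<tau> \<in> hom (ihom A B) (F \<otimes>\<^bsub>ihom A B\<^esub> G) (F' \<otimes>\<^bsub>ihom A B\<^esub> G')"
      using monoidal_transformation_ihom_ten[of \<sigma> \<tau>] by (simp add: hom_iff)
  next
    fix F G assume "F \<in> Obj (ihom A B)" "G \<in> Obj (ihom A B)"
    then interpret F: sm_functor A B F + G: sm_functor A B G by simp_all
    show "Idn (ihom A B) F \<boxtimes>\<^bsub>ihom A B\<^esub> Idn (ihom A B) G = Idn (ihom A B) (F \<otimes>\<^bsub>ihom A B\<^esub> G)"
      by (intro mnt_eqI[where S = "Obj A"]; simp) (simp add: ihom_ten_def)
  next
    fix \<sigma> \<sigma>' \<tau> \<tau>' F F' F'' G G' G''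
    assume h: "\<sigma> \<in> hom (ihom A B) F F'" "\<sigma>' \<in> hom (ihom A B) F' F''"
      "\<tau> \<in> hom (ihom A B) G G'" "\<tau>' \<in> hom (ihom A B) G' G''"
    then interpret s: monoidal_transformation A B \<sigma> by (simp add: hom_iff)
    from h interpret s': monoidal_transformation A B \<sigma>' by (simp add: hom_iff)
    from h interpret t: monoidal_transformation A B \<tau> by (simp add: hom_iff)
    from h interpret t': monoidal_transformation A B \<tau>' by (simp add: hom_iff)
    from h have [simp]: "msrc \<sigma> = F" "mtgt \<sigma> = F'" "msrc \<tau> = G" "mtgt \<tau> = G'"
      "msrc \<sigma>' = F'" "mtgt \<sigma>' = F''" "msrc \<tau>' = G'" "mtgt \<tau>' = G''"
      by (auto simp: hom_iff)
    show "(\<sigma>' \<cdot>\<^bsub>ihom A B\<^esub> \<sigma>) \<boxtimes>\<^bsub>ihom A B\<^esub> (\<tau>' \<cdot>\<^bsub>ihom A B\<^esub> \<tau>) =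
        (\<sigma>' \<boxtimes>\<^bsub>ihom A B\<^esub> \<tau>') \<cdot>\<^bsub>ihom A B\<^esub> (\<sigma> \<boxtimes>\<^bsub>ihom A B\<^esub> \<tau>)"
      by (rule mnt_eqI[where S = "Obj A"]) simp_all
  qed
qed

end

section \<open>The tensor product as a category\<close>

locale smc_pair = A: smc A + B: smc B
  for A :: "('a, 'f) smc" and B :: "('b, 'g) smc"
begin

lemma word_ok_typing [simp]:
  assumes "formal_ok A B p"
  shows "word_ok A B (fdom A B p)" and "word_ok A B (fcod A B p)"
proof -
  have "word_ok A B (fdom A B p) \<and> word_ok A B (fcod A B p)"
    using assms by (induction p) auto
  then show "word_ok A B (fdom A B p)" and "word_ok A B (fcod A B p)" by simp_all
qed

lemma ften_typing [simp]:
  "fdom A B (ften A B p q) = fdom A B p \<odot> fdom A B q"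
  "fcod A B (ften A B p q) = fcod A B p \<odot> fcod A B q"
  "formal_ok A B (ften A B p q) \<longleftrightarrow> formal_ok A B p \<and> formal_ok A B q"
  by (auto simp: ften_def)

text \<open>Relations are imposed between well-formed arrows only, and these constraints are enough to make
  the two sides parallel; so \<^const>\<open>fdom\<close>, \<^const>\<open>fcod\<close> descend to classes.\<close>

lemma frel_typing:
  "frel A B p q \<Longrightarrow> formal_ok A B p \<Longrightarrow> formal_ok A B q \<Longrightarrow>
    fdom A B p = fdom A B q \<and> fcod A B p = fcod A B q"
  by (induction rule: frel.induct) (auto simp: finterchange_def hom_iff)

lemma fcong_typing:
  "fcong A B p q \<Longrightarrow>
    formal_ok A B p \<and> formal_ok A B q \<and> fdom A B p = fdom A B q \<and> fcod A B p = fcod A B q"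
  by (induction rule: fcong.induct) (use frel_typing in auto)

lemma fcong_ften:
  assumes p: "fcong A B p p'" and q: "fcong A B q q'"
  shows "fcong A B (ften A B p q) (ften A B p' q')"
  using fcong_typing[OF p] fcong_typing[OF q] p q
  by (auto simp: ften_def intro!: fcong.comp fcong.left fcong.right)

lemma fclass_eq: "formal_ok A B p \<Longrightarrow> fclass A B p = fclass A B q \<longleftrightarrow> fcong A B p q"
  unfolding fclass_def by (blast intro: fcong.refl fcong.sym fcong.trans)

lemma fcong_rep: "formal_ok A B p \<Longrightarrow> fcong A B p (rep (fclass A B p))"
  unfolding rep_def fclass_def by (rule someI2[of _ p]) (auto intro: fcong.refl)

lemma tensor_simps [simp]:
  "Obj (tensor A B) = {X. word_ok A B X}"
  "Idn (tensor A B) = (\<lambda>X. fclass A B (FId X))"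
  "TenO (tensor A B) = WTen" "Unt (tensor A B) = WUnit"
  "Ass (tensor A B) = (\<lambda>X Y Z. fclass A B (FAss X Y Z))"
  "Run (tensor A B) = (\<lambda>X. fclass A B (FRun X))"
  "Lun (tensor A B) = (\<lambda>X. fclass A B (FLun X))"
  "Sym (tensor A B) = (\<lambda>X Y. fclass A B (FSym X Y))"
  by (simp_all add: tensor_def)

lemma fclass_typing [simp]:
  assumes "formal_ok A B p"
  shows "fclass A B p \<in> Arr (tensor A B)" and "Dom (tensor A B) (fclass A B p) = fdom A B p"
    and "Cod (tensor A B) (fclass A B p) = fcod A B p"
  using assms fcong_typing[OF fcong_rep[OF assms]] by (auto simp: tensor_def)

lemma tensor_arrE:
  assumes "c \<in> Arr (tensor A B)"
  obtains p where "formal_ok A B p" and "c = fclass A B p"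
  using assms by (auto simp: tensor_def)

text \<open>The operations of the tensor product are defined on chosen representatives.  As all of them
  respect the congruence, they can be computed on arbitrary representatives instead.\<close>

lemma comp_fclass [simp]:
  assumes "formal_ok A B p" and "formal_ok A B q" and "fcod A B p = fdom A B q"
  shows "fclass A B q \<cdot>\<^bsub>tensor A B\<^esub> fclass A B p = fclass A B (q \<bullet> p)"
proof -
  have "fcong A B (q \<bullet> p) (rep (fclass A B q) \<bullet> rep (fclass A B p))"
    using assms by (intro fcong.comp fcong_rep)
  then show ?thesis
    using assms by (simp add: tensor_def fclass_eq flip: fclass_eq)
qed

lemma ten_fclass [simp]:
  assumes "formal_ok A B p" and "formal_ok A B q"
  shows "fclass A B p \<boxtimes>\<^bsub>tensor A B\<^esub> fclass A B q = fclass A B (ften A B p q)"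
proof -
  have "fcong A B (ften A B p q) (ften A B (rep (fclass A B p)) (rep (fclass A B q)))"
    using assms by (intro fcong_ften fcong_rep)
  then show ?thesis
    using assms by (simp add: tensor_def flip: fclass_eq)
qed

lemma fclass_eqI:
  "frel A B p q \<Longrightarrow> formal_ok A B p \<Longrightarrow> formal_ok A B q \<Longrightarrow> fclass A B p = fclass A B q"
  by (simp add: fclass_eq fcong.base)

lemma category_tensor: "category (tensor A B)"
proof
  fix c assume "c \<in> Arr (tensor A B)"
  then show "Dom (tensor A B) c \<in> Obj (tensor A B)" "Cod (tensor A B) c \<in> Obj (tensor A B)"
    by (auto elim!: tensor_arrE)
next
  fix X assume "X \<in> Obj (tensor A B)"
  then show "Idn (tensor A B) X \<in> hom (tensor A B) X X" by (simp add: hom_iff)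
next
  fix c d X Y Z assume "c \<in> hom (tensor A B) X Y" "d \<in> hom (tensor A B) Y Z"
  then show "d \<cdot>\<^bsub>tensor A B\<^esub> c \<in> hom (tensor A B) X Z"
    by (auto simp: hom_iff elim!: tensor_arrE)
next
  fix c X Y assume h: "c \<in> hom (tensor A B) X Y"
  then obtain p where p: "formal_ok A B p" "c = fclass A B p" by (auto simp: hom_iff elim: tensor_arrE)
  with h have "X = fdom A B p" "Y = fcod A B p" by (auto simp: hom_iff)
  with p show "c \<cdot>\<^bsub>tensor A B\<^esub> Idn (tensor A B) X = c" "Idn (tensor A B) Y \<cdot>\<^bsub>tensor A B\<^esub> c = c"
    by (simp_all add: hom_iff fclass_eqI frel.comp_id frel.id_comp)
next
  fix c d e W X Y Z
  assume h: "c \<in> hom (tensor A B) W X" "d \<in> hom (tensor A B) X Y" "e \<in> hom (tensor A B) Y Z"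
  then obtain p q r where "formal_ok A B p" "c = fclass A B p" "formal_ok A B q" "d = fclass A B q"
      "formal_ok A B r" "e = fclass A B r"
    by (auto simp: hom_iff elim!: tensor_arrE)
  with h show "(e \<cdot>\<^bsub>tensor A B\<^esub> d) \<cdot>\<^bsub>tensor A B\<^esub> c = e \<cdot>\<^bsub>tensor A B\<^esub> (d \<cdot>\<^bsub>tensor A B\<^esub> c)"
    by (simp add: hom_iff fclass_eqI frel.comp_assoc)
qed

sublocale T: category "tensor A B"
  by (rule category_tensor)

sublocale T: tensor_closed "tensor A B"
  by unfold_locales simp_all

end

section \<open>Evaluating formal arrows\<close>

text \<open>A symmetric monoidal functor \<open>A \<rightarrow> [B, C]\<close> is a bilinear map in the sense that its values and its
  structure arrows are themselves functors and transformations in the second variable.\<close>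

locale bilinear = smc_pair A B + C: smc C + F: sm_functor A "ihom B C" F
  for A :: "('a, 'f) smc" and B :: "('b, 'g) smc" and C :: "('c, 'h) smc"
    and F :: "('a, 'f, ('b, 'g, 'c, 'h) smf, ('b, 'g, 'c, 'h) mnt) smf"
begin

lemma sm_functor_omap: "a \<in> Obj A \<Longrightarrow> sm_functor B C (omap F a)"
  using F.omap_in[of a] by (simp del: F.omap_in)

lemma monoidal_transformation_amap: "f \<in> Arr A \<Longrightarrow> monoidal_transformation B C (amap F f)"
  using F.amap_typing(1)[of f] by (simp del: F.amap_typing)

lemma monoidal_transformation_phi0: "monoidal_transformation B C (phi0 F)"
  using F.phi0_typing(1) by (simp del: F.phi0_typing)

lemma monoidal_transformation_phi2:
  "a \<in> Obj A \<Longrightarrow> a' \<in> Obj A \<Longrightarrow> monoidal_transformation B C (phi2 F a a')"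
  using F.phi2_typing(1)[of a a'] by (simp del: F.phi2_typing)

lemma src_tgt [simp]:
  "f \<in> Arr A \<Longrightarrow> msrc (amap F f) = omap F (Dom A f)"
  "f \<in> Arr A \<Longrightarrow> mtgt (amap F f) = omap F (Cod A f)"
  "msrc (phi0 F) = ihom_unit B C" "mtgt (phi0 F) = omap F (Unt A)"
  "a \<in> Obj A \<Longrightarrow> a' \<in> Obj A \<Longrightarrow> msrc (phi2 F a a') = ihom_ten B C (omap F a) (omap F a')"
  "a \<in> Obj A \<Longrightarrow> a' \<in> Obj A \<Longrightarrow> mtgt (phi2 F a a') = omap F (a \<otimes>\<^bsub>A\<^esub> a')"
  using F.amap_typing(2,3)[of f] F.phi0_typing(2,3) F.phi2_typing(2,3)[of a a'] by simp_all

lemma functor_typing [simp]: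
  assumes "a \<in> Obj A"
  shows "b \<in> Obj B \<Longrightarrow> omap (omap F a) b \<in> Obj C"
    and "g \<in> Arr B \<Longrightarrow> amap (omap F a) g \<in> Arr C"
    and "g \<in> Arr B \<Longrightarrow> Dom C (amap (omap F a) g) = omap (omap F a) (Dom B g)"
    and "g \<in> Arr B \<Longrightarrow> Cod C (amap (omap F a) g) = omap (omap F a) (Cod B g)"
    and "phi0 (omap F a) \<in> Arr C" and "Dom C (phi0 (omap F a)) = Unt C"
    and "Cod C (phi0 (omap F a)) = omap (omap F a) (Unt B)"
    and "b \<in> Obj B \<Longrightarrow> b' \<in> Obj B \<Longrightarrow> phi2 (omap F a) b b' \<in> Arr C"
    and "b \<in> Obj B \<Longrightarrow> b' \<in> Obj B \<Longrightarrow>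
      Dom C (phi2 (omap F a) b b') = omap (omap F a) b \<otimes>\<^bsub>C\<^esub> omap (omap F a) b'"
    and "b \<in> Obj B \<Longrightarrow> b' \<in> Obj B \<Longrightarrow> Cod C (phi2 (omap F a) b b') = omap (omap F a) (b \<otimes>\<^bsub>B\<^esub> b')"
  by (simp_all add: sm_functor_typing[OF sm_functor_omap[OF assms]])

lemma transformation_typing [simp]:
  assumes "b \<in> Obj B"
  shows "f \<in> Arr A \<Longrightarrow> mcomp (amap F f) b \<in> Arr C"
    and "f \<in> Arr A \<Longrightarrow> Dom C (mcomp (amap F f) b) = omap (omap F (Dom A f)) b"
    and "f \<in> Arr A \<Longrightarrow> Cod C (mcomp (amap F f) b) = omap (omap F (Cod A f)) b"
    and "mcomp (phi0 F) b \<in> Arr C" and "Dom C (mcomp (phi0 F) b) = Unt C"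
    and "Cod C (mcomp (phi0 F) b) = omap (omap F (Unt A)) b"
    and "a \<in> Obj A \<Longrightarrow> a' \<in> Obj A \<Longrightarrow> mcomp (phi2 F a a') b \<in> Arr C"
    and "a \<in> Obj A \<Longrightarrow> a' \<in> Obj A \<Longrightarrow>
      Dom C (mcomp (phi2 F a a') b) = omap (omap F a) b \<otimes>\<^bsub>C\<^esub> omap (omap F a') b"
    and "a \<in> Obj A \<Longrightarrow> a' \<in> Obj A \<Longrightarrow> Cod C (mcomp (phi2 F a a') b) = omap (omap F (a \<otimes>\<^bsub>A\<^esub> a')) b"
  using assms monoidal_transformation.mcomp_typing[OF monoidal_transformation_amap, of f b]
    monoidal_transformation.mcomp_typing[OF monoidal_transformation_phi0, of b]
    monoidal_transformation.mcomp_typing[OF monoidal_transformation_phi2, of a a' b]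
  by (simp_all add: ihom_unit_def ihom_ten_def)

lemma bar_word_in [simp]: "word_ok A B X \<Longrightarrow> bar_word C F X \<in> Obj C"
  by (induction X) simp_all

lemma bar_formal_typing [simp]:
  assumes "formal_ok A B p"
  shows "bar_formal C F p \<in> Arr C" and "Dom C (bar_formal C F p) = bar_word C F (fdom A B p)"
    and "Cod C (bar_formal C F p) = bar_word C F (fcod A B p)"
  using assms by (induction p) simp_all

lemma bar_ften:
  "formal_ok A B p \<Longrightarrow> formal_ok A B q \<Longrightarrow>
    bar_formal C F (ften A B p q) = bar_formal C F p \<boxtimes>\<^bsub>C\<^esub> bar_formal C F q"
  by (simp add: ften_def)

lemma bar_finterchange:
  "bar_formal C F (finterchange X Y Z W) =
    interchange C (bar_word C F X) (bar_word C F Y) (bar_word C F Z) (bar_word C F W)"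
  by (simp add: finterchange_def interchange_def)

text \<open>That the arrow \<open>phi2 F a a'\<close> respects the binary structure maps is the relation between
  \<open>\<gamma>\<close> and \<open>\<delta>\<close>, except that the interchange stands on the other side; it is its own
  inverse after exchanging the two middle objects.\<close>

lemma mcomp_phi2_ihom:
  assumes "a \<in> Obj A" and "a' \<in> Obj A" and "b \<in> Obj B" and "b' \<in> Obj B"
  shows "mcomp (phi2 F a a') (b \<otimes>\<^bsub>B\<^esub> b') \<cdot>\<^bsub>C\<^esub> (phi2 (omap F a) b b' \<boxtimes>\<^bsub>C\<^esub> phi2 (omap F a') b b') =
    phi2 (omap F (a \<otimes>\<^bsub>A\<^esub> a')) b b' \<cdot>\<^bsub>C\<^esub> (mcomp (phi2 F a a') b \<boxtimes>\<^bsub>C\<^esub> mcomp (phi2 F a a') b') \<cdot>\<^bsub>C\<^esub>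
      interchange C (omap (omap F a) b) (omap (omap F a) b') (omap (omap F a') b) (omap (omap F a') b')"
  (is "?l = ?p \<cdot>\<^bsub>C\<^esub> ?m \<cdot>\<^bsub>C\<^esub> ?i")
proof -
  let ?j = "interchange C (omap (omap F a) b) (omap (omap F a') b) (omap (omap F a) b') (omap (omap F a') b')"
  note [simp] = assms
  have "?l \<cdot>\<^bsub>C\<^esub> ?j = ?p \<cdot>\<^bsub>C\<^esub> ?m"
    using monoidal_transformation.mcomp_phi2[OF monoidal_transformation_phi2, of a a' b b']
    by (simp add: ihom_ten_def)
  then have "(?l \<cdot>\<^bsub>C\<^esub> ?j) \<cdot>\<^bsub>C\<^esub> ?i = (?p \<cdot>\<^bsub>C\<^esub> ?m) \<cdot>\<^bsub>C\<^esub> ?i" by simp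
  then show ?thesis by (simp add: C.interchange_inv)
qed

text \<open>Each defining relation becomes an axiom: of the symmetric monoidal category \<open>C\<close>, of a functor
  \<open>F a\<close>, of \<open>F\<close> itself at an object of \<open>B\<close>, or of one of the transformations \<open>F f\<close>, \<open>phi0 F\<close>, \<open>phi2 F a a'\<close>.\<close>

lemma bar_frel:
  "frel A B p q \<Longrightarrow> formal_ok A B p \<Longrightarrow> formal_ok A B q \<Longrightarrow> bar_formal C F p = bar_formal C F q"
proof (induction rule: frel.induct)
  case (ass_nat p q r)
  then show ?case using C.ass_nat[of "bar_formal C F p" "bar_formal C F q" "bar_formal C F r"] by (simp add: bar_ften)
next
  case (run_nat p)
  then show ?case using C.run_nat[of "bar_formal C F p"] by simp
next
  case (lun_nat p)
  then show ?case using C.lun_nat[of "bar_formal C F p"] by simp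
next
  case (sym_nat p q)
  then show ?case using C.sym_nat[of "bar_formal C F p" "bar_formal C F q"] by (simp add: bar_ften)
next
  case (pentagon X Y Z W)
  then show ?case by (simp add: C.pentagon)
next
  case (triangle X Y)
  then show ?case by (simp add: C.triangle)
next
  case (sym_inv Y X)
  then show ?case by (simp add: C.Sym_inv)
next
  case (sym_unit X)
  then show ?case by (simp add: C.Sym_unit)
next
  case (hexagon Z X Y)
  then show ?case by (simp add: C.hexagon)
next
  case (obj_arr_id a b)
  then interpret a: sm_functor B C "omap F a" by (simp add: sm_functor_omap)
  from obj_arr_id show ?case by simp
next
  case (obj_arr_comp g b b' g' b'' a)
  then interpret a: sm_functor B C "omap F a" by (simp add: sm_functor_omap)
  from obj_arr_comp show ?case by (simp add: a.amap_comp hom_iff)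
next
  case (delta_nat g b c g' b' c' a)
  then interpret a: sm_functor B C "omap F a" by (simp add: sm_functor_omap)
  from delta_nat show ?case using a.phi2_nat[of g b c g' b' c'] by (simp add: bar_ften)
next
  case (delta_ass a b b' b'')
  then interpret a: sm_functor B C "omap F a" by (simp add: sm_functor_omap)
  from delta_ass show ?case by (simp add: a.phi2_Ass)
next
  case (delta_run a b)
  then interpret a: sm_functor B C "omap F a" by (simp add: sm_functor_omap)
  from delta_run show ?case by (simp add: a.phi2_Run)
next
  case (delta_lun a b)
  then interpret a: sm_functor B C "omap F a" by (simp add: sm_functor_omap)
  from delta_lun show ?case by (simp add: a.phi2_Lun)
next
  case (delta_sym a b b')
  then interpret a: sm_functor B C "omap F a" by (simp add: sm_functor_omap)
  from delta_sym show ?case by (simp add: a.phi2_Sym)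
next
  case (arr_obj_id a b)
  then show ?case by simp
next
  case (arr_obj_comp f a a' f' a'' b)
  then have b: "b \<in> Obj B" by simp
  from arr_obj_comp show ?case
    by (simp only: F.amap_Comp[of f a a' f' a''] mcomp_ihom[OF b] bar_formal.simps)
next
  case (gamma_nat f a c f' a' c' b)
  then have b: "b \<in> Obj B" and o: "formal_ok A B (FArrObj f b)" "formal_ok A B (FArrObj f' b)" by simp_all
  show ?case
    using arg_cong[OF F.phi2_nat[OF gamma_nat(1,2)], of "\<lambda>\<sigma>. mcomp \<sigma> b"]
    by (simp only: mcomp_ihom[OF b] bar_formal.simps bar_ften[OF o])
next
  case (gamma_ass a a' a'' b)
  then have b: "b \<in> Obj B" and a: "a \<in> Obj A" "a' \<in> Obj A" "a'' \<in> Obj A" by simp_all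
  show ?case
    using arg_cong[OF F.phi2_Ass[OF a], of "\<lambda>\<sigma>. mcomp \<sigma> b"]
    by (simp only: mcomp_ihom[OF b] bar_formal.simps bar_word.simps)
next
  case (gamma_run a b)
  then have b: "b \<in> Obj B" and a: "a \<in> Obj A" by simp_all
  show ?case
    using arg_cong[OF F.phi2_Run[OF a], of "\<lambda>\<sigma>. mcomp \<sigma> b"]
    by (simp only: mcomp_ihom[OF b] bar_formal.simps bar_word.simps)
next
  case (gamma_lun a b)
  then have b: "b \<in> Obj B" and a: "a \<in> Obj A" by simp_all
  show ?case
    using arg_cong[OF F.phi2_Lun[OF a], of "\<lambda>\<sigma>. mcomp \<sigma> b"]
    by (simp only: mcomp_ihom[OF b] bar_formal.simps bar_word.simps)
next
  case (gamma_sym a a' b)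
  then have b: "b \<in> Obj B" and a: "a \<in> Obj A" "a' \<in> Obj A" by simp_all
  show ?case
    using arg_cong[OF F.phi2_Sym[OF a], of "\<lambda>\<sigma>. mcomp \<sigma> b"]
    by (simp only: mcomp_ihom[OF b] bar_formal.simps bar_word.simps)
next
  case (arr_arr f a a' g b b')
  then interpret f: monoidal_transformation B C "amap F f" by (simp add: monoidal_transformation_amap)
  from arr_arr show ?case using f.mcomp_nat[of g b b'] by (simp add: hom_iff)
next
  case (arr_beta f a a')
  then interpret f: monoidal_transformation B C "amap F f" by (simp add: monoidal_transformation_amap)
  from arr_beta show ?case using f.mcomp_phi0 by (simp add: hom_iff)
next
  case (arr_delta f a a' b b')
  then interpret f: monoidal_transformation B C "amap F f" by (simp add: monoidal_transformation_amap)
  from arr_delta show ?case using f.mcomp_phi2[of b b'] by (simp add: bar_ften hom_iff)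
next
  case (arr_alpha g b b')
  interpret phi0: monoidal_transformation B C "phi0 F" by (rule monoidal_transformation_phi0)
  from arr_alpha show ?case using phi0.mcomp_nat[of g b b'] by (simp add: ihom_unit_def hom_iff)
next
  case (arr_gamma g b b' a a')
  then interpret phi2: monoidal_transformation B C "phi2 F a a'"
    by (simp add: monoidal_transformation_phi2)
  from arr_gamma show ?case
    using phi2.mcomp_nat[of g b b'] by (simp add: bar_ften ihom_ten_def hom_iff)
next
  case (alpha_delta b b')
  interpret phi0: monoidal_transformation B C "phi0 F" by (rule monoidal_transformation_phi0)
  from alpha_delta show ?case
    using phi0.mcomp_phi2[of b b'] by (simp add: bar_ften ihom_unit_def hom_iff)
next
  case (beta_gamma a a')
  then interpret phi2: monoidal_transformation B C "phi2 F a a'"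
    by (simp add: monoidal_transformation_phi2)
  have e: "phi0 (omap F (a \<otimes>\<^bsub>A\<^esub> a')) = mcomp (phi2 F a a') (Unt B) \<cdot>\<^bsub>C\<^esub>
      (phi0 (omap F a) \<boxtimes>\<^bsub>C\<^esub> phi0 (omap F a')) \<cdot>\<^bsub>C\<^esub> inv_arr C (Run C (Unt C))"
    using phi2.mcomp_phi0 beta_gamma by (simp add: ihom_ten_def)
  from beta_gamma show ?case by (simp add: e bar_ften)
next
  case beta_alpha
  interpret phi0: monoidal_transformation B C "phi0 F" by (rule monoidal_transformation_phi0)
  show ?case using phi0.mcomp_phi0 by (simp add: ihom_unit_def)
next
  case (gamma_delta a a' b b')
  then show ?case by (simp add: bar_ften bar_finterchange mcomp_phi2_ihom)
qed simp_all

lemma bar_fcong: "fcong A B p q \<Longrightarrow> bar_formal C F p = bar_formal C F q"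
  by (induction rule: fcong.induct) (simp_all add: bar_frel)

lemma bar_fclass [simp]: "formal_ok A B p \<Longrightarrow> amap (bar A B C F) (fclass A B p) = bar_formal C F p"
  using bar_fcong[OF fcong_rep[of p]] by (simp add: bar_def)

lemma omap_bar [simp]: "word_ok A B X \<Longrightarrow> omap (bar A B C F) X = bar_word C F X"
  by (simp add: bar_def)

lemma phi0_bar [simp]: "phi0 (bar A B C F) = Idn C (Unt C)"
  by (simp add: bar_def)

lemma phi2_bar [simp]:
  "word_ok A B X \<Longrightarrow> word_ok A B Y \<Longrightarrow>
    phi2 (bar A B C F) X Y = Idn C (bar_word C F X \<otimes>\<^bsub>C\<^esub> bar_word C F Y)"
  by (simp add: bar_def)

lemma strict_bar: "strict (tensor A B) C (bar A B C F)"
  by (simp add: strict_def)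

lemma sm_functor_bar: "sm_functor (tensor A B) C (bar A B C F)"
proof (rule sm_functorI)
  show "category (tensor A B)" "category C" ..
  show "phi0 (bar A B C F) \<in> hom C (Unt C) (omap (bar A B C F) (Unt (tensor A B)))"
    by (simp add: hom_iff)
  show "omap (bar A B C F) \<in> extensional (Obj (tensor A B))"
    "amap (bar A B C F) \<in> extensional (Arr (tensor A B))"
    by (simp_all add: bar_def del: tensor_simps)
  fix c assume "c \<in> Arr (tensor A B)"
  then obtain p where p [simp]: "formal_ok A B p" and c [simp]: "c = fclass A B p" by (rule tensor_arrE)
  show "amap (bar A B C F) c \<in> hom C (omap (bar A B C F) (Dom (tensor A B) c))
      (omap (bar A B C F) (Cod (tensor A B) c))"
    by (simp add: hom_iff)
  fix d assume "d \<in> Arr (tensor A B)"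
  then obtain q where q [simp]: "formal_ok A B q" and d [simp]: "d = fclass A B q" by (rule tensor_arrE)
  show "amap (bar A B C F) (d \<cdot>\<^bsub>tensor A B\<^esub> c) = amap (bar A B C F) d \<cdot>\<^bsub>C\<^esub> amap (bar A B C F) c"
    if "Cod (tensor A B) c = Dom (tensor A B) d"
    using that by simp
  show "phi2 (bar A B C F) (Cod (tensor A B) c) (Cod (tensor A B) d) \<cdot>\<^bsub>C\<^esub>
      (amap (bar A B C F) c \<boxtimes>\<^bsub>C\<^esub> amap (bar A B C F) d) =
    amap (bar A B C F) (c \<boxtimes>\<^bsub>tensor A B\<^esub> d) \<cdot>\<^bsub>C\<^esub>
      phi2 (bar A B C F) (Dom (tensor A B) c) (Dom (tensor A B) d)"
    by (simp add: bar_ften)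
qed (auto simp: hom_iff, simp_all add: bar_def)

end

section \<open>The functor on transformations\<close>

locale bilinear_transformation =
  smc_pair A B + C: smc C + s: monoidal_transformation A "ihom B C" \<sigma>
  for A :: "('a, 'f) smc" and B :: "('b, 'g) smc" and C :: "('c, 'h) smc"
    and \<sigma> :: "('a, 'f, ('b, 'g, 'c, 'h) smf, ('b, 'g, 'c, 'h) mnt) mnt"
begin

sublocale F: bilinear A B C "msrc \<sigma>"
  by unfold_locales

sublocale G: bilinear A B C "mtgt \<sigma>"
  by unfold_locales

lemma monoidal_transformation_mcomp:
  "a \<in> Obj A \<Longrightarrow> monoidal_transformation B C (mcomp \<sigma> a)"
  using s.mcomp_typing(1)[of a] by (simp del: s.mcomp_typing)

lemma src_tgt [simp]:
  "a \<in> Obj A \<Longrightarrow> msrc (mcomp \<sigma> a) = omap (msrc \<sigma>) a"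
  "a \<in> Obj A \<Longrightarrow> mtgt (mcomp \<sigma> a) = omap (mtgt \<sigma>) a"
  using s.mcomp_typing(2,3)[of a] by simp_all

lemma component_typing [simp]:
  assumes "a \<in> Obj A" and "b \<in> Obj B"
  shows "mcomp (mcomp \<sigma> a) b \<in> Arr C"
    and "Dom C (mcomp (mcomp \<sigma> a) b) = omap (omap (msrc \<sigma>) a) b"
    and "Cod C (mcomp (mcomp \<sigma> a) b) = omap (omap (mtgt \<sigma>) a) b"
  using assms monoidal_transformation.mcomp_typing[OF monoidal_transformation_mcomp, of a b] by simp_all

lemma bar_mnt_word_typing [simp]:
  assumes "word_ok A B X"
  shows "bar_mnt_word C \<sigma> X \<in> Arr C" and "Dom C (bar_mnt_word C \<sigma> X) = bar_word C (msrc \<sigma>) X"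
    and "Cod C (bar_mnt_word C \<sigma> X) = bar_word C (mtgt \<sigma>) X"
  using assms by (induction X) simp_all

text \<open>Naturality propagates along the formation of formal arrows.  At canonical arrows it is the
  naturality of these in \<open>C\<close>; at the other generators it is the naturality and monoidality of \<open>\<sigma>\<close> and
  of its components.\<close>

lemma bar_mnt_natural:
  "formal_ok A B p \<Longrightarrow> bar_mnt_word C \<sigma> (fcod A B p) \<cdot>\<^bsub>C\<^esub> bar_formal C (msrc \<sigma>) p =
    bar_formal C (mtgt \<sigma>) p \<cdot>\<^bsub>C\<^esub> bar_mnt_word C \<sigma> (fdom A B p)"
proof (induction p)
  case (FId X)
  then show ?case by simp
next
  case (FComp q p)
  then have [simp]: "formal_ok A B p" "formal_ok A B q" "fcod A B p = fdom A B q" by simp_all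
  have q: "bar_mnt_word C \<sigma> (fcod A B q) \<cdot>\<^bsub>C\<^esub> bar_formal C (msrc \<sigma>) q =
      bar_formal C (mtgt \<sigma>) q \<cdot>\<^bsub>C\<^esub> bar_mnt_word C \<sigma> (fdom A B q)"
    and p: "bar_mnt_word C \<sigma> (fdom A B q) \<cdot>\<^bsub>C\<^esub> bar_formal C (msrc \<sigma>) p =
      bar_formal C (mtgt \<sigma>) p \<cdot>\<^bsub>C\<^esub> bar_mnt_word C \<sigma> (fdom A B p)"
    using FComp.IH by simp_all
  show ?case by (simp add: C.comp_extend[OF q] p)
next
  case (FLeft X p)
  then show ?case by simp
next
  case (FRight p X)
  then show ?case by simp
next
  case (FAss X Y Z)
  then show ?case
    using C.ass_nat[of "bar_mnt_word C \<sigma> X" "bar_mnt_word C \<sigma> Y" "bar_mnt_word C \<sigma> Z"] by simp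
next
  case (FAssInv X Y Z)
  then show ?case
    using C.inv_ass_nat[of "bar_mnt_word C \<sigma> X" "bar_mnt_word C \<sigma> Y" "bar_mnt_word C \<sigma> Z"] by simp
next
  case (FRun X)
  then show ?case using C.run_nat[of "bar_mnt_word C \<sigma> X"] by simp
next
  case (FRunInv X)
  then show ?case using C.inv_run_nat[of "bar_mnt_word C \<sigma> X"] by simp
next
  case (FLun X)
  then show ?case using C.lun_nat[of "bar_mnt_word C \<sigma> X"] by simp
next
  case (FLunInv X)
  then show ?case using C.inv_lun_nat[of "bar_mnt_word C \<sigma> X"] by simp
next
  case (FSym X Y)
  then show ?case using C.sym_nat[of "bar_mnt_word C \<sigma> X" "bar_mnt_word C \<sigma> Y"] by simp
next
  case (FAlpha b)
  then have b: "b \<in> Obj B" by simp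
  have "mcomp (mcomp \<sigma> (Unt A)) b \<cdot>\<^bsub>C\<^esub> mcomp (phi0 (msrc \<sigma>)) b = mcomp (phi0 (mtgt \<sigma>)) b"
    using arg_cong[OF s.mcomp_phi0, of "\<lambda>\<tau>. mcomp \<tau> b"] by (simp only: mcomp_ihom[OF b])
  with b show ?case by simp
next
  case (FBeta a)
  then interpret a: monoidal_transformation B C "mcomp \<sigma> a" by (simp add: monoidal_transformation_mcomp)
  from FBeta show ?case using a.mcomp_phi0 by simp
next
  case (FGamma a a' b)
  then have b: "b \<in> Obj B" and a: "a \<in> Obj A" "a' \<in> Obj A" by simp_all
  show ?case
    using arg_cong[OF s.mcomp_phi2[OF a], of "\<lambda>\<tau>. mcomp \<tau> b"]
    by (simp only: mcomp_ihom[OF b] bar_formal.simps bar_mnt_word.simps fdom.simps fcod.simps)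
next
  case (FDelta a b b')
  then interpret a: monoidal_transformation B C "mcomp \<sigma> a" by (simp add: monoidal_transformation_mcomp)
  from FDelta show ?case using a.mcomp_phi2[of b b'] by simp
next
  case (FObjArr a g)
  then interpret a: monoidal_transformation B C "mcomp \<sigma> a" by (simp add: monoidal_transformation_mcomp)
  from FObjArr show ?case using a.mcomp_natural[of g] by simp
next
  case (FArrObj f b)
  then have b: "b \<in> Obj B" and f: "f \<in> Arr A" by simp_all
  show ?case
    using arg_cong[OF s.mcomp_natural[OF f], of "\<lambda>\<tau>. mcomp \<tau> b"]
    by (simp only: mcomp_ihom[OF b] bar_formal.simps bar_mnt_word.simps fdom.simps fcod.simps)
qed

lemma bar_mnt_simps [simp]:
  "msrc (bar_mnt A B C \<sigma>) = bar A B C (msrc \<sigma>)" "mtgt (bar_mnt A B C \<sigma>) = bar A B C (mtgt \<sigma>)"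
  "mcomp (bar_mnt A B C \<sigma>) = (\<lambda>X \<in> {X. word_ok A B X}. bar_mnt_word C \<sigma> X)"
  by (simp_all add: bar_mnt_def)

lemma monoidal_transformation_bar_mnt: "monoidal_transformation (tensor A B) C (bar_mnt A B C \<sigma>)"
proof (rule monoidal_transformationI)
  fix c assume "c \<in> Arr (tensor A B)"
  then obtain p where p [simp]: "formal_ok A B p" and c [simp]: "c = fclass A B p" by (rule tensor_arrE)
  show "mcomp (bar_mnt A B C \<sigma>) (Cod (tensor A B) c) \<cdot>\<^bsub>C\<^esub> amap (msrc (bar_mnt A B C \<sigma>)) c =
      amap (mtgt (bar_mnt A B C \<sigma>)) c \<cdot>\<^bsub>C\<^esub> mcomp (bar_mnt A B C \<sigma>) (Dom (tensor A B) c)"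
    by (simp add: bar_mnt_natural)
qed (simp_all add: hom_iff F.sm_functor_bar G.sm_functor_bar)

end

context smc_pair
begin

lemma bar_mnt_Idn:
  assumes C: "smc C" and F: "sm_functor A (ihom B C) F"
  shows "bar_mnt A B C (Idn (SMC A (ihom B C)) F) = Idn (SMC (tensor A B) C) (bar A B C F)"
proof -
  interpret C: smc C by (rule C)
  interpret F: sm_functor A "ihom B C" F by (rule F)
  interpret bilinear A B C F by unfold_locales
  have "bar_mnt_word C (Idn (SMC A (ihom B C)) F) X = Idn C (bar_word C F X)" if "word_ok A B X" for X
    using that by (induction X) simp_all
  then show ?thesis
    by (intro mnt_eqI[where S = "Obj (tensor A B)"]) (simp_all add: bar_mnt_def)
qed

lemma bar_mnt_Comp:
  assumes C: "smc C" and s: "monoidal_transformation A (ihom B C) \<sigma>"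
    and t: "monoidal_transformation A (ihom B C) \<tau>" and st: "mtgt \<sigma> = msrc \<tau>"
  shows "bar_mnt A B C (\<tau> \<cdot>\<^bsub>SMC A (ihom B C)\<^esub> \<sigma>) =
    bar_mnt A B C \<tau> \<cdot>\<^bsub>SMC (tensor A B) C\<^esub> bar_mnt A B C \<sigma>"
proof -
  interpret C: smc C by (rule C)
  interpret s: monoidal_transformation A "ihom B C" \<sigma> by (rule s)
  interpret t: monoidal_transformation A "ihom B C" \<tau> by (rule t)
  interpret s: bilinear_transformation A B C \<sigma> by unfold_locales
  interpret t: bilinear_transformation A B C \<tau> by unfold_locales
  note [simp] = st
  have "bar_mnt_word C (\<tau> \<cdot>\<^bsub>SMC A (ihom B C)\<^esub> \<sigma>) X = bar_mnt_word C \<tau> X \<cdot>\<^bsub>C\<^esub> bar_mnt_word C \<sigma> X"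
    if "word_ok A B X" for X
    using that by (induction X) simp_all
  then show ?thesis
    by (intro mnt_eqI[where S = "Obj (tensor A B)"]) (simp_all add: bar_mnt_def)
qed

end

section \<open>Strict functors and isomorphisms of categories\<close>

lemma StrSMC_simps [simp]:
  "Obj (StrSMC A B) = {F. sm_functor A B F \<and> strict A B F}"
  "Arr (StrSMC A B) = {\<sigma>. monoidal_transformation A B \<sigma> \<and> strict A B (msrc \<sigma>) \<and> strict A B (mtgt \<sigma>)}"
  "Dom (StrSMC A B) = Dom (SMC A B)" "Cod (StrSMC A B) = Cod (SMC A B)"
  "Idn (StrSMC A B) = Idn (SMC A B)" "Comp (StrSMC A B) = Comp (SMC A B)"
  by (simp_all add: StrSMC_def del: SMC_simps)

lemma cat_functorI:
  assumes "category A" and "category B"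
    and "\<And>a. a \<in> Obj A \<Longrightarrow> omap F a \<in> Obj B"
    and "\<And>f. f \<in> Arr A \<Longrightarrow> amap F f \<in> hom B (omap F (Dom A f)) (omap F (Cod A f))"
    and "\<And>a. a \<in> Obj A \<Longrightarrow> amap F (Idn A a) = Idn B (omap F a)"
    and "\<And>f g. f \<in> Arr A \<Longrightarrow> g \<in> Arr A \<Longrightarrow> Cod A f = Dom A g \<Longrightarrow>
      amap F (g \<cdot>\<^bsub>A\<^esub> f) = amap F g \<cdot>\<^bsub>B\<^esub> amap F f"
    and "omap F \<in> extensional (Obj A)" and "amap F \<in> extensional (Arr A)"
  shows "cat_functor A B F"
proof (intro cat_functor.intro cat_functor_axioms.intro assms)
  show "amap F f \<in> hom B (omap F x) (omap F y)" if "f \<in> hom A x y" for f x y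
    using assms(4)[of f] that by (simp add: hom_iff)
qed (simp_all add: hom_iff)

lemma category_StrSMC:
  assumes "category (SMC A B)"
  shows "category (StrSMC A B)"
proof -
  interpret S: category "SMC A B" by (rule assms)
  have h: "\<sigma> \<in> hom (StrSMC A B) F G \<longleftrightarrow> \<sigma> \<in> hom (SMC A B) F G \<and> strict A B F \<and> strict A B G" for \<sigma> F G
    by (auto simp: hom_iff)
  have o: "F \<in> Obj (StrSMC A B) \<longleftrightarrow> F \<in> Obj (SMC A B) \<and> strict A B F" for F
    by simp
  show ?thesis
  proof
    fix \<sigma> assume "\<sigma> \<in> Arr (StrSMC A B)"
    then show "Dom (StrSMC A B) \<sigma> \<in> Obj (StrSMC A B)" "Cod (StrSMC A B) \<sigma> \<in> Obj (StrSMC A B)"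
      using S.Dom_in[of \<sigma>] S.Cod_in[of \<sigma>] by simp_all
  qed (use S.Idn_hom S.Comp_hom S.Comp_Idn S.Idn_Comp S.Comp_assoc in
      \<open>simp_all only: h o StrSMC_simps(5,6)\<close>, blast+)
qed

lemma cat_functor_StrSMC_incl:
  assumes "category (SMC A B)"
  shows "cat_functor (StrSMC A B) (SMC A B) (StrSMC_incl A B)"
proof -
  interpret T: category "StrSMC A B" by (rule category_StrSMC[OF assms])
  show ?thesis
  proof (rule cat_functorI)
    show "category (StrSMC A B)" ..
    fix \<sigma> assume s: "\<sigma> \<in> Arr (StrSMC A B)"
    show "amap (StrSMC_incl A B) \<sigma> \<in> hom (SMC A B) (omap (StrSMC_incl A B) (Dom (StrSMC A B) \<sigma>))
      (omap (StrSMC_incl A B) (Cod (StrSMC A B) \<sigma>))"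
      using s T.Dom_in[OF s] T.Cod_in[OF s] by (simp add: StrSMC_incl_def ftor_id_def hom_iff)
    fix \<tau> assume t: "\<tau> \<in> Arr (StrSMC A B)" and "Cod (StrSMC A B) \<sigma> = Dom (StrSMC A B) \<tau>"
    then have "Comp (StrSMC A B) \<tau> \<sigma> \<in> Arr (StrSMC A B)" using s by (intro T.comp_typing)
    then show "amap (StrSMC_incl A B) (\<tau> \<cdot>\<^bsub>StrSMC A B\<^esub> \<sigma>) =
        amap (StrSMC_incl A B) \<tau> \<cdot>\<^bsub>SMC A B\<^esub> amap (StrSMC_incl A B) \<sigma>"
      using s t by (simp add: StrSMC_incl_def ftor_id_def del: StrSMC_simps(1,2) SMC_simps)
  next
    fix F assume F: "F \<in> Obj (StrSMC A B)"
    then show "amap (StrSMC_incl A B) (Idn (StrSMC A B) F) = Idn (SMC A B) (omap (StrSMC_incl A B) F)"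
      using T.Idn_typing(1)[OF F]
      by (simp add: StrSMC_incl_def ftor_id_def del: StrSMC_simps(1,2) SMC_simps)
  qed (use assms in \<open>auto simp: StrSMC_incl_def ftor_id_def\<close>)
qed

text \<open>The inverse maps preserve sources, targets, identities and composition because the functor does
  and is injective; so bijectivity on objects and arrows is all that has to be checked.\<close>

lemma cat_isoI:
  assumes F: "cat_functor A B F"
    and u: "\<And>b. b \<in> Obj B \<Longrightarrow> u b \<in> Obj A \<and> omap F (u b) = b"
    and u': "\<And>a. a \<in> Obj A \<Longrightarrow> u (omap F a) = a"
    and v: "\<And>g. g \<in> Arr B \<Longrightarrow> v g \<in> Arr A \<and> amap F (v g) = g"
    and v': "\<And>f. f \<in> Arr A \<Longrightarrow> v (amap F f) = f"
  shows "cat_iso A B F"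
proof -
  interpret F: cat_functor A B F by (rule F)
  let ?G = "\<lparr>omap = restrict u (Obj B), amap = restrict v (Arr B)\<rparr>"
  have dom: "Dom A (v g) = u (Dom B g)" and cod: "Cod A (v g) = u (Cod B g)" if "g \<in> Arr B" for g
    using F.amap_typing(2,3)[of "v g"] u'[of "Dom A (v g)"] u'[of "Cod A (v g)"] v[OF that] by simp_all
  have "cat_functor B A ?G"
  proof (rule cat_functorI)
    show "category B" "category A" ..
    fix g h assume g: "g \<in> Arr B" "h \<in> Arr B" "Cod B g = Dom B h"
    then have "v (h \<cdot>\<^bsub>B\<^esub> g) = v (amap F (v h \<cdot>\<^bsub>A\<^esub> v g))"
      using v by (simp add: F.amap_comp dom cod)
    also have "\<dots> = v h \<cdot>\<^bsub>A\<^esub> v g"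
      using g v by (intro v') (simp add: dom cod)
    finally show "amap ?G (h \<cdot>\<^bsub>B\<^esub> g) = amap ?G h \<cdot>\<^bsub>A\<^esub> amap ?G g"
      using g by simp
  next
    fix b assume b: "b \<in> Obj B"
    have "v (Idn B b) = v (amap F (Idn A (u b)))" using u[OF b] by simp
    also have "\<dots> = Idn A (u b)" using u[OF b] by (intro v') simp
    finally show "amap ?G (Idn B b) = Idn A (omap ?G b)" using b by simp
  qed (use u v in \<open>simp_all add: hom_iff dom cod\<close>)
  moreover have "ftor_comp A ?G F = ftor_id A" "ftor_comp B F ?G = ftor_id B"
    using u u' v v' by (simp_all add: ftor_comp_def ftor_id_def cong: restrict_cong)
  ultimately show ?thesis
    using F by (auto simp: cat_iso_def)
qed

lemma cat_functor_comp:
  assumes F: "cat_functor A B F" and G: "cat_functor B C G"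
  shows "cat_functor A C (ftor_comp A G F)"
proof -
  interpret F: cat_functor A B F by (rule F)
  interpret G: cat_functor B C G by (rule G)
  show ?thesis
    by (rule cat_functorI) (auto simp: ftor_comp_def hom_iff F.amap_comp G.amap_comp intro: F.A.category_axioms G.B.category_axioms)
qed

lemma ftor_comp_StrSMC_incl:
  assumes K: "cat_functor D (StrSMC A B) K"
  shows "ftor_comp D (StrSMC_incl A B) K = K"
proof -
  interpret K: cat_functor D "StrSMC A B" K by (rule K)
  have "omap (ftor_comp D (StrSMC_incl A B) K) = omap K"
    by (rule extensionalityI[OF _ K.omap_ext])
      (use K.omap_in in \<open>simp_all add: ftor_comp_def StrSMC_incl_def ftor_id_def del: StrSMC_simps\<close>)
  moreover have "amap (ftor_comp D (StrSMC_incl A B) K) = amap K"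
    by (rule extensionalityI[OF _ K.amap_ext])
      (use K.amap_typing in \<open>simp_all add: ftor_comp_def StrSMC_incl_def ftor_id_def del: StrSMC_simps\<close>)
  ultimately show ?thesis by (intro ftor.equality) auto
qed

section \<open>The inverse construction\<close>

text \<open>The restriction of a functor on \<open>A \<otimes> B\<close> along \<open>b \<mapsto> a \<otimes> b\<close>, which is monoidal by means of
  \<open>\<beta>\<close> and \<open>\<delta>\<close>.\<close>

definition unbar_obj :: "('a, 'f) smc \<Rightarrow> ('b, 'g) smc \<Rightarrow>
    (('a, 'b) word, ('a, 'f, 'b, 'g) formal set, 'c, 'h) smf \<Rightarrow> 'a \<Rightarrow> ('b, 'g, 'c, 'h) smf" where
  "unbar_obj A B G a = \<lparr>
     omap = (\<lambda>b \<in> Obj B. omap G (WGen a b)),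
     amap = (\<lambda>g \<in> Arr B. amap G (fclass A B (FObjArr a g))),
     phi0 = amap G (fclass A B (FBeta a)),
     phi2 = (\<lambda>b b'. if b \<in> Obj B \<and> b' \<in> Obj B then amap G (fclass A B (FDelta a b b')) else undefined)\<rparr>"

definition unbar :: "('a, 'f) smc \<Rightarrow> ('b, 'g) smc \<Rightarrow> ('c, 'h) smc \<Rightarrow>
    (('a, 'b) word, ('a, 'f, 'b, 'g) formal set, 'c, 'h) smf \<Rightarrow>
    ('a, 'f, ('b, 'g, 'c, 'h) smf, ('b, 'g, 'c, 'h) mnt) smf" where
  "unbar A B C G = \<lparr>
     omap = (\<lambda>a \<in> Obj A. unbar_obj A B G a),
     amap = (\<lambda>f \<in> Arr A. \<lparr>msrc = unbar_obj A B G (Dom A f), mtgt = unbar_obj A B G (Cod A f),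
       mcomp = (\<lambda>b \<in> Obj B. amap G (fclass A B (FArrObj f b)))\<rparr>),
     phi0 = \<lparr>msrc = ihom_unit B C, mtgt = unbar_obj A B G (Unt A),
       mcomp = (\<lambda>b \<in> Obj B. amap G (fclass A B (FAlpha b)))\<rparr>,
     phi2 = (\<lambda>a a'. if a \<in> Obj A \<and> a' \<in> Obj A then
       \<lparr>msrc = ihom_ten B C (unbar_obj A B G a) (unbar_obj A B G a'),
        mtgt = unbar_obj A B G (a \<otimes>\<^bsub>A\<^esub> a'),
        mcomp = (\<lambda>b \<in> Obj B. amap G (fclass A B (FGamma a a' b)))\<rparr> else undefined)\<rparr>"

definition unbar_mnt :: "('a, 'f) smc \<Rightarrow> ('b, 'g) smc \<Rightarrow> ('c, 'h) smc \<Rightarrow>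
    (('a, 'b) word, ('a, 'f, 'b, 'g) formal set, 'c, 'h) mnt \<Rightarrow>
    ('a, 'f, ('b, 'g, 'c, 'h) smf, ('b, 'g, 'c, 'h) mnt) mnt" where
  "unbar_mnt A B C \<tau> = \<lparr>
     msrc = unbar A B C (msrc \<tau>),
     mtgt = unbar A B C (mtgt \<tau>),
     mcomp = (\<lambda>a \<in> Obj A. \<lparr>msrc = unbar_obj A B (msrc \<tau>) a, mtgt = unbar_obj A B (mtgt \<tau>) a,
       mcomp = (\<lambda>b \<in> Obj B. mcomp \<tau> (WGen a b))\<rparr>)\<rparr>"

lemma unbar_simps [simp]:
  "b \<in> Obj B \<Longrightarrow> omap (unbar_obj A B G a) b = omap G (WGen a b)"
  "g \<in> Arr B \<Longrightarrow> amap (unbar_obj A B G a) g = amap G (fclass A B (FObjArr a g))"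
  "phi0 (unbar_obj A B G a) = amap G (fclass A B (FBeta a))"
  "b \<in> Obj B \<Longrightarrow> b' \<in> Obj B \<Longrightarrow> phi2 (unbar_obj A B G a) b b' = amap G (fclass A B (FDelta a b b'))"
  "a \<in> Obj A \<Longrightarrow> omap (unbar A B C G) a = unbar_obj A B G a"
  "f \<in> Arr A \<Longrightarrow> amap (unbar A B C G) f = \<lparr>msrc = unbar_obj A B G (Dom A f),
     mtgt = unbar_obj A B G (Cod A f), mcomp = (\<lambda>b \<in> Obj B. amap G (fclass A B (FArrObj f b)))\<rparr>"
  "phi0 (unbar A B C G) = \<lparr>msrc = ihom_unit B C, mtgt = unbar_obj A B G (Unt A),
     mcomp = (\<lambda>b \<in> Obj B. amap G (fclass A B (FAlpha b)))\<rparr>"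
  "a \<in> Obj A \<Longrightarrow> a' \<in> Obj A \<Longrightarrow> phi2 (unbar A B C G) a a' =
     \<lparr>msrc = ihom_ten B C (unbar_obj A B G a) (unbar_obj A B G a'),
      mtgt = unbar_obj A B G (a \<otimes>\<^bsub>A\<^esub> a'),
      mcomp = (\<lambda>b \<in> Obj B. amap G (fclass A B (FGamma a a' b)))\<rparr>"
  by (simp_all add: unbar_obj_def unbar_def)

locale strict_tensor_functor = smc_pair A B + C: smc C + G: sm_functor "tensor A B" C G
  for A :: "('a, 'f) smc" and B :: "('b, 'g) smc" and C :: "('c, 'h) smc"
    and G :: "(('a, 'b) word, ('a, 'f, 'b, 'g) formal set, 'c, 'h) smf" +
  assumes strict: "strict (tensor A B) C G"
begin

abbreviation E :: "('a, 'f, 'b, 'g) formal \<Rightarrow> 'h" where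
  "E p \<equiv> amap G (fclass A B p)"

lemma phi0_strict [simp]: "phi0 G = Idn C (Unt C)"
  using strict by (simp add: strict_def)

lemma phi2_strict [simp]:
  "word_ok A B X \<Longrightarrow> word_ok A B Y \<Longrightarrow> phi2 G X Y = Idn C (omap G X \<otimes>\<^bsub>C\<^esub> omap G Y)"
  using strict by (simp add: strict_def)

lemma omap_WUnit [simp]: "omap G WUnit = Unt C"
  using G.phi0_typing(3) by simp

lemma omap_WTen [simp]:
  "word_ok A B X \<Longrightarrow> word_ok A B Y \<Longrightarrow> omap G (X \<odot> Y) = omap G X \<otimes>\<^bsub>C\<^esub> omap G Y"
  using G.phi2_typing(3)[of X Y] by simp

lemma E_FId [simp]: "word_ok A B X \<Longrightarrow> E (FId X) = Idn C (omap G X)"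
  using G.amap_idn[of X] by simp

lemma E_FComp [simp]:
  assumes "formal_ok A B p" and "formal_ok A B q" and "fcod A B p = fdom A B q"
  shows "E (q \<bullet> p) = E q \<cdot>\<^bsub>C\<^esub> E p"
  using G.amap_comp[of "fclass A B p" "fclass A B q"] assms by simp

lemma E_ften [simp]:
  assumes "formal_ok A B p" and "formal_ok A B q"
  shows "E (ften A B p q) = E p \<boxtimes>\<^bsub>C\<^esub> E q"
  using G.phi2_natural[of "fclass A B p" "fclass A B q"] assms by simp

lemma E_frel: "frel A B p q \<Longrightarrow> formal_ok A B p \<Longrightarrow> formal_ok A B q \<Longrightarrow> E p = E q"
  by (simp add: fclass_eqI)

text \<open>For a strict functor, naturality of \<^const>\<open>phi2\<close> says that it preserves tensor products of arrows;
  \<open>X \<otimes> p\<close> is such a product with an identity.\<close>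

lemma E_FLeft [simp]:
  assumes [simp]: "word_ok A B X" "formal_ok A B p"
  shows "E (FLeft X p) = Idn C (omap G X) \<boxtimes>\<^bsub>C\<^esub> E p"
proof -
  have "E (FRight (FId X) (fdom A B p)) = Idn C (omap G X \<otimes>\<^bsub>C\<^esub> omap G (fdom A B p))"
    using E_frel[OF frel.right_id, of X "fdom A B p"] by simp
  moreover have "E (ften A B (FId X) p) = E (FLeft X p) \<cdot>\<^bsub>C\<^esub> E (FRight (FId X) (fdom A B p))"
    unfolding ften_def by (subst E_FComp) simp_all
  ultimately show ?thesis by simp
qed

lemma E_FRight [simp]:
  assumes [simp]: "word_ok A B X" "formal_ok A B p"
  shows "E (FRight p X) = E p \<boxtimes>\<^bsub>C\<^esub> Idn C (omap G X)"
proof -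
  have "E (FLeft (fcod A B p) (FId X)) = Idn C (omap G (fcod A B p) \<otimes>\<^bsub>C\<^esub> omap G X)"
    by simp
  moreover have "E (ften A B p (FId X)) = E (FLeft (fcod A B p) (FId X)) \<cdot>\<^bsub>C\<^esub> E (FRight p X)"
    unfolding ften_def by (subst E_FComp) simp_all
  ultimately show ?thesis by simp
qed

lemma E_inv:
  assumes "formal_ok A B p" and "formal_ok A B q"
    and "fcod A B p = fdom A B q" and "fcod A B q = fdom A B p"
    and "frel A B (q \<bullet> p) (FId (fdom A B p))" and "frel A B (p \<bullet> q) (FId (fdom A B q))"
  shows "inv_arr C (E p) = E q"
  using assms E_frel[OF assms(5)] E_frel[OF assms(6)]
  by (intro C.inv_arr_eq) (simp_all add: is_inverse_def hom_iff)

text \<open>With identities for structure arrows, the axioms of a symmetric monoidal functor say that canonical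
  arrows are preserved.\<close>

lemma E_FAss [simp]:
  assumes "word_ok A B X" and "word_ok A B Y" and "word_ok A B Z"
  shows "E (FAss X Y Z) = Ass C (omap G X) (omap G Y) (omap G Z)"
  using G.phi2_Ass[of X Y Z] assms by simp

lemma E_FRun [simp]: "word_ok A B X \<Longrightarrow> E (FRun X) = Run C (omap G X)"
  using G.phi2_Run[of X] by simp

lemma E_FLun [simp]: "word_ok A B X \<Longrightarrow> E (FLun X) = Lun C (omap G X)"
  using G.phi2_Lun[of X] by simp

lemma E_FSym [simp]:
  "word_ok A B X \<Longrightarrow> word_ok A B Y \<Longrightarrow> E (FSym X Y) = Sym C (omap G X) (omap G Y)"
  using G.phi2_Sym[of X Y] by simp

lemma E_FAssInv [simp]:
  assumes "word_ok A B X" and "word_ok A B Y" and "word_ok A B Z"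
  shows "E (FAssInv X Y Z) = inv_arr C (Ass C (omap G X) (omap G Y) (omap G Z))"
  using assms E_inv[of "FAss X Y Z" "FAssInv X Y Z"] by (simp add: frel.ass_inv1 frel.ass_inv2)

lemma E_FRunInv [simp]: "word_ok A B X \<Longrightarrow> E (FRunInv X) = inv_arr C (Run C (omap G X))"
  using E_inv[of "FRun X" "FRunInv X"] by (simp add: frel.run_inv1 frel.run_inv2)

lemma E_FLunInv [simp]: "word_ok A B X \<Longrightarrow> E (FLunInv X) = inv_arr C (Lun C (omap G X))"
  using E_inv[of "FLun X" "FLunInv X"] by (simp add: frel.lun_inv1 frel.lun_inv2)

text \<open>Each axiom for the restriction is the image under the functor of a defining relation of
  \<open>A \<otimes> B\<close>.\<close>

lemma sm_functor_unbar_obj: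
  assumes a [simp]: "a \<in> Obj A"
  shows "sm_functor B C (unbar_obj A B G a)"
proof (rule sm_functorI)
  show "category B" "category C" ..
  fix g assume g [simp]: "g \<in> Arr B"
  show "amap (unbar_obj A B G a) g \<in> hom C (omap (unbar_obj A B G a) (Dom B g)) (omap (unbar_obj A B G a) (Cod B g))"
    by (simp add: hom_iff)
  fix g' assume g' [simp]: "g' \<in> Arr B"
  show "amap (unbar_obj A B G a) (g' \<cdot>\<^bsub>B\<^esub> g) = amap (unbar_obj A B G a) g' \<cdot>\<^bsub>C\<^esub> amap (unbar_obj A B G a) g"
    if [simp]: "Cod B g = Dom B g'"
    using E_frel[OF frel.obj_arr_comp[of g B "Dom B g" "Cod B g" g' "Cod B g'" A a]] by (simp add: hom_iff)
  show "phi2 (unbar_obj A B G a) (Cod B g) (Cod B g') \<cdot>\<^bsub>C\<^esub>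
      (amap (unbar_obj A B G a) g \<boxtimes>\<^bsub>C\<^esub> amap (unbar_obj A B G a) g') =
    amap (unbar_obj A B G a) (g \<boxtimes>\<^bsub>B\<^esub> g') \<cdot>\<^bsub>C\<^esub> phi2 (unbar_obj A B G a) (Dom B g) (Dom B g')"
    using E_frel[OF frel.delta_nat[of g B "Dom B g" "Cod B g" g' "Dom B g'" "Cod B g'" A a]]
    by (simp add: hom_iff)
next
  fix b assume b [simp]: "b \<in> Obj B"
  show "omap (unbar_obj A B G a) b \<in> Obj C" by simp
  show "amap (unbar_obj A B G a) (Idn B b) = Idn C (omap (unbar_obj A B G a) b)"
    using E_frel[OF frel.obj_arr_id[of A B a b]] by simp
  show "amap (unbar_obj A B G a) (Run B b) \<cdot>\<^bsub>C\<^esub> phi2 (unbar_obj A B G a) b (Unt B) \<cdot>\<^bsub>C\<^esub>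
      (Idn C (omap (unbar_obj A B G a) b) \<boxtimes>\<^bsub>C\<^esub> phi0 (unbar_obj A B G a)) = Run C (omap (unbar_obj A B G a) b)"
    using E_frel[OF frel.delta_run[of A B a b]] by simp
  show "amap (unbar_obj A B G a) (Lun B b) \<cdot>\<^bsub>C\<^esub> phi2 (unbar_obj A B G a) (Unt B) b \<cdot>\<^bsub>C\<^esub>
      (phi0 (unbar_obj A B G a) \<boxtimes>\<^bsub>C\<^esub> Idn C (omap (unbar_obj A B G a) b)) = Lun C (omap (unbar_obj A B G a) b)"
    using E_frel[OF frel.delta_lun[of A B a b]] by simp
  fix b' assume b' [simp]: "b' \<in> Obj B"
  show "amap (unbar_obj A B G a) (Sym B b b') \<cdot>\<^bsub>C\<^esub> phi2 (unbar_obj A B G a) b b' =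
      phi2 (unbar_obj A B G a) b' b \<cdot>\<^bsub>C\<^esub> Sym C (omap (unbar_obj A B G a) b) (omap (unbar_obj A B G a) b')"
    using E_frel[OF frel.delta_sym[of A B a b b']] by simp
  fix b'' assume b'' [simp]: "b'' \<in> Obj B"
  show "amap (unbar_obj A B G a) (Ass B b b' b'') \<cdot>\<^bsub>C\<^esub> phi2 (unbar_obj A B G a) b (b' \<otimes>\<^bsub>B\<^esub> b'') \<cdot>\<^bsub>C\<^esub>
      (Idn C (omap (unbar_obj A B G a) b) \<boxtimes>\<^bsub>C\<^esub> phi2 (unbar_obj A B G a) b' b'') =
    phi2 (unbar_obj A B G a) (b \<otimes>\<^bsub>B\<^esub> b') b'' \<cdot>\<^bsub>C\<^esub>
      (phi2 (unbar_obj A B G a) b b' \<boxtimes>\<^bsub>C\<^esub> Idn C (omap (unbar_obj A B G a) b'')) \<cdot>\<^bsub>C\<^esub>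
      Ass C (omap (unbar_obj A B G a) b) (omap (unbar_obj A B G a) b') (omap (unbar_obj A B G a) b'')"
    using E_frel[OF frel.delta_ass[of A B a b b' b'']] by simp
qed (auto simp: hom_iff, auto simp: unbar_obj_def)

lemma monoidal_transformation_unbar_amap:
  assumes f [simp]: "f \<in> Arr A"
  shows "monoidal_transformation B C (amap (unbar A B C G) f)"
proof (rule monoidal_transformationI)
  fix g assume [simp]: "g \<in> Arr B"
  show "mcomp (amap (unbar A B C G) f) (Cod B g) \<cdot>\<^bsub>C\<^esub> amap (msrc (amap (unbar A B C G) f)) g =
      amap (mtgt (amap (unbar A B C G) f)) g \<cdot>\<^bsub>C\<^esub> mcomp (amap (unbar A B C G) f) (Dom B g)"
    using E_frel[OF frel.arr_arr[of f A "Dom A f" "Cod A f" g B "Dom B g" "Cod B g"]] by (simp add: hom_iff)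
next
  show "mcomp (amap (unbar A B C G) f) (Unt B) \<cdot>\<^bsub>C\<^esub> phi0 (msrc (amap (unbar A B C G) f)) =
      phi0 (mtgt (amap (unbar A B C G) f))"
    using E_frel[OF frel.arr_beta[of f A "Dom A f" "Cod A f" B]] by (simp add: hom_iff)
next
  fix b b' assume [simp]: "b \<in> Obj B" "b' \<in> Obj B"
  show "mcomp (amap (unbar A B C G) f) (b \<otimes>\<^bsub>B\<^esub> b') \<cdot>\<^bsub>C\<^esub> phi2 (msrc (amap (unbar A B C G) f)) b b' =
      phi2 (mtgt (amap (unbar A B C G) f)) b b' \<cdot>\<^bsub>C\<^esub>
        (mcomp (amap (unbar A B C G) f) b \<boxtimes>\<^bsub>C\<^esub> mcomp (amap (unbar A B C G) f) b')"
    using E_frel[OF frel.arr_delta[of f A "Dom A f" "Cod A f" B b b']] by (simp add: hom_iff)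
qed (simp_all add: sm_functor_unbar_obj hom_iff)

lemma monoidal_transformation_unbar_phi0:
  "monoidal_transformation B C (phi0 (unbar A B C G))"
proof (rule monoidal_transformationI)
  fix g assume [simp]: "g \<in> Arr B"
  show "mcomp (phi0 (unbar A B C G)) (Cod B g) \<cdot>\<^bsub>C\<^esub> amap (msrc (phi0 (unbar A B C G))) g =
      amap (mtgt (phi0 (unbar A B C G))) g \<cdot>\<^bsub>C\<^esub> mcomp (phi0 (unbar A B C G)) (Dom B g)"
    using E_frel[OF frel.arr_alpha[of g B "Dom B g" "Cod B g" A]] by (simp add: hom_iff ihom_unit_def)
next
  show "mcomp (phi0 (unbar A B C G)) (Unt B) \<cdot>\<^bsub>C\<^esub> phi0 (msrc (phi0 (unbar A B C G))) =
      phi0 (mtgt (phi0 (unbar A B C G)))"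
    using E_frel[OF frel.beta_alpha[of A B]] by (simp add: ihom_unit_def)
next
  fix b b' assume [simp]: "b \<in> Obj B" "b' \<in> Obj B"
  show "mcomp (phi0 (unbar A B C G)) (b \<otimes>\<^bsub>B\<^esub> b') \<cdot>\<^bsub>C\<^esub> phi2 (msrc (phi0 (unbar A B C G))) b b' =
      phi2 (mtgt (phi0 (unbar A B C G))) b b' \<cdot>\<^bsub>C\<^esub>
        (mcomp (phi0 (unbar A B C G)) b \<boxtimes>\<^bsub>C\<^esub> mcomp (phi0 (unbar A B C G)) b')"
    using E_frel[OF frel.alpha_delta[of A B b b']] by (simp add: ihom_unit_def)
qed (simp_all add: sm_functor_ihom_unit[OF B.smc_axioms C.smc_axioms] sm_functor_unbar_obj hom_iff,
    simp_all add: ihom_unit_def)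

lemma E_finterchange:
  assumes "word_ok A B X" and "word_ok A B Y" and "word_ok A B Z" and "word_ok A B W"
  shows "formal_ok A B (finterchange X Y Z W)"
    and "fdom A B (finterchange X Y Z W) = (X \<odot> Y) \<odot> (Z \<odot> W)"
    and "fcod A B (finterchange X Y Z W) = (X \<odot> Z) \<odot> (Y \<odot> W)"
    and "E (finterchange X Y Z W) = interchange C (omap G X) (omap G Y) (omap G Z) (omap G W)"
  using assms by (simp_all add: finterchange_def interchange_def)

lemma monoidal_transformation_unbar_phi2:
  assumes a [simp]: "a \<in> Obj A" "a' \<in> Obj A"
  shows "monoidal_transformation B C (phi2 (unbar A B C G) a a')"
proof (rule monoidal_transformationI)
  fix g assume [simp]: "g \<in> Arr B"
  show "mcomp (phi2 (unbar A B C G) a a') (Cod B g) \<cdot>\<^bsub>C\<^esub> amap (msrc (phi2 (unbar A B C G) a a')) g =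
      amap (mtgt (phi2 (unbar A B C G) a a')) g \<cdot>\<^bsub>C\<^esub> mcomp (phi2 (unbar A B C G) a a') (Dom B g)"
    using E_frel[OF frel.arr_gamma[of g B "Dom B g" "Cod B g" A a a']] by (simp add: hom_iff ihom_ten_def)
next
  have "E (FBeta (a \<otimes>\<^bsub>A\<^esub> a')) \<cdot>\<^bsub>C\<^esub> Run C (Unt C) =
      E (FGamma a a' (Unt B)) \<cdot>\<^bsub>C\<^esub> (E (FBeta a) \<boxtimes>\<^bsub>C\<^esub> E (FBeta a'))"
    using E_frel[OF frel.beta_gamma[of A B a a']] by simp
  then have "(E (FBeta (a \<otimes>\<^bsub>A\<^esub> a')) \<cdot>\<^bsub>C\<^esub> Run C (Unt C)) \<cdot>\<^bsub>C\<^esub> inv_arr C (Run C (Unt C)) =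
      (E (FGamma a a' (Unt B)) \<cdot>\<^bsub>C\<^esub> (E (FBeta a) \<boxtimes>\<^bsub>C\<^esub> E (FBeta a'))) \<cdot>\<^bsub>C\<^esub> inv_arr C (Run C (Unt C))"
    by simp
  then show "mcomp (phi2 (unbar A B C G) a a') (Unt B) \<cdot>\<^bsub>C\<^esub> phi0 (msrc (phi2 (unbar A B C G) a a')) =
      phi0 (mtgt (phi2 (unbar A B C G) a a'))"
    by (simp add: ihom_ten_def)
next
  fix b b' assume [simp]: "b \<in> Obj B" "b' \<in> Obj B"
  let ?l = "E (FGamma a a' (b \<otimes>\<^bsub>B\<^esub> b')) \<cdot>\<^bsub>C\<^esub> (E (FDelta a b b') \<boxtimes>\<^bsub>C\<^esub> E (FDelta a' b b'))"
  let ?r = "E (FDelta (a \<otimes>\<^bsub>A\<^esub> a') b b') \<cdot>\<^bsub>C\<^esub> (E (FGamma a a' b) \<boxtimes>\<^bsub>C\<^esub> E (FGamma a a' b'))"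
  let ?i = "interchange C (omap G (WGen a b)) (omap G (WGen a b')) (omap G (WGen a' b)) (omap G (WGen a' b'))"
  let ?j = "interchange C (omap G (WGen a b)) (omap G (WGen a' b)) (omap G (WGen a b')) (omap G (WGen a' b'))"
  have "?l = ?r \<cdot>\<^bsub>C\<^esub> ?i"
    using E_frel[OF frel.gamma_delta[of A B a a' b b']] by (simp add: E_finterchange)
  then have "?l \<cdot>\<^bsub>C\<^esub> ?j = (?r \<cdot>\<^bsub>C\<^esub> ?i) \<cdot>\<^bsub>C\<^esub> ?j" by simp
  also have "\<dots> = ?r" by (simp add: C.interchange_inv)
  finally show "mcomp (phi2 (unbar A B C G) a a') (b \<otimes>\<^bsub>B\<^esub> b') \<cdot>\<^bsub>C\<^esub> phi2 (msrc (phi2 (unbar A B C G) a a')) b b' =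
      phi2 (mtgt (phi2 (unbar A B C G) a a')) b b' \<cdot>\<^bsub>C\<^esub>
        (mcomp (phi2 (unbar A B C G) a a') b \<boxtimes>\<^bsub>C\<^esub> mcomp (phi2 (unbar A B C G) a a') b')"
    by (simp add: ihom_ten_def)
qed (simp_all add: sm_functor_ihom_ten[OF B.smc_axioms C.smc_axioms] sm_functor_unbar_obj hom_iff,
    simp_all add: ihom_ten_def)

lemma sm_functor_unbar: "sm_functor A (ihom B C) (unbar A B C G)"
proof (rule sm_functorI)
  show "category A" ..
  show "category (ihom B C)"
    using tensor_category_ihom[OF B.smc_axioms C.smc_axioms] by (simp add: tensor_category_def)
  let ?U = "unbar A B C G"
  fix f assume f [simp]: "f \<in> Arr A"
  show "amap ?U f \<in> hom (ihom B C) (omap ?U (Dom A f)) (omap ?U (Cod A f))"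
    using monoidal_transformation_unbar_amap[OF f] by (simp add: hom_iff)
  fix f' assume f' [simp]: "f' \<in> Arr A"
  show "amap ?U (f' \<cdot>\<^bsub>A\<^esub> f) = amap ?U f' \<cdot>\<^bsub>ihom B C\<^esub> amap ?U f" if [simp]: "Cod A f = Dom A f'"
    using E_frel[OF frel.arr_obj_comp[of f A "Dom A f" "Cod A f" f' "Cod A f'" B]]
    by (intro mnt_eqI[where S = "Obj B"]) (simp_all add: hom_iff)
  show "phi2 ?U (Cod A f) (Cod A f') \<cdot>\<^bsub>ihom B C\<^esub> (amap ?U f \<boxtimes>\<^bsub>ihom B C\<^esub> amap ?U f') =
      amap ?U (f \<boxtimes>\<^bsub>A\<^esub> f') \<cdot>\<^bsub>ihom B C\<^esub> phi2 ?U (Dom A f) (Dom A f')"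
    using E_frel[OF frel.gamma_nat[of f A "Dom A f" "Cod A f" f' "Dom A f'" "Cod A f'" B]]
    by (intro mnt_eqI[where S = "Obj B"]) (simp_all add: hom_iff)
next
  let ?U = "unbar A B C G"
  fix a assume a [simp]: "a \<in> Obj A"
  show "omap ?U a \<in> Obj (ihom B C)"
    by (simp add: sm_functor_unbar_obj)
  show "amap ?U (Idn A a) = Idn (ihom B C) (omap ?U a)"
    using E_frel[OF frel.arr_obj_id[of A B a]] by (intro mnt_eqI[where S = "Obj B"]) simp_all
  show "amap ?U (Run A a) \<cdot>\<^bsub>ihom B C\<^esub> phi2 ?U a (Unt A) \<cdot>\<^bsub>ihom B C\<^esub>
      (Idn (ihom B C) (omap ?U a) \<boxtimes>\<^bsub>ihom B C\<^esub> phi0 ?U) = Run (ihom B C) (omap ?U a)"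
    using E_frel[OF frel.gamma_run[of A B a]] by (intro mnt_eqI[where S = "Obj B"]) simp_all
  show "amap ?U (Lun A a) \<cdot>\<^bsub>ihom B C\<^esub> phi2 ?U (Unt A) a \<cdot>\<^bsub>ihom B C\<^esub>
      (phi0 ?U \<boxtimes>\<^bsub>ihom B C\<^esub> Idn (ihom B C) (omap ?U a)) = Lun (ihom B C) (omap ?U a)"
    using E_frel[OF frel.gamma_lun[of A B a]] by (intro mnt_eqI[where S = "Obj B"]) simp_all
  fix a' assume a' [simp]: "a' \<in> Obj A"
  show "phi2 ?U a a' \<in> hom (ihom B C) (omap ?U a \<otimes>\<^bsub>ihom B C\<^esub> omap ?U a') (omap ?U (a \<otimes>\<^bsub>A\<^esub> a'))"
    using monoidal_transformation_unbar_phi2[OF a a'] by (simp add: hom_iff)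
  show "amap ?U (Sym A a a') \<cdot>\<^bsub>ihom B C\<^esub> phi2 ?U a a' =
      phi2 ?U a' a \<cdot>\<^bsub>ihom B C\<^esub> Sym (ihom B C) (omap ?U a) (omap ?U a')"
    using E_frel[OF frel.gamma_sym[of A B a a']] by (intro mnt_eqI[where S = "Obj B"]) simp_all
  fix a'' assume a'' [simp]: "a'' \<in> Obj A"
  show "amap ?U (Ass A a a' a'') \<cdot>\<^bsub>ihom B C\<^esub> phi2 ?U a (a' \<otimes>\<^bsub>A\<^esub> a'') \<cdot>\<^bsub>ihom B C\<^esub>
      (Idn (ihom B C) (omap ?U a) \<boxtimes>\<^bsub>ihom B C\<^esub> phi2 ?U a' a'') =
    phi2 ?U (a \<otimes>\<^bsub>A\<^esub> a') a'' \<cdot>\<^bsub>ihom B C\<^esub> (phi2 ?U a a' \<boxtimes>\<^bsub>ihom B C\<^esub> Idn (ihom B C) (omap ?U a'')) \<cdot>\<^bsub>ihom B C\<^esub>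
      Ass (ihom B C) (omap ?U a) (omap ?U a') (omap ?U a'')"
    using E_frel[OF frel.gamma_ass[of A B a a' a'']] by (intro mnt_eqI[where S = "Obj B"]) simp_all
next
  let ?U = "unbar A B C G"
  show "phi0 ?U \<in> hom (ihom B C) (Unt (ihom B C)) (omap ?U (Unt A))"
    using monoidal_transformation_unbar_phi0 by (simp add: hom_iff)
qed (auto simp: unbar_def)

lemma bar_word_unbar: "word_ok A B X \<Longrightarrow> bar_word C (unbar A B C G) X = omap G X"
  by (induction X) simp_all

text \<open>Both sides respect all ways of forming formal arrows and agree at the generators, so a strict
  functor is determined by its values there.\<close>

lemma bar_formal_unbar: "formal_ok A B p \<Longrightarrow> bar_formal C (unbar A B C G) p = E p"
  by (induction p) (simp_all add: bar_word_unbar)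

lemma bar_unbar: "bar A B C (unbar A B C G) = G"
proof -
  interpret U: sm_functor A "ihom B C" "unbar A B C G" by (rule sm_functor_unbar)
  interpret U: bilinear A B C "unbar A B C G" by unfold_locales
  interpret b: sm_functor "tensor A B" C "bar A B C (unbar A B C G)" by (rule U.sm_functor_bar)
  have "omap (bar A B C (unbar A B C G)) = omap G"
    by (rule extensionalityI[OF b.omap_ext G.omap_ext]) (simp add: bar_word_unbar)
  moreover have "amap (bar A B C (unbar A B C G)) = amap G"
    by (rule extensionalityI[OF b.amap_ext G.amap_ext])
      (auto elim!: tensor_arrE simp: bar_formal_unbar)
  moreover have "phi2 (bar A B C (unbar A B C G)) X Y = phi2 G X Y" for X Y
    using b.phi2_ext[of X Y] G.phi2_ext[of X Y]
    by (cases "word_ok A B X \<and> word_ok A B Y") (auto simp: bar_word_unbar)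
  ultimately show ?thesis
    by (intro smf.equality) auto
qed

end

context bilinear
begin

lemma unbar_obj_bar:
  assumes a [simp]: "a \<in> Obj A"
  shows "unbar_obj A B (bar A B C F) a = omap F a"
proof -
  interpret a: sm_functor B C "omap F a" by (rule sm_functor_omap[OF a])
  have "omap (unbar_obj A B (bar A B C F) a) = omap (omap F a)"
    by (rule extensionalityI[OF _ a.omap_ext]) (simp_all add: unbar_obj_def)
  moreover have "amap (unbar_obj A B (bar A B C F) a) = amap (omap F a)"
    by (rule extensionalityI[OF _ a.amap_ext]) (simp_all add: unbar_obj_def)
  moreover have "phi2 (unbar_obj A B (bar A B C F) a) b b' = phi2 (omap F a) b b'" for b b'
    using a.phi2_ext[of b b'] by (auto simp: unbar_obj_def)
  ultimately show ?thesis
    by (intro smf.equality) auto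
qed

lemma unbar_bar: "unbar A B C (bar A B C F) = F"
proof -
  interpret b: strict_tensor_functor A B C "bar A B C F"
    by (intro strict_tensor_functor.intro strict_tensor_functor_axioms.intro sm_functor_bar strict_bar)
      unfold_locales
  let ?U = "unbar A B C (bar A B C F)"
  interpret U: sm_functor A "ihom B C" ?U by (rule b.sm_functor_unbar)
  have "omap ?U = omap F"
    by (rule extensionalityI[OF U.omap_ext F.omap_ext]) (simp add: unbar_obj_bar)
  moreover have "amap ?U f = amap F f" if f [simp]: "f \<in> Arr A" for f
    using monoidal_transformation.mcomp_ext[OF monoidal_transformation_amap[OF f]]
    by (intro mnt_eqI[where S = "Obj B"]) (simp_all add: unbar_obj_bar)
  then have "amap ?U = amap F"
    by (intro extensionalityI[OF U.amap_ext F.amap_ext])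
  moreover have "phi0 ?U = phi0 F"
    using monoidal_transformation.mcomp_ext[OF monoidal_transformation_phi0]
    by (intro mnt_eqI[where S = "Obj B"]) (simp_all add: unbar_obj_bar)
  moreover have "phi2 ?U a a' = phi2 F a a'" for a a'
  proof (cases "a \<in> Obj A \<and> a' \<in> Obj A")
    case True
    then show ?thesis
      using monoidal_transformation.mcomp_ext[OF monoidal_transformation_phi2, of a a']
      by (intro mnt_eqI[where S = "Obj B"]) (simp_all add: unbar_obj_bar)
  next
    case False
    then show ?thesis using F.phi2_ext[of a a'] U.phi2_ext[of a a'] by metis
  qed
  ultimately show ?thesis
    by (intro smf.equality) auto
qed

end

text \<open>A monoidal transformation between strict functors has \<open>\<tau> (X \<otimes> Y) = \<tau> X \<otimes> \<tau> Y\<close> and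
  \<open>\<tau> I = 1\<close>, so it is determined by its components at the words \<open>a \<otimes> b\<close>.\<close>

locale strict_tensor_transformation =
  smc_pair A B + C: smc C + t: monoidal_transformation "tensor A B" C \<tau>
  for A :: "('a, 'f) smc" and B :: "('b, 'g) smc" and C :: "('c, 'h) smc"
    and \<tau> :: "(('a, 'b) word, ('a, 'f, 'b, 'g) formal set, 'c, 'h) mnt" +
  assumes strict_src: "strict (tensor A B) C (msrc \<tau>)"
    and strict_tgt: "strict (tensor A B) C (mtgt \<tau>)"
begin

sublocale F: strict_tensor_functor A B C "msrc \<tau>"
  by unfold_locales (rule strict_src)

sublocale G: strict_tensor_functor A B C "mtgt \<tau>"
  by unfold_locales (rule strict_tgt)

lemma mcomp_WUnit [simp]: "mcomp \<tau> WUnit = Idn C (Unt C)"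
  using t.mcomp_phi0 by simp

lemma mcomp_WTen [simp]:
  "word_ok A B X \<Longrightarrow> word_ok A B Y \<Longrightarrow> mcomp \<tau> (X \<odot> Y) = mcomp \<tau> X \<boxtimes>\<^bsub>C\<^esub> mcomp \<tau> Y"
  using t.mcomp_phi2[of X Y] by simp

lemma mcomp_E:
  "formal_ok A B p \<Longrightarrow> mcomp \<tau> (fcod A B p) \<cdot>\<^bsub>C\<^esub> F.E p = G.E p \<cdot>\<^bsub>C\<^esub> mcomp \<tau> (fdom A B p)"
  using t.mcomp_natural[of "fclass A B p"] by simp

lemma monoidal_transformation_unbar_component:
  assumes a [simp]: "a \<in> Obj A"
  shows "monoidal_transformation B C (mcomp (unbar_mnt A B C \<tau>) a)"
proof (rule monoidal_transformationI)
  let ?t = "mcomp (unbar_mnt A B C \<tau>) a"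
  show "mcomp ?t (Unt B) \<cdot>\<^bsub>C\<^esub> phi0 (msrc ?t) = phi0 (mtgt ?t)"
    using mcomp_E[of "FBeta a"] by (simp add: unbar_mnt_def)
  fix g assume [simp]: "g \<in> Arr B"
  show "mcomp ?t (Cod B g) \<cdot>\<^bsub>C\<^esub> amap (msrc ?t) g = amap (mtgt ?t) g \<cdot>\<^bsub>C\<^esub> mcomp ?t (Dom B g)"
    using mcomp_E[of "FObjArr a g"] by (simp add: unbar_mnt_def)
next
  let ?t = "mcomp (unbar_mnt A B C \<tau>) a"
  fix b b' assume [simp]: "b \<in> Obj B" "b' \<in> Obj B"
  show "mcomp ?t (b \<otimes>\<^bsub>B\<^esub> b') \<cdot>\<^bsub>C\<^esub> phi2 (msrc ?t) b b' =
      phi2 (mtgt ?t) b b' \<cdot>\<^bsub>C\<^esub> (mcomp ?t b \<boxtimes>\<^bsub>C\<^esub> mcomp ?t b')"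
    using mcomp_E[of "FDelta a b b'"] by (simp add: unbar_mnt_def)
qed (simp_all add: unbar_mnt_def hom_iff F.sm_functor_unbar_obj G.sm_functor_unbar_obj)

lemma monoidal_transformation_unbar_mnt:
  "monoidal_transformation A (ihom B C) (unbar_mnt A B C \<tau>)"
proof (rule monoidal_transformationI)
  let ?t = "unbar_mnt A B C \<tau>"
  show "sm_functor A (ihom B C) (msrc ?t)" "sm_functor A (ihom B C) (mtgt ?t)"
    by (simp_all add: unbar_mnt_def F.sm_functor_unbar G.sm_functor_unbar)
  show "mcomp ?t \<in> extensional (Obj A)"
    by (simp add: unbar_mnt_def)
  show "mcomp ?t (Unt A) \<cdot>\<^bsub>ihom B C\<^esub> phi0 (msrc ?t) = phi0 (mtgt ?t)"
    using mcomp_E[of "FAlpha b" for b]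
    by (intro mnt_eqI[where S = "Obj B"]) (simp_all add: unbar_mnt_def)
  fix f assume [simp]: "f \<in> Arr A"
  show "mcomp ?t (Cod A f) \<cdot>\<^bsub>ihom B C\<^esub> amap (msrc ?t) f = amap (mtgt ?t) f \<cdot>\<^bsub>ihom B C\<^esub> mcomp ?t (Dom A f)"
    using mcomp_E[of "FArrObj f b" for b]
    by (intro mnt_eqI[where S = "Obj B"]) (simp_all add: unbar_mnt_def)
next
  let ?t = "unbar_mnt A B C \<tau>"
  fix a assume a [simp]: "a \<in> Obj A"
  show "mcomp ?t a \<in> hom (ihom B C) (omap (msrc ?t) a) (omap (mtgt ?t) a)"
    using monoidal_transformation_unbar_component[OF a] by (simp add: unbar_mnt_def hom_iff)
  fix a' assume a' [simp]: "a' \<in> Obj A"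
  show "mcomp ?t (a \<otimes>\<^bsub>A\<^esub> a') \<cdot>\<^bsub>ihom B C\<^esub> phi2 (msrc ?t) a a' =
      phi2 (mtgt ?t) a a' \<cdot>\<^bsub>ihom B C\<^esub> (mcomp ?t a \<boxtimes>\<^bsub>ihom B C\<^esub> mcomp ?t a')"
    using mcomp_E[of "FGamma a a' b" for b]
    by (intro mnt_eqI[where S = "Obj B"]) (simp_all add: unbar_mnt_def)
qed

lemma bar_unbar_mnt: "bar_mnt A B C (unbar_mnt A B C \<tau>) = \<tau>"
proof -
  have "bar_mnt_word C (unbar_mnt A B C \<tau>) X = mcomp \<tau> X" if "word_ok A B X" for X
    using that by (induction X) (simp_all add: unbar_mnt_def)
  then show ?thesis
    using t.mcomp_ext F.bar_unbar G.bar_unbar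
    by (intro mnt_eqI[where S = "Obj (tensor A B)"]) (simp_all add: bar_mnt_def unbar_mnt_def)
qed

end

lemma (in bilinear_transformation) unbar_bar_mnt: "unbar_mnt A B C (bar_mnt A B C \<sigma>) = \<sigma>"
proof -
  have "mcomp (unbar_mnt A B C (bar_mnt A B C \<sigma>)) a = mcomp \<sigma> a" if a [simp]: "a \<in> Obj A" for a
    using monoidal_transformation.mcomp_ext[OF monoidal_transformation_mcomp[OF a]]
    by (intro mnt_eqI[where S = "Obj B"])
      (simp_all add: unbar_mnt_def F.unbar_obj_bar G.unbar_obj_bar)
  then show ?thesis
    using s.mcomp_ext
    by (intro mnt_eqI[where S = "Obj A"]) (simp_all add: unbar_mnt_def F.unbar_bar G.unbar_bar)
qed

section \<open>The isomorphism\<close>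

text \<open>The values of \<^const>\<open>En\<close> are strict, so the same pair of maps serves for the functor into the
  subcategory and for its composite with the inclusion.\<close>

locale smc_triple = smc_pair A B + C: smc C
  for A :: "('a, 'f) smc" and B :: "('b, 'g) smc" and C :: "('c, 'h) smc"
begin

lemma bilinear: "F \<in> Obj (SMC A (ihom B C)) \<Longrightarrow> bilinear A B C F"
  by (auto intro!: bilinear.intro smc_pair_axioms C.smc_axioms)

lemma bilinear_transformation: "\<sigma> \<in> Arr (SMC A (ihom B C)) \<Longrightarrow> bilinear_transformation A B C \<sigma>"
  by (auto intro!: bilinear_transformation.intro smc_pair_axioms C.smc_axioms)

lemma strict_tensor_functor: "G \<in> Obj (StrSMC (tensor A B) C) \<Longrightarrow> strict_tensor_functor A B C G"
  by (auto intro!: strict_tensor_functor.intro strict_tensor_functor_axioms.intro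
      smc_pair_axioms C.smc_axioms)

lemma strict_tensor_transformation:
  "\<tau> \<in> Arr (StrSMC (tensor A B) C) \<Longrightarrow> strict_tensor_transformation A B C \<tau>"
  by (auto intro!: strict_tensor_transformation.intro strict_tensor_transformation_axioms.intro
      smc_pair_axioms C.smc_axioms)

lemma category_SMC_ihom: "category (SMC A (ihom B C))"
  by (rule category_SMC[OF A.tensor_closed_axioms tensor_category_ihom[OF B.smc_axioms C.smc_axioms]])

lemma category_SMC_tensor: "category (SMC (tensor A B) C)"
  by (rule category_SMC[OF T.tensor_closed_axioms C.tensor_category_axioms])

lemma cat_functor_En: "cat_functor (SMC A (ihom B C)) (StrSMC (tensor A B) C) (En A B C)"
proof (rule cat_functorI)
  show "category (SMC A (ihom B C))" "category (StrSMC (tensor A B) C)"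
    by (rule category_SMC_ihom category_StrSMC[OF category_SMC_tensor])+
  interpret S: category "SMC A (ihom B C)" by (rule category_SMC_ihom)
  show "omap (En A B C) F \<in> Obj (StrSMC (tensor A B) C)" if F: "F \<in> Obj (SMC A (ihom B C))" for F
    using bilinear.sm_functor_bar[OF bilinear[OF F]] bilinear.strict_bar[OF bilinear[OF F]] F
    by (simp add: En_def)
  show "amap (En A B C) (Idn (SMC A (ihom B C)) F) = Idn (StrSMC (tensor A B) C) (omap (En A B C) F)"
    if F: "F \<in> Obj (SMC A (ihom B C))" for F
    using bar_mnt_Idn[OF C.smc_axioms, of F] S.Idn_typing(1)[OF F] F
    by (simp add: En_def del: SMC_simps(2,5))
  fix \<sigma> assume s: "\<sigma> \<in> Arr (SMC A (ihom B C))"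
  interpret s: bilinear_transformation A B C \<sigma> by (rule bilinear_transformation[OF s])
  show "amap (En A B C) \<sigma> \<in> hom (StrSMC (tensor A B) C)
      (omap (En A B C) (Dom (SMC A (ihom B C)) \<sigma>)) (omap (En A B C) (Cod (SMC A (ihom B C)) \<sigma>))"
    using s s.monoidal_transformation_bar_mnt s.F.strict_bar s.G.strict_bar
      s.s.F.sm_functor_axioms s.s.G.sm_functor_axioms
    by (simp add: En_def hom_iff)
  fix \<tau> assume t: "\<tau> \<in> Arr (SMC A (ihom B C))" and st: "Cod (SMC A (ihom B C)) \<sigma> = Dom (SMC A (ihom B C)) \<tau>"
  show "amap (En A B C) (\<tau> \<cdot>\<^bsub>SMC A (ihom B C)\<^esub> \<sigma>) =
      amap (En A B C) \<tau> \<cdot>\<^bsub>StrSMC (tensor A B) C\<^esub> amap (En A B C) \<sigma>"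
    using bar_mnt_Comp[OF C.smc_axioms, of \<sigma> \<tau>] S.comp_typing(1)[OF s t st] s t st
    by (simp add: En_def del: SMC_simps(2,6)) simp
qed (simp_all add: En_def del: SMC_simps)

lemma cat_iso_En: "cat_iso (SMC A (ihom B C)) (StrSMC (tensor A B) C) (En A B C)"
proof (rule cat_isoI[where u = "unbar A B C" and v = "unbar_mnt A B C"])
  show "unbar A B C G \<in> Obj (SMC A (ihom B C)) \<and> omap (En A B C) (unbar A B C G) = G"
    if "G \<in> Obj (StrSMC (tensor A B) C)" for G
    using strict_tensor_functor.sm_functor_unbar[OF strict_tensor_functor[OF that]]
      strict_tensor_functor.bar_unbar[OF strict_tensor_functor[OF that]]
    by (simp add: En_def)
  show "unbar A B C (omap (En A B C) F) = F" if "F \<in> Obj (SMC A (ihom B C))" for F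
    using bilinear.unbar_bar[OF bilinear[OF that]] that by (simp add: En_def)
  show "unbar_mnt A B C \<tau> \<in> Arr (SMC A (ihom B C)) \<and> amap (En A B C) (unbar_mnt A B C \<tau>) = \<tau>"
    if "\<tau> \<in> Arr (StrSMC (tensor A B) C)" for \<tau>
    using strict_tensor_transformation.monoidal_transformation_unbar_mnt[OF strict_tensor_transformation[OF that]]
      strict_tensor_transformation.bar_unbar_mnt[OF strict_tensor_transformation[OF that]]
    by (simp add: En_def)
  show "unbar_mnt A B C (amap (En A B C) \<sigma>) = \<sigma>" if "\<sigma> \<in> Arr (SMC A (ihom B C))" for \<sigma>
    using bilinear_transformation.unbar_bar_mnt[OF bilinear_transformation[OF that]] that
    by (simp add: En_def)
qed (rule cat_functor_En)

end

theorem corollary14p5: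
  fixes A :: "('a, 'f) smc" and B :: "('b, 'g) smc" and C :: "('c, 'h) smc"
  assumes "smc A" and "smc B" and "smc C"
  shows "(\<forall>F \<in> Obj (SMC A (ihom B C)). \<forall>p. formal_ok A B p \<longrightarrow>
            amap (bar A B C F) (fclass A B p) = bar_formal C F p) \<and>
         cat_functor (SMC A (ihom B C)) (SMC (tensor A B) C) (En A B C) \<and>
         cat_functor (StrSMC (tensor A B) C) (SMC (tensor A B) C) (StrSMC_incl (tensor A B) C) \<and>
         (\<exists>K. cat_iso (SMC A (ihom B C)) (StrSMC (tensor A B) C) K \<and>
            En A B C = ftor_comp (SMC A (ihom B C)) (StrSMC_incl (tensor A B) C) K)"
proof -
  interpret smc_triple A B C
    by (intro smc_triple.intro smc_pair.intro assms)
  have incl: "cat_functor (StrSMC (tensor A B) C) (SMC (tensor A B) C) (StrSMC_incl (tensor A B) C)"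
    by (rule cat_functor_StrSMC_incl[OF category_SMC_tensor])
  have En: "ftor_comp (SMC A (ihom B C)) (StrSMC_incl (tensor A B) C) (En A B C) = En A B C"
    by (rule ftor_comp_StrSMC_incl[OF cat_functor_En])
  show ?thesis
    using bilinear.bar_fclass[OF bilinear] cat_functor_comp[OF cat_functor_En incl] incl cat_iso_En
    unfolding En by (auto intro: exI[of _ "En A B C"] simp: En simp del: SMC_simps)
qed

end
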